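(* Let $\mathbf{s}=(s_i)_{i=1}^\infty$ be a nonnegative nonincreasing sequence and let $\mathbf{d}=(d_i)_{i=1}^\infty$ be a complex-valued sequence, both tending to zero. Let $|\mathbf{d}|^*=(|d|^*_i)_{i=1}^\infty$ denote the nonincreasing rearrangement of $(|d_i|)_{i=1}^\infty$. Then there is a compact operator $A$ with singular value sequence $\mathbf{s}$ and diagonal $\mathbf{d}$ if and only if $$\sum_{i=1}^k |d|^*_i\le \sum_{i=1}^k s_i\quad\text{for all }k\in\mathbb{N}.$$ Moreover, if $\mathbf{d}$ is real-valued then the same statement holds over real Hilbert space (i.e. with $A$ a compact operator on a real Hilbert space).
   Context: Hilbert spaces are separable and infinite-dimensional (with orthonormal bases indexed by $\mathbb{N}$), complex unless stated otherwise. A sequence $\mathbf{d}=(d_j)_{j=1}^\infty$ is a diagonal of an operator $A$ if there is an orthonormal basis $\{e_j\}_{j=1}^\infty$ with $\langle Ae_j,e_j\rangle=d_j$ for all $j$. For a compact operator $A$, the singular value sequence is $s(A)=(s_1(A),s_2(A),\ldots)$, where $s_i(A)$ is the $i$-th largest square root of an eigenvalue of $A^*A$, counting multiplicity; thus if $A$ has infinite rank, $s(A)$ consists only of the positive singular values (zeros are omitted even if $A$ has nontrivial kernel), and if $A$ has finite rank, $s(A)$ ends in zeros. For a nonnegative sequence tending to zero, its nonincreasing rearrangement is the sequence whose $i$-th term is the $i$-th largest term of the original sequence, respecting multiplicity (so zeros are dropped when the support is infinite). *)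

theory Defs
  imports "HOL-Analysis.Analysis"
begin

text \<open>
  A complex inner product space carries the real inner product \<open>Re \<langle>x, y\<rangle>\<close>; building the class on
  \<^class>\<open>real_inner\<close> makes the norm and the topology those of the library.
  The complex inner product is linear in the first argument.
\<close>

class complex_inner = real_inner +
  fixes scaleC :: "complex \<Rightarrow> 'a \<Rightarrow> 'a"  (infixr \<open>*\<^sub>C\<close> 75)
    and cinner :: "'a \<Rightarrow> 'a \<Rightarrow> complex"
  assumes scaleC_add_right: "c *\<^sub>C (x + y) = c *\<^sub>C x + c *\<^sub>C y"
    and scaleC_add_left: "(b + c) *\<^sub>C x = b *\<^sub>C x + c *\<^sub>C x"
    and scaleC_scaleC: "b *\<^sub>C (c *\<^sub>C x) = (b * c) *\<^sub>C x"
    and scaleC_of_real: "complex_of_real r *\<^sub>C x = r *\<^sub>R x"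
    and cinner_add_left: "cinner (x + y) z = cinner x z + cinner y z"
    and cinner_scaleC_left: "cinner (c *\<^sub>C x) y = c * cinner x y"
    and cinner_commute: "cinner x y = cnj (cinner y x)"
    and Re_cinner: "Re (cinner x y) = inner x y"

lemma vector_space_scaleC: "vector_space (scaleC :: complex \<Rightarrow> 'a::complex_inner \<Rightarrow> 'a)"
proof
  fix x :: 'a
  show "1 *\<^sub>C x = x"
    using scaleC_of_real[of 1 x] by simp
qed (simp_all add: scaleC_add_right scaleC_add_left scaleC_scaleC)

definition cspan :: "'a::complex_inner set \<Rightarrow> 'a set" where
  "cspan = module.span scaleC"

definition cindependent :: "'a::complex_inner set \<Rightarrow> bool" where
  "cindependent B \<longleftrightarrow> \<not> module.dependent scaleC B"

definition onb :: "(nat \<Rightarrow> 'a::real_inner) \<Rightarrow> bool" where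
  "onb e \<longleftrightarrow> (\<forall>i j. inner (e i) (e j) = of_bool (i = j)) \<and> closure (span (range e)) = UNIV"

definition conb :: "(nat \<Rightarrow> 'a::complex_inner) \<Rightarrow> bool" where
  "conb e \<longleftrightarrow> (\<forall>i j. cinner (e i) (e j) = of_bool (i = j)) \<and> closure (cspan (range e)) = UNIV"

definition diagonal :: "('a::real_inner \<Rightarrow> 'a) \<Rightarrow> (nat \<Rightarrow> real) \<Rightarrow> bool" where
  "diagonal A d \<longleftrightarrow> (\<exists>e. onb e \<and> (\<forall>j. inner (A (e j)) (e j) = d j))"

definition cdiagonal :: "('a::complex_inner \<Rightarrow> 'a) \<Rightarrow> (nat \<Rightarrow> complex) \<Rightarrow> bool" where
  "cdiagonal A d \<longleftrightarrow> (\<exists>e. conb e \<and> (\<forall>j. cinner (A (e j)) (e j) = d j))"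

definition compact_operator :: "('a::real_inner \<Rightarrow> 'a) \<Rightarrow> bool" where
  "compact_operator A \<longleftrightarrow> bounded_linear A \<and> compact (closure (A ` cball 0 1))"

definition ccompact_operator :: "('a::complex_inner \<Rightarrow> 'a) \<Rightarrow> bool" where
  "ccompact_operator A \<longleftrightarrow> compact_operator A \<and> (\<forall>c x. A (c *\<^sub>C x) = c *\<^sub>C A x)"

text \<open>The complex counterpart of \<^const>\<open>adjoint\<close>.\<close>

definition cadjoint :: "('a::complex_inner \<Rightarrow> 'a) \<Rightarrow> 'a \<Rightarrow> 'a" where
  "cadjoint A = (SOME A'. \<forall>x y. cinner (A x) y = cinner x (A' y))"

text \<open>
  The \<open>(n+1)\<close>-th largest member of the family \<open>(f i)\<close>, \<open>i \<in> I\<close>, respecting multiplicity: the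
  greatest \<open>t\<close> such that at least \<open>n + 1\<close> members are \<open>\<ge> t\<close>. For a nonnegative null family the
  zeros are dropped when infinitely many members are positive; otherwise they form the tail.
\<close>

definition nth_largest :: "('i \<Rightarrow> real) \<Rightarrow> 'i set \<Rightarrow> nat \<Rightarrow> real" where
  "nth_largest f I n = (GREATEST t. \<exists>J\<subseteq>I. card J = Suc n \<and> (\<forall>j\<in>J. t \<le> f j))"

definition rearrangement :: "(nat \<Rightarrow> real) \<Rightarrow> nat \<Rightarrow> real" where
  "rearrangement f = nth_largest f UNIV"

text \<open>
  Eigenvalues of \<open>A\<^sup>* A\<close> are real, and each is listed with multiplicity as the pairs \<open>(\<mu>, k)\<close>
  for \<open>k\<close> below the (possibly infinite) dimension of its eigenspace.
\<close>

definition singular_values :: "('a::real_inner \<Rightarrow> 'a) \<Rightarrow> nat \<Rightarrow> real" where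
  "singular_values A = nth_largest (\<lambda>(\<mu>, k). sqrt \<mu>)
     {(\<mu>, k::nat). \<exists>B \<subseteq> {x. adjoint A (A x) = \<mu> *\<^sub>R x}. independent B \<and> card B = Suc k}"

definition csingular_values :: "('a::complex_inner \<Rightarrow> 'a) \<Rightarrow> nat \<Rightarrow> real" where
  "csingular_values A = nth_largest (\<lambda>(\<mu>, k). sqrt \<mu>)
     {(\<mu>, k::nat). \<exists>B \<subseteq> {x. cadjoint A (A x) = complex_of_real \<mu> *\<^sub>C x}.
        cindependent B \<and> card B = Suc k}"

end

theory Submission
  imports Defs "HOL-Complex_Analysis.Great_Picard"
begin

text \<open>
  Necessity. The vectors maximising \<open>norm (A x)\<close> on successive orthogonal complements are eigenvectors of
  \<open>A\<^sup>*A\<close> and give the singular values. For a finite set \<open>J\<close> with \<open>k\<close> elements, splitting off the first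
  \<open>k\<close> singular vectors on both sides bounds \<open>\<Sum>j\<in>J. cmod (d j)\<close> by the sum of the first \<open>k\<close> singular
  values, using only Bessel's inequality.

  Sufficiency. It is enough to find real matrices \<open>U\<close> and \<open>W\<close> with orthonormal rows and
  \<open>(\<Sum>i. s i * (U i j * W i j)) = cmod (d j)\<close>: then \<open>A = (\<Sum>i. s i * \<langle>\<cdot>, w i\<rangle> * u i)\<close>, where
  \<open>w i\<close> and \<open>u i\<close> have the rows as coordinates and the phases of \<open>d\<close> go into the basis used for \<open>u\<close>.
  Horn's algorithm realises finitely many diagonal entries, and a pointwise limit of the resulting
  matrices is a contraction \<open>V\<close> with \<open>(\<Sum>i. s i * (V i j)\<^sup>2) = cmod (d j)\<close>.
  If the partial sums of \<open>s\<close> and of the rearranged \<open>d\<close> come arbitrarily close to each other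
  infinitely often, no mass can be lost in the limit, and \<open>V\<close> already has orthonormal rows.
  Otherwise there is room to replace infinitely many pairs of small entries of \<open>d\<close> by their sum and a
  zero; on the zero columns \<open>V\<close> can be dilated to orthonormal rows, and rotating each pair of
  coordinates restores the original entries.
\<close>

subsection \<open>Finitely many diagonal entries\<close>

text \<open>Pointwise limits keep the diagonal but not orthonormality: part of a row of
  \<open>V\<close> may escape to infinity, and an operator built from short rows need not have the
  singular values \<open>s\<close>. A row can be lengthened only where the diagonal is not affected.
  This is why two matrices are sought: \<open>s i * (U i j * W i j)\<close> does not change when
  \<open>U\<close> is altered in a column in which \<open>W\<close> vanishes, whereas in
  \<open>s i * (V i j)\<^sup>2\<close> every added entry with \<open>s i > 0\<close> counts. Columns
  where both vanish are produced by merging; merging increases partial sums of the diagonal and has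
  to be paid for by slack. Where no slack exists, comparing partial sums shows that nothing has
  escaped. Rows with \<open>s i = 0\<close> do not enter the diagonal and can be left free until the
  end. Majorisation is used in the form \<open>sum d J \<le> sum s {..<card J}\<close> for finite
  \<open>J\<close>, so that \<open>d\<close> is never reordered.\<close>

lemma sum_merge_adjacent:
  fixes g h :: "nat \<Rightarrow> real"
  assumes "\<And>l. l < i \<Longrightarrow> g l = h l" "g i + g (Suc i) = h i" "\<And>l. i < l \<Longrightarrow> g (Suc l) = h l" "i < N"
  shows "sum g {..<Suc N} = sum h {..<N}"
  using assms(4)
proof (induction N)
  case (Suc N)
  show ?case
  proof (cases "i < N")
    case True
    then show ?thesis using Suc assms(3)[of N] by simp
  next
    case False
    then have [simp]: "N = i" using Suc by simp
    have "sum g {..<i} = sum h {..<i}" using assms(1) by (intro sum.cong) auto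
    then show ?thesis using assms(2) by simp
  qed
qed simp

lemma sum_extend_zero:
  fixes g :: "nat \<Rightarrow> real"
  assumes "\<And>i. i \<ge> N \<Longrightarrow> g i = 0" "N \<le> M"
  shows "sum g {..<M} = sum g {..<N}"
  using assms by (intro sum.mono_neutral_right) auto

text \<open>A vector \<open>f j\<close> with \<open>d j = 0\<close> is taken to be zero, since a strictly positive \<open>s\<close> admits no
  unit vector with vanishing quadratic form.\<close>

lemma finite_schur_horn:
  fixes s d :: "nat \<Rightarrow> real"
  assumes "decseq s" "\<And>i. 0 \<le> s i" "s \<longlonglongrightarrow> 0" "\<And>j. 0 \<le> d j"
    and "\<And>J. J \<subseteq> {..<n} \<Longrightarrow> sum d J \<le> sum s {..<card J}"
  shows "\<exists>f N. (\<forall>j<n. \<forall>i\<ge>N. f j i = 0) \<and>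
    (\<forall>j<n. \<forall>j'<n. (\<Sum>i<N. f j i * f j' i) = of_bool (j = j' \<and> 0 < d j)) \<and>
    (\<forall>j<n. (\<Sum>i<N. s i * (f j i)\<^sup>2) = d j)"
  using assms
proof (induction n arbitrary: s)
  case 0
  then show ?case by auto
next
  case (Suc n)
  have sub: "J \<subseteq> {..<Suc n}" if "J \<subseteq> {..<n}" for J using that by force
  note dec = Suc.prems(1) and s0 = Suc.prems(2) and lim = Suc.prems(3) and d0 = Suc.prems(4)
    and maj = Suc.prems(5)
  define x where "x = d n"
  show ?case
  proof (cases "x = 0")
    case True
    obtain f N where f: "\<forall>j<n. \<forall>i\<ge>N. f j i = 0"
      "\<forall>j<n. \<forall>j'<n. (\<Sum>i<N. f j i * f j' i) = of_bool (j = j' \<and> 0 < d j)"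
      "\<forall>j<n. (\<Sum>i<N. s i * (f j i)\<^sup>2) = d j"
      using Suc.IH[OF dec s0 lim d0 maj[OF sub]] by blast
    show ?thesis
      using f True x_def by (intro exI[of _ "f(n := \<lambda>_. 0)"] exI[of _ N]) (auto simp: less_Suc_eq)
  next
    case False
    then have x0: "x > 0" using d0[of n] by (simp add: x_def)
    have ex: "\<exists>i. s (Suc i) \<le> x"
    proof -
      have "eventually (\<lambda>i. s i < x) sequentially" using lim x0 by (simp add: order_tendstoD)
      then show ?thesis unfolding eventually_sequentially by (meson le_SucI less_imp_le order_refl)
    qed
    \<comment> \<open>\<open>x\<close> is bracketed by two neighbours in \<open>s\<close>:
      minimality of \<open>i\<close> gives \<open>x \<le> s i\<close>, and for \<open>i = 0\<close>
      this is the hypothesis on the singleton \<open>{n}\<close>.\<close>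
    define i where "i = (LEAST i. s (Suc i) \<le> x)"
    have i1: "s (Suc i) \<le> x" unfolding i_def using ex by (rule LeastI_ex)
    have i2: "x \<le> s i"
    proof (cases i)
      case 0
      then show ?thesis using maj[of "{n}"] by (simp add: x_def)
    next
      case (Suc k)
      then have "\<not> s (Suc k) \<le> x" unfolding i_def by (intro not_less_Least) simp
      then show ?thesis using Suc by simp
    qed
    \<comment> \<open>\<open>c2\<close> and \<open>1 - c2\<close> are the squared coordinates of a
      unit vector in the plane of coordinates \<open>i\<close> and \<open>Suc i\<close> whose
      quadratic form is \<open>x\<close>.\<close>
    obtain c2 where c2: "0 \<le> c2" "c2 \<le> 1" "x = c2 * s i + (1 - c2) * s (Suc i)"
    proof (cases "s i = s (Suc i)")
      case True
      then show ?thesis using that[of 1] i1 i2 by simp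
    next
      case False
      then have l: "s i > s (Suc i)" using decseqD[OF dec, of i "Suc i"] by simp
      show ?thesis
        using that[of "(x - s (Suc i)) / (s i - s (Suc i))"] i1 i2 l
        by (simp add: divide_simps) (simp add: algebra_simps)
    qed
    define C where "C = sqrt c2"
    define T where "T = sqrt (1 - c2)"
    have CT: "C\<^sup>2 = c2" "T\<^sup>2 = 1 - c2" using c2 by (auto simp: C_def T_def)
    \<comment> \<open>The rest of that plane carries the remaining trace
      \<open>s i + s (Suc i) - x\<close>. So \<open>s'\<close> is the compression of the diagonal
      matrix \<open>s\<close> to the complement of the chosen vector, with the two coordinates fused
      into one.\<close>
    define s' where "s' l = (if l < i then s l else if l = i then s i + s (Suc i) - x else s (Suc l))" for l
    have dec': "decseq s'"
    proof (rule decseq_SucI)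
      fix l
      have a: "s i + s (Suc i) - x \<le> s i" "s (Suc i) \<le> s i + s (Suc i) - x" using i1 i2 by auto
      have b: "s (Suc l) \<le> s l" "s (Suc (Suc l)) \<le> s (Suc l)" using dec by (auto simp: decseq_Suc_iff)
      show "s' (Suc l) \<le> s' l"
        using a b by (cases "Suc l = i"; cases "l = i") (auto simp: s'_def)
    qed
    have s0': "0 \<le> s' l" for l
      using s0[of l] s0[of "Suc l"] s0[of "Suc i"] i2 by (auto simp: s'_def)
    have lim': "s' \<longlonglongrightarrow> 0"
    proof (rule Lim_transform_eventually[OF LIMSEQ_Suc[OF lim]])
      show "\<forall>\<^sub>F l in sequentially. s (Suc l) = s' l"
        unfolding eventually_sequentially by (intro exI[of _ "Suc i"]) (auto simp: s'_def)
    qed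
    have maj': "sum d J \<le> sum s' {..<card J}" if J: "J \<subseteq> {..<n}" for J
    proof (cases "card J \<le> i")
      case True
      then have "sum s' {..<card J} = sum s {..<card J}" by (intro sum.cong) (auto simp: s'_def)
      then show ?thesis using maj[OF sub[OF J]] by simp
    next
      case False
      have fin: "finite J" and nJ: "n \<notin> J" using J finite_subset by auto
      \<comment> \<open>Removing \<open>x\<close> at position \<open>i\<close> from the first
        \<open>Suc (card J)\<close> terms of \<open>s\<close> leaves the sum of the first
        \<open>card J\<close> terms of \<open>s'\<close>, and the hypothesis for
        \<open>insert n J\<close> loses the same \<open>x\<close>.\<close>
      define g where "g = (\<lambda>l. s l - (if l = i then x else 0))"
      have "sum g {..<Suc (card J)} = sum s' {..<card J}"
        using False by (intro sum_merge_adjacent[of i]) (auto simp: g_def s'_def)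
      moreover have "sum g {..<Suc (card J)} = sum s {..<Suc (card J)} - x"
        using False by (simp only: g_def sum_subtractf) (subst sum.delta; simp)
      moreover have "insert n J \<subseteq> {..<Suc n}" using J by auto
      then have "sum d (insert n J) \<le> sum s {..<card (insert n J)}" by (rule maj)
      then have "sum d J + x \<le> sum s {..<Suc (card J)}" using fin nJ by (simp add: x_def)
      ultimately show ?thesis by linarith
    qed
    obtain f N0 where f0: "\<forall>j<n. \<forall>i\<ge>N0. f j i = 0"
      "\<forall>j<n. \<forall>j'<n. (\<Sum>i<N0. f j i * f j' i) = of_bool (j = j' \<and> 0 < d j)"
      "\<forall>j<n. (\<Sum>i<N0. s' i * (f j i)\<^sup>2) = d j"
      using Suc.IH[OF dec' s0' lim' d0 maj'] by blast
    define N where "N = max N0 (Suc i)"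
    have N: "i < N" "N0 \<le> N" by (auto simp: N_def)
    have f1: "f j l = 0" if "j < n" "l \<ge> N" for j l using f0(1) that N by auto
    have f2: "(\<Sum>l<N. f j l * f j' l) = of_bool (j = j' \<and> 0 < d j)" if "j < n" "j' < n" for j j'
      using f0(1,2) that N by (subst sum_extend_zero[of N0]) auto
    have f3: "(\<Sum>l<N. s' l * (f j l)\<^sup>2) = d j" if "j < n" for j
      using f0(1,3) that N by (subst sum_extend_zero[of N0]) auto
    \<comment> \<open>The old vectors are carried over by sending coordinate \<open>i\<close> to the
      direction \<open>(-T, C)\<close>, orthogonal to the new vector \<open>(C, T)\<close> in the
      plane; later coordinates move up by one.\<close>
    define w where "w j l = (if j = n then (if l = i then C else if l = Suc i then T else 0)
      else if l < i then f j l else if l = i then - T * f j i else if l = Suc i then C * f j i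
      else f j (l - 1))" for j l
    have e: "s i * C\<^sup>2 + s (Suc i) * T\<^sup>2 = x"
      unfolding CT using c2(3) by (simp add: algebra_simps)
    have ct1: "T * T + C * C = 1" using CT by (simp add: power2_eq_square)
    have w1: "(\<Sum>l<Suc N. w j l * w j' l) = of_bool (j = j' \<and> 0 < d j)" if "j < n" "j' < n" for j j'
    proof -
      have "(\<Sum>l<Suc N. w j l * w j' l) = (\<Sum>l<N. f j l * f j' l)"
      proof (rule sum_merge_adjacent[of i])
        show "w j i * w j' i + w j (Suc i) * w j' (Suc i) = f j i * f j' i"
        proof -
          have "w j i * w j' i + w j (Suc i) * w j' (Suc i) = (T * T + C * C) * (f j i * f j' i)"
            using that by (simp add: w_def algebra_simps)
          then show ?thesis using ct1 by simp
        qed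
      qed (use that N in \<open>auto simp: w_def\<close>)
      then show ?thesis using f2[OF that] by simp
    qed
    have w2: "(\<Sum>l<Suc N. w n l * w j l) = 0" if "j < n" for j
    proof -
      have "(\<Sum>l<Suc N. w n l * w j l) = (\<Sum>l<N. 0)"
        by (rule sum_merge_adjacent[of i]) (use that N in \<open>auto simp: w_def\<close>)
      then show ?thesis by simp
    qed
    have w3: "(\<Sum>l<Suc N. w n l * w n l) = 1"
    proof -
      have "(\<Sum>l<Suc N. w n l * w n l) = (\<Sum>l<N. if l = i then 1 else 0)"
        by (rule sum_merge_adjacent[of i]) (use ct1 N in \<open>auto simp: w_def\<close>)
      then show ?thesis using N by simp
    qed
    have w4: "(\<Sum>l<Suc N. s l * (w n l)\<^sup>2) = x"
    proof -
      have "(\<Sum>l<Suc N. s l * (w n l)\<^sup>2) = (\<Sum>l<N. if l = i then x else 0)"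
        by (rule sum_merge_adjacent[of i]) (use e N in \<open>auto simp: w_def\<close>)
      then show ?thesis using N by simp
    qed
    have w5: "(\<Sum>l<Suc N. s l * (w j l)\<^sup>2) = d j" if "j < n" for j
    proof -
      have "(\<Sum>l<Suc N. s l * (w j l)\<^sup>2) = (\<Sum>l<N. s' l * (f j l)\<^sup>2)"
      proof (rule sum_merge_adjacent[of i])
        have "s i * (w j i)\<^sup>2 + s (Suc i) * (w j (Suc i))\<^sup>2 = (s i * T\<^sup>2 + s (Suc i) * C\<^sup>2) * (f j i)\<^sup>2"
          using that by (simp add: w_def algebra_simps power_mult_distrib)
        also have "s i * T\<^sup>2 + s (Suc i) * C\<^sup>2 = s' i"
          unfolding CT using c2(3) by (simp add: s'_def algebra_simps)
        finally show "s i * (w j i)\<^sup>2 + s (Suc i) * (w j (Suc i))\<^sup>2 = s' i * (f j i)\<^sup>2" .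
      qed (use that N in \<open>auto simp: w_def s'_def\<close>)
      then show ?thesis using f3[OF that] by simp
    qed
    have w6: "w j l = 0" if "j < Suc n" "l \<ge> Suc N" for j l
      using that f1[of j "l - 1"] N by (auto simp: w_def)
    have w7: "(\<Sum>l<Suc N. w j l * w n l) = 0" if "j < n" for j
      using w2[OF that] by (simp only: mult.commute)
    have "(\<Sum>l<Suc N. w j l * w j' l) = of_bool (j = j' \<and> 0 < d j)" if "j < Suc n" "j' < Suc n" for j j'
    proof (cases "j = n")
      case True
      then show ?thesis using w2[of j'] w3 x0 that unfolding x_def by (cases "j' = n") auto
    next
      case False
      then show ?thesis using w1[of j j'] w7[of j] that by (cases "j' = n") auto
    qed
    moreover have "(\<Sum>l<Suc N. s l * (w j l)\<^sup>2) = d j" if "j < Suc n" for j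
      using w4 w5[of j] that unfolding x_def by (cases "j = n") auto
    ultimately show ?thesis using w6 by blast
  qed
qed

subsection \<open>The limit contraction\<close>

text \<open>The squared distance from \<open>a\<close> to its projection, with coefficients
  \<open>t j\<close>, is nonnegative. The predicate \<open>P\<close> admits zero vectors in the
  family, as \<open>finite_schur_horn\<close> produces them.\<close>

lemma bessel_finite:
  fixes f :: "nat \<Rightarrow> nat \<Rightarrow> real"
  assumes G: "\<And>j j'. j < n \<Longrightarrow> j' < n \<Longrightarrow> (\<Sum>i<N. f j i * f j' i) = of_bool (j = j' \<and> P j)"
  shows "(\<Sum>j<n. (\<Sum>i<N. a i * f j i)\<^sup>2) \<le> (\<Sum>i<N. (a i)\<^sup>2)"
proof -
  define t where "t j = (\<Sum>i<N. a i * f j i)" for j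
  have 1: "(\<Sum>i<N. a i * (\<Sum>j<n. t j * f j i)) = (\<Sum>j<n. (t j)\<^sup>2)"
  proof -
    have "(\<Sum>i<N. a i * (\<Sum>j<n. t j * f j i)) = (\<Sum>j<n. \<Sum>i<N. a i * (t j * f j i))"
      by (subst sum.swap) (simp add: sum_distrib_left)
    also have "\<dots> = (\<Sum>j<n. t j * t j)"
      by (rule sum.cong) (simp_all add: t_def sum_distrib_left sum_distrib_right mult_ac)
    finally show ?thesis by (simp add: power2_eq_square)
  qed
  have 2: "(\<Sum>i<N. (\<Sum>j<n. t j * f j i)\<^sup>2) \<le> (\<Sum>j<n. (t j)\<^sup>2)"
  proof -
    have "(\<Sum>i<N. (\<Sum>j<n. t j * f j i)\<^sup>2) = (\<Sum>i<N. \<Sum>j<n. \<Sum>j'<n. t j * t j' * (f j i * f j' i))"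
      by (simp add: power2_eq_square sum_product mult_ac)
    also have "\<dots> = (\<Sum>j<n. \<Sum>i<N. \<Sum>j'<n. t j * t j' * (f j i * f j' i))"
      by (rule sum.swap)
    also have "\<dots> = (\<Sum>j<n. \<Sum>j'<n. \<Sum>i<N. t j * t j' * (f j i * f j' i))"
      by (intro sum.cong refl sum.swap)
    also have "\<dots> = (\<Sum>j<n. \<Sum>j'<n. t j * t j' * (\<Sum>i<N. f j i * f j' i))"
      by (simp add: sum_distrib_left)
    also have "\<dots> = (\<Sum>j<n. \<Sum>j'<n. t j * t j' * of_bool (j = j' \<and> P j))"
      by (intro sum.cong refl) (simp add: G)
    also have "\<dots> \<le> (\<Sum>j<n. (t j)\<^sup>2)"
    proof (rule sum_mono)
      fix j assume "j \<in> {..<n}"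
      have "(\<Sum>j'<n. t j * t j' * of_bool (j = j' \<and> P j)) = (\<Sum>j'<n. if j' = j then (t j)\<^sup>2 * of_bool (P j) else 0)"
        by (rule sum.cong) (auto simp: power2_eq_square)
      then show "(\<Sum>j'<n. t j * t j' * of_bool (j = j' \<and> P j)) \<le> (t j)\<^sup>2"
        using \<open>j \<in> {..<n}\<close> by simp
    qed
    finally show ?thesis .
  qed
  have "0 \<le> (\<Sum>i<N. (a i - (\<Sum>j<n. t j * f j i))\<^sup>2)" by (intro sum_nonneg) auto
  also have "\<dots> = (\<Sum>i<N. (a i)\<^sup>2) - 2 * (\<Sum>i<N. a i * (\<Sum>j<n. t j * f j i)) + (\<Sum>i<N. (\<Sum>j<n. t j * f j i)\<^sup>2)"
    by (simp add: power2_diff sum.distrib sum_subtractf sum_distrib_left mult_ac)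
  finally show ?thesis using 1 2 by (simp add: t_def)
qed

text \<open>Contractivity on coefficient vectors is expressed by finite square sections: each
  instance involves finitely many entries and so survives entrywise limits.\<close>

definition row_contraction :: "(nat \<Rightarrow> nat \<Rightarrow> real) \<Rightarrow> bool" where
  "row_contraction V \<longleftrightarrow> (\<forall>a m. (\<Sum>j<m. (\<Sum>i<m. a i * V i j)\<^sup>2) \<le> (\<Sum>i<m. (a i)\<^sup>2))"

lemma row_contractionD:
  "row_contraction V \<Longrightarrow> (\<Sum>j<m. (\<Sum>i<m. a i * V i j)\<^sup>2) \<le> (\<Sum>i<m. (a i)\<^sup>2)"
  by (simp add: row_contraction_def)

lemma row_contraction_sum:
  assumes "row_contraction V"
  shows "(\<Sum>j<k. (\<Sum>i<m. a i * V i j)\<^sup>2) \<le> (\<Sum>i<m. (a i)\<^sup>2)"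
proof -
  define M where "M = max k m"
  define b where "b i = (if i < m then a i else 0)" for i
  have e: "(\<Sum>i<M. b i * V i j) = (\<Sum>i<m. a i * V i j)" for j
    by (subst sum_extend_zero[of m]) (auto simp: b_def M_def)
  have e2: "(\<Sum>i<M. (b i)\<^sup>2) = (\<Sum>i<m. (a i)\<^sup>2)"
    by (subst sum_extend_zero[of m]) (auto simp: b_def M_def)
  have "(\<Sum>j<k. (\<Sum>i<m. a i * V i j)\<^sup>2) \<le> (\<Sum>j<M. (\<Sum>i<m. a i * V i j)\<^sup>2)"
    by (rule sum_mono2) (auto simp: M_def)
  also have "\<dots> \<le> (\<Sum>i<m. (a i)\<^sup>2)"
    using row_contractionD[OF assms, where a = b and m = M] by (simp add: e e2)
  finally show ?thesis .
qed

text \<open>The column itself serves as the coefficient vector: with \<open>t\<close> its truncated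
  squared norm, contractivity gives \<open>t\<^sup>2 \<le> t\<close>.\<close>

lemma row_contraction_column:
  assumes "row_contraction V"
  shows "(\<Sum>i<m. (V i j)\<^sup>2) \<le> 1"
proof -
  define t where "t = (\<Sum>i<m. (V i j)\<^sup>2)"
  have t0: "t \<ge> 0" by (simp add: t_def sum_nonneg)
  have "t\<^sup>2 \<le> (\<Sum>j'<Suc j. (\<Sum>i<m. V i j * V i j')\<^sup>2)"
    by (simp add: t_def power2_eq_square[of "V _ _"] sum_nonneg)
  also have "\<dots> \<le> t" unfolding t_def by (rule row_contraction_sum[OF assms])
  finally have "t * t \<le> 1 * t" by (simp add: power2_eq_square)
  then show ?thesis using t0 unfolding t_def[symmetric]
    by (metis less_eq_real_def mult_le_cancel_right not_less zero_le_one)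
qed

lemma row_contraction_row:
  assumes "row_contraction V"
  shows "(\<Sum>j<m. (V i j)\<^sup>2) \<le> 1"
proof -
  let ?a = "\<lambda>i'. if i' = i then 1 else 0 :: real"
  have "(\<Sum>j<m. (\<Sum>i'<Suc i. ?a i' * V i' j)\<^sup>2) \<le> (\<Sum>i'<Suc i. (?a i')\<^sup>2)"
    by (rule row_contraction_sum[OF assms])
  then show ?thesis by simp
qed

text \<open>Column norms at most 1 bound the tail of \<open>\<Sum>i. s i * (F i j)\<^sup>2\<close>
  from \<open>M\<close> on by \<open>s M\<close>, uniformly over the finite problems. This
  uniformity lets the diagonal pass to the entrywise limit, while orthonormality may be
  lost.\<close>

lemma schur_horn_row_contraction:
  fixes s d :: "nat \<Rightarrow> real"
  assumes dec: "decseq s" and s0: "\<And>i. 0 \<le> s i" and lim: "s \<longlonglongrightarrow> 0" and d0: "\<And>j. 0 \<le> d j"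
    and maj: "\<And>J. finite J \<Longrightarrow> sum d J \<le> sum s {..<card J}"
  obtains V where "row_contraction V" "\<And>j. (\<lambda>i. s i * (V i j)\<^sup>2) sums d j"
proof -
  have "\<exists>F. row_contraction F \<and> (\<forall>j<n. \<forall>M. \<bar>(\<Sum>i<M. s i * (F i j)\<^sup>2) - d j\<bar> \<le> s M)" for n
  proof -
    have m: "sum d J \<le> sum s {..<card J}" if "J \<subseteq> {..<n}" for J
      using maj finite_subset[OF that] by blast
    obtain f N where "\<forall>j<n. \<forall>i\<ge>N. f j i = 0"
      "\<forall>j<n. \<forall>j'<n. (\<Sum>i<N. f j i * f j' i) = of_bool (j = j' \<and> 0 < d j)"
      "\<forall>j<n. (\<Sum>i<N. s i * (f j i)\<^sup>2) = d j"
      using finite_schur_horn[OF dec s0 lim d0 m] by blast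
    then have f: "\<And>j i. j < n \<Longrightarrow> i \<ge> N \<Longrightarrow> f j i = 0"
      "\<And>j j'. j < n \<Longrightarrow> j' < n \<Longrightarrow> (\<Sum>i<N. f j i * f j' i) = of_bool (j = j' \<and> 0 < d j)"
      "\<And>j. j < n \<Longrightarrow> (\<Sum>i<N. s i * (f j i)\<^sup>2) = d j"
      by simp_all
    \<comment> \<open>The vectors become the columns; Bessel's inequality for them is exactly
      contractivity of the rows.\<close>
    define F where "F i j = (if j < n then f j i else 0)" for i j
    have rc: "row_contraction F"
      unfolding row_contraction_def
    proof (intro allI)
      fix a :: "nat \<Rightarrow> real" and m
      define b where "b i = (if i < m then a i else 0)" for i
      have e: "(\<Sum>i<m. a i * F i j) = (\<Sum>i<N. b i * f j i)" if "j < n" for j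
      proof -
        have "(\<Sum>i<m. a i * F i j) = (\<Sum>i<max m N. b i * f j i)"
          using that by (subst sum_extend_zero[of m]) (auto simp: b_def F_def)
        also have "\<dots> = (\<Sum>i<N. b i * f j i)"
          using that f(1) by (subst sum_extend_zero[of N]) auto
        finally show ?thesis .
      qed
      have "(\<Sum>j<m. (\<Sum>i<m. a i * F i j)\<^sup>2) \<le> (\<Sum>j<max m n. (\<Sum>i<m. a i * F i j)\<^sup>2)"
        by (rule sum_mono2) auto
      also have "\<dots> = (\<Sum>j<n. (\<Sum>i<m. a i * F i j)\<^sup>2)"
        by (subst sum_extend_zero[of n]) (auto simp: F_def)
      also have "\<dots> = (\<Sum>j<n. (\<Sum>i<N. b i * f j i)\<^sup>2)"
        by (rule sum.cong) (auto simp: e)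
      also have "\<dots> \<le> (\<Sum>i<N. (b i)\<^sup>2)" by (rule bessel_finite[OF f(2)])
      also have "\<dots> \<le> (\<Sum>i<max m N. (b i)\<^sup>2)" by (rule sum_mono2) auto
      also have "\<dots> = (\<Sum>i<m. (a i)\<^sup>2)" by (subst sum_extend_zero[of m]) (auto simp: b_def)
      finally show "(\<Sum>j<m. (\<Sum>i<m. a i * F i j)\<^sup>2) \<le> (\<Sum>i<m. (a i)\<^sup>2)" .
    qed
    have "\<bar>(\<Sum>i<M. s i * (F i j)\<^sup>2) - d j\<bar> \<le> s M" if j: "j < n" for j M
    proof -
      have dj: "d j = (\<Sum>i<max M N. s i * (F i j)\<^sup>2)"
        using f(3)[OF j] f(1)[OF j] j by (subst sum_extend_zero[of N]) (auto simp: F_def)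
      have "d j = (\<Sum>i<M. s i * (F i j)\<^sup>2) + (\<Sum>i\<in>{M..<max M N}. s i * (F i j)\<^sup>2)"
        by (simp add: dj lessThan_atLeast0 sum.atLeastLessThan_concat)
      moreover have "0 \<le> (\<Sum>i\<in>{M..<max M N}. s i * (F i j)\<^sup>2)"
        by (intro sum_nonneg mult_nonneg_nonneg s0) auto
      moreover have "(\<Sum>i\<in>{M..<max M N}. s i * (F i j)\<^sup>2) \<le> s M"
      proof -
        have "(\<Sum>i\<in>{M..<max M N}. s i * (F i j)\<^sup>2) \<le> (\<Sum>i\<in>{M..<max M N}. s M * (F i j)\<^sup>2)"
          by (intro sum_mono mult_right_mono decseqD[OF dec]) auto
        also have "\<dots> \<le> (\<Sum>i<max M N. s M * (F i j)\<^sup>2)"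
          by (intro sum_mono2 mult_nonneg_nonneg s0) auto
        also have "\<dots> = s M * (\<Sum>i<max M N. (F i j)\<^sup>2)" by (simp add: sum_distrib_left)
        also have "\<dots> \<le> s M * 1"
          by (intro mult_left_mono row_contraction_column[OF rc] s0)
        finally show ?thesis by simp
      qed
      ultimately show ?thesis by linarith
    qed
    then show ?thesis using rc by blast
  qed
  then obtain F where rc: "\<And>n. row_contraction (F n)"
    and F: "\<And>n j M. j < n \<Longrightarrow> \<bar>(\<Sum>i<M. s i * (F n i j)\<^sup>2) - d j\<bar> \<le> s M"
    by metis
  have bnd: "norm (F n (fst p) (snd p)) \<le> 1" for n p
  proof -
    have "(F n (fst p) (snd p))\<^sup>2 \<le> (\<Sum>i<Suc (fst p). (F n i (snd p))\<^sup>2)"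
      by (simp add: sum_nonneg)
    also have "\<dots> \<le> 1" by (rule row_contraction_column[OF rc])
    finally show ?thesis by (simp add: abs_square_le_1)
  qed
  obtain k where k: "strict_mono (k :: nat \<Rightarrow> nat)"
    and "\<And>p. p \<in> UNIV \<Longrightarrow> \<exists>l. (\<lambda>n. F (k n) (fst p) (snd p)) \<longlonglongrightarrow> l"
    using function_convergent_subsequence[of UNIV "\<lambda>n p. F n (fst p) (snd p)" 1] bnd by auto
  then have "\<exists>l. (\<lambda>n. F (k n) i j) \<longlonglongrightarrow> l" for i j by (metis UNIV_I fst_conv snd_conv)
  then obtain V where V: "\<And>i j. (\<lambda>n. F (k n) i j) \<longlonglongrightarrow> V i j" by metis
  have "row_contraction V"
    unfolding row_contraction_def
  proof (intro allI)
    fix a :: "nat \<Rightarrow> real" and m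
    have "(\<lambda>n. \<Sum>j<m. (\<Sum>i<m. a i * F (k n) i j)\<^sup>2) \<longlonglongrightarrow> (\<Sum>j<m. (\<Sum>i<m. a i * V i j)\<^sup>2)"
      by (intro tendsto_intros V)
    then show "(\<Sum>j<m. (\<Sum>i<m. a i * V i j)\<^sup>2) \<le> (\<Sum>i<m. (a i)\<^sup>2)"
      by (rule LIMSEQ_le_const2) (use row_contractionD[OF rc] in blast)
  qed
  moreover have "(\<lambda>i. s i * (V i j)\<^sup>2) sums d j" for j
  proof -
    have "\<bar>(\<Sum>i<M. s i * (V i j)\<^sup>2) - d j\<bar> \<le> s M" for M
    proof (rule LIMSEQ_le_const2)
      show "(\<lambda>n. \<bar>(\<Sum>i<M. s i * (F (k n) i j)\<^sup>2) - d j\<bar>) \<longlonglongrightarrow> \<bar>(\<Sum>i<M. s i * (V i j)\<^sup>2) - d j\<bar>"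
        by (intro tendsto_intros V)
      show "\<exists>N. \<forall>n\<ge>N. \<bar>(\<Sum>i<M. s i * (F (k n) i j)\<^sup>2) - d j\<bar> \<le> s M"
        using F seq_suble[OF k] by (intro exI[of _ "Suc j"]) (meson Suc_le_lessD order_trans)
    qed
    then have "(\<lambda>M. (\<Sum>i<M. s i * (V i j)\<^sup>2) - d j) \<longlonglongrightarrow> 0"
      by (intro Lim_null_comparison[OF _ lim]) auto
    then show ?thesis by (simp add: sums_def LIM_zero_iff)
  qed
  ultimately show ?thesis using that by blast
qed

section \<open>Infinite rows and their Gram matrices\<close>

lemma square_sum_summable_on:
  fixes x :: "nat \<Rightarrow> real"
  assumes "\<And>m. (\<Sum>j<m. (x j)\<^sup>2) \<le> c"
  shows "(\<lambda>j. (x j)\<^sup>2) summable_on UNIV"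
proof -
  have "summable (\<lambda>j. (x j)\<^sup>2)"
    using assms by (intro summableI_nonneg_bounded[of _ c]) auto
  then show ?thesis by (subst summable_on_UNIV_nonneg_real_iff) auto
qed

lemma summable_on_mult_squares:
  fixes x y :: "'i \<Rightarrow> real"
  assumes "(\<lambda>j. (x j)\<^sup>2) summable_on A" "(\<lambda>j. (y j)\<^sup>2) summable_on A"
  shows "(\<lambda>j. x j * y j) summable_on A"
proof -
  have "(\<lambda>j. (x j)\<^sup>2 + (y j)\<^sup>2) summable_on A" using assms by (rule summable_on_add)
  then have "(\<lambda>j. norm (x j * y j)) summable_on A"
  proof (rule summable_on_comparison_test)
    fix j
    have "0 \<le> (\<bar>x j\<bar> - \<bar>y j\<bar>)\<^sup>2" by simp
    also have "\<dots> = (x j)\<^sup>2 + (y j)\<^sup>2 - 2 * (\<bar>x j\<bar> * \<bar>y j\<bar>)"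
      by (simp add: power2_diff)
    finally show "norm (x j * y j) \<le> (x j)\<^sup>2 + (y j)\<^sup>2"
      using abs_ge_zero[of "x j * y j"] unfolding abs_mult real_norm_def by linarith
  qed auto
  then show ?thesis by (rule abs_summable_summable)
qed

definition row_gram :: "(nat \<Rightarrow> nat \<Rightarrow> real) \<Rightarrow> nat \<Rightarrow> nat \<Rightarrow> real" where
  "row_gram V i i' = (\<Sum>\<^sub>\<infinity>j. V i j * V i' j)"

lemma row_contraction_has_sum:
  assumes "row_contraction V"
  shows "((\<lambda>j. V i j * V i' j) has_sum row_gram V i i') UNIV"
  unfolding row_gram_def
  by (intro has_sum_infsum summable_on_mult_squares square_sum_summable_on[of _ 1]
        row_contraction_row assms)

lemma has_sum_finite_sum:
  fixes f :: "'i \<Rightarrow> 'j \<Rightarrow> real"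
  assumes "finite A" "\<And>i. i \<in> A \<Longrightarrow> (f i has_sum c i) B"
  shows "((\<lambda>j. \<Sum>i\<in>A. f i j) has_sum (\<Sum>i\<in>A. c i)) B"
  using assms by (induction A rule: finite_induct) (auto intro: has_sum_add)

lemma has_sum_square_combination:
  fixes V :: "nat \<Rightarrow> nat \<Rightarrow> real"
  assumes "\<And>i i'. ((\<lambda>j. V i j * V i' j) has_sum G i i') UNIV"
  shows "((\<lambda>j. (\<Sum>i<n. a i * V i j)\<^sup>2) has_sum (\<Sum>i<n. \<Sum>i'<n. a i * a i' * G i i')) UNIV"
proof -
  have "(\<lambda>j. (\<Sum>i<n. a i * V i j)\<^sup>2) = (\<lambda>j. \<Sum>i<n. \<Sum>i'<n. a i * a i' * (V i j * V i' j))"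
    by (simp add: power2_eq_square sum_product mult_ac)
  then show ?thesis
    by (simp only:) (intro has_sum_finite_sum has_sum_cmult_right assms finite_lessThan)
qed

lemma orthonormal_rows_contraction:
  fixes U :: "nat \<Rightarrow> nat \<Rightarrow> real"
  assumes "\<And>i i'. ((\<lambda>j. U i j * U i' j) has_sum of_bool (i = i')) UNIV"
  shows "row_contraction U"
  unfolding row_contraction_def
proof (intro allI)
  fix a :: "nat \<Rightarrow> real" and m
  have 1: "((\<lambda>j. (\<Sum>i<m. a i * U i j)\<^sup>2) has_sum (\<Sum>i<m. \<Sum>i'<m. a i * a i' * of_bool (i = i'))) UNIV"
    by (rule has_sum_square_combination[OF assms])
  have 2: "(\<Sum>i<m. \<Sum>i'<m. a i * a i' * of_bool (i = i')) = (\<Sum>i<m. (a i)\<^sup>2)"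
    by (intro sum.cong refl) (simp add: power2_eq_square)
  have 3: "((\<lambda>j. (\<Sum>i<m. a i * U i j)\<^sup>2) has_sum (\<Sum>j<m. (\<Sum>i<m. a i * U i j)\<^sup>2)) {..<m}"
    by (simp add: has_sum_finite)
  show "(\<Sum>j<m. (\<Sum>i<m. a i * U i j)\<^sup>2) \<le> (\<Sum>i<m. (a i)\<^sup>2)"
    by (rule has_sum_mono_neutral[OF 3 1[unfolded 2]]) auto
qed

subsection \<open>Positive semidefinite infinite matrices\<close>

definition psd :: "(nat \<Rightarrow> nat \<Rightarrow> real) \<Rightarrow> bool" where
  "psd E \<longleftrightarrow> (\<forall>i j. E i j = E j i) \<and> (\<forall>a n. 0 \<le> (\<Sum>i<n. \<Sum>j<n. a i * a j * E i j))"

text \<open>The quadratic form is nonnegative along the line through \<open>a\<close> in the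
  \<open>k\<close>-th coordinate direction; suitable values of \<open>t\<close> give the next three
  lemmas.\<close>

lemma psd_shift:
  assumes "psd E" "k < n"
  shows "0 \<le> (\<Sum>i<n. \<Sum>j<n. a i * a j * E i j) + 2 * t * (\<Sum>i<n. a i * E i k) + t\<^sup>2 * E k k"
proof -
  define b where "b i = a i + (if i = k then t else 0)" for i
  have inner: "(\<Sum>j<n. b i * b j * E i j) = b i * (\<Sum>j<n. a j * E i j) + b i * t * E i k" for i
  proof -
    have "(\<Sum>j<n. b i * b j * E i j) = (\<Sum>j<n. b i * (a j * E i j) + (if j = k then b i * t * E i k else 0))"
      by (rule sum.cong) (auto simp: b_def algebra_simps)
    then show ?thesis using assms(2) by (simp add: sum.distrib sum_distrib_left)
  qed
  have "(\<Sum>i<n. b i * (\<Sum>j<n. a j * E i j))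
      = (\<Sum>i<n. a i * (\<Sum>j<n. a j * E i j) + (if i = k then t * (\<Sum>j<n. a j * E k j) else 0))"
    by (rule sum.cong) (auto simp: b_def algebra_simps)
  then have 1: "(\<Sum>i<n. b i * (\<Sum>j<n. a j * E i j))
      = (\<Sum>i<n. a i * (\<Sum>j<n. a j * E i j)) + t * (\<Sum>j<n. a j * E k j)"
    using assms(2) by (simp add: sum.distrib)
  have "(\<Sum>i<n. b i * t * E i k) = (\<Sum>i<n. t * (a i * E i k) + (if i = k then t\<^sup>2 * E k k else 0))"
    by (rule sum.cong) (auto simp: b_def algebra_simps power2_eq_square)
  then have 2: "(\<Sum>i<n. b i * t * E i k) = t * (\<Sum>i<n. a i * E i k) + t\<^sup>2 * E k k"
    using assms(2) by (simp add: sum.distrib sum_distrib_left)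
  have sym: "(\<Sum>j<n. a j * E k j) = (\<Sum>i<n. a i * E i k)"
    using assms(1) unfolding psd_def by metis
  have "0 \<le> (\<Sum>i<n. \<Sum>j<n. b i * b j * E i j)" using assms(1) by (simp add: psd_def)
  also have "\<dots> = (\<Sum>i<n. b i * (\<Sum>j<n. a j * E i j)) + (\<Sum>i<n. b i * t * E i k)"
    by (simp only: inner sum.distrib)
  also have "\<dots> = (\<Sum>i<n. \<Sum>j<n. a i * a j * E i j) + 2 * t * (\<Sum>i<n. a i * E i k) + t\<^sup>2 * E k k"
    unfolding 1 2 sym by (simp add: sum_distrib_left mult_ac)
  finally show ?thesis .
qed

lemma psd_diag:
  assumes "psd E"
  shows "0 \<le> E k k"
  using psd_shift[OF assms lessI, of "\<lambda>_. 0" k 1] by simp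

text \<open>With \<open>E k k = 0\<close> the bound of \<open>psd_shift\<close> is affine in
  \<open>t\<close>, so it can stay nonnegative only if its slope vanishes.\<close>

lemma psd_zero:
  assumes "psd E" "E k k = 0"
  shows "E i k = 0" "E k i = 0"
proof -
  define n where "n = Suc (max i k)"
  have n: "i < n" "k < n" by (auto simp: n_def)
  define a where "a l = (if l = i then 1 else 0 :: real)" for l
  have "(\<Sum>l<n. \<Sum>j<n. a l * a j * E l j) = (\<Sum>l<n. if l = i then E i i else 0)"
  proof (rule sum.cong)
    fix l
    have "(\<Sum>j<n. a l * a j * E l j) = (\<Sum>j<n. if j = i then a l * E l i else 0)"
      by (rule sum.cong) (auto simp: a_def)
    then show "(\<Sum>j<n. a l * a j * E l j) = (if l = i then E i i else 0)"
      using n by (simp add: a_def)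
  qed simp
  then have 1: "(\<Sum>l<n. \<Sum>j<n. a l * a j * E l j) = E i i" using n by simp
  have "(\<Sum>l<n. a l * E l k) = (\<Sum>l<n. if l = i then E i k else 0)"
    by (rule sum.cong) (auto simp: a_def)
  then have 2: "(\<Sum>l<n. a l * E l k) = E i k" using n by simp
  have *: "0 \<le> E i i + 2 * t * E i k" for t
    using psd_shift[OF assms(1) n(2), of a t] assms(2) unfolding 1 2 by simp
  show "E i k = 0"
  proof (rule ccontr)
    assume "E i k \<noteq> 0"
    \<comment> \<open>At this \<open>t\<close> the affine function takes the value -1.\<close>
    then show False using *[of "- (E i i + 1) / (2 * E i k)"] by (simp add: field_simps)
  qed
  then show "E k i = 0" using assms(1) by (simp add: psd_def)
qed

text \<open>Minimising the bound of \<open>psd_shift\<close> over \<open>t\<close> leads to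
  \<open>t = - B / E k k\<close>. If \<open>E k k = 0\<close>, division by zero returns 0 and the
  matrix is unchanged.\<close>

lemma psd_schur_complement:
  assumes "psd E"
  shows "psd (\<lambda>i j. E i j - E i k * E k j / E k k)"
proof (cases "E k k = 0")
  case True
  then show ?thesis using assms by simp
next
  case False
  have sym: "E i j = E j i" for i j using assms by (simp add: psd_def)
  show ?thesis
    unfolding psd_def
  proof (intro conjI allI)
    fix i j show "E i j - E i k * E k j / E k k = E j i - E j k * E k i / E k k"
      using sym[of i j] sym[of i k] sym[of j k] by simp
  next
    fix a :: "nat \<Rightarrow> real" and n
    define b where "b i = (if i < n then a i else 0)" for i
    define m where "m = max n (Suc k)"
    have km: "k < m" by (simp add: m_def)
    define Q where "Q = (\<Sum>i<m. \<Sum>j<m. b i * b j * E i j)"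
    define B where "B = (\<Sum>i<m. b i * E i k)"
    have "0 \<le> Q + 2 * (- B / E k k) * B + (- B / E k k)\<^sup>2 * E k k"
      using psd_shift[OF assms km, of b "- B / E k k"] by (simp only: Q_def B_def)
    also have "\<dots> = Q - B * B / E k k" using False by (simp add: field_simps power2_eq_square)
    also have "\<dots> = (\<Sum>i<m. \<Sum>j<m. b i * b j * (E i j - E i k * E k j / E k k))"
    proof -
      have "B * B / E k k = (\<Sum>i<m. \<Sum>j<m. b i * b j * (E i k * E k j / E k k))"
        unfolding B_def sum_product sum_divide_distrib
        by (intro sum.cong refl) (subst (3) sym, simp add: mult_ac)
      then show ?thesis by (simp add: Q_def right_diff_distrib sum_subtractf)
    qed
    also have "\<dots> = (\<Sum>i<n. \<Sum>j<m. b i * b j * (E i j - E i k * E k j / E k k))"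
      by (rule sum_extend_zero) (auto simp: b_def m_def)
    also have "\<dots> = (\<Sum>i<n. \<Sum>j<n. b i * b j * (E i j - E i k * E k j / E k k))"
      by (intro sum.cong refl sum_extend_zero) (auto simp: b_def m_def)
    also have "\<dots> = (\<Sum>i<n. \<Sum>j<n. a i * a j * (E i j - E i k * E k j / E k k))"
      by (intro sum.cong refl) (auto simp: b_def)
    finally show "0 \<le> (\<Sum>i<n. \<Sum>j<n. a i * a j * (E i j - E i k * E k j / E k k))" .
  qed
qed

text \<open>The remainder of \<open>E\<close> after \<open>k\<close> steps of Cholesky elimination,
  with pivots taken in order. At a zero pivot nothing is subtracted, which is right because by
  \<open>psd_zero\<close> its row and column vanish already.\<close>

fun cholesky_rest :: "(nat \<Rightarrow> nat \<Rightarrow> real) \<Rightarrow> nat \<Rightarrow> nat \<Rightarrow> nat \<Rightarrow> real" where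
  "cholesky_rest E 0 i j = E i j"
| "cholesky_rest E (Suc k) i j = cholesky_rest E k i j
     - cholesky_rest E k i k * cholesky_rest E k k j / cholesky_rest E k k k"

text \<open>Row \<open>i\<close> of the remainder vanishes once pivot \<open>i\<close> has been
  used, so the factor is lower triangular and every series has only finitely many nonzero
  terms.\<close>

lemma psd_cholesky:
  assumes "psd E"
  shows "\<exists>X :: nat \<Rightarrow> nat \<Rightarrow> real. \<forall>i j. ((\<lambda>k. X i k * X j k) has_sum E i j) UNIV"
proof -
  define C where "C = cholesky_rest E"
  have psd: "psd (C k)" for k
  proof (induction k)
    case 0
    have "C 0 = E" by (intro ext) (simp add: C_def)
    then show ?case using assms by simp
  next
    case (Suc k)
    have "C (Suc k) = (\<lambda>i j. C k i j - C k i k * C k k j / C k k k)"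
      by (intro ext) (simp add: C_def)
    then show ?case using psd_schur_complement[OF Suc, of k] by simp
  qed
  have sym: "C k i j = C k j i" for k i j using psd[of k] by (simp add: psd_def)
  have CS: "C (Suc k) i j = C k i j - C k i k * C k k j / C k k k" for k i j by (simp add: C_def)
  have zero: "i < k \<Longrightarrow> C k i j = 0" for k i j
  proof (induction k arbitrary: j)
    case (Suc k)
    show ?case
    proof (cases "i = k")
      case True
      show ?thesis
        using psd_zero(2)[OF psd[of k], of k j] by (cases "C k k k = 0") (simp_all add: CS True)
    next
      case False
      then show ?thesis using Suc by (simp add: CS)
    qed
  qed simp
  define X where "X i k = C k i k / sqrt (C k k k)" for i k
  have XX: "X i k * X j k = C k i k * C k k j / C k k k" for i j k
  proof -
    have "sqrt (C k k k) * sqrt (C k k k) = C k k k" using psd_diag[OF psd] by simp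
    then show ?thesis by (simp add: X_def sym[of k k j])
  qed
  have step: "E i j = (\<Sum>k<n. X i k * X j k) + C n i j" for i j n
    by (induction n) (simp_all add: CS XX, simp add: C_def)
  have "((\<lambda>k. X i k * X j k) has_sum E i j) UNIV" for i j
  proof -
    have "((\<lambda>k. X i k * X j k) has_sum (\<Sum>k<Suc i. X i k * X j k)) {..<Suc i}"
      by (rule has_sum_finite) simp
    moreover have "(\<Sum>k<Suc i. X i k * X j k) = E i j"
      using step[of i j "Suc i"] zero[of i "Suc i" j] by simp
    moreover have "X i k = 0" if "k > i" for k using zero[OF that] by (simp add: X_def)
    ultimately show ?thesis
      by (subst has_sum_cong_neutral[where T = "{..<Suc i}"]) auto
  qed
  then show ?thesis by blast
qed

section \<open>Dilation of row contractions to orthonormal rows\<close>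

lemma row_contraction_defect_psd:
  assumes "row_contraction V"
  shows "psd (\<lambda>i j. of_bool (i = j) - row_gram V i j)"
  unfolding psd_def
proof (intro conjI allI)
  fix i j show "of_bool (i = j) - row_gram V i j = of_bool (j = i) - row_gram V j i"
    by (simp add: row_gram_def mult.commute eq_commute)
next
  fix a :: "nat \<Rightarrow> real" and n
  have "((\<lambda>j. (\<Sum>i<n. a i * V i j)\<^sup>2) has_sum (\<Sum>i<n. \<Sum>i'<n. a i * a i' * row_gram V i i')) UNIV"
    by (rule has_sum_square_combination[OF row_contraction_has_sum[OF assms]])
  then have "(\<lambda>j. (\<Sum>i<n. a i * V i j)\<^sup>2) sums (\<Sum>i<n. \<Sum>i'<n. a i * a i' * row_gram V i i')"
    by (rule has_sum_imp_sums)
  then have "(\<Sum>i<n. \<Sum>i'<n. a i * a i' * row_gram V i i') \<le> (\<Sum>i<n. (a i)\<^sup>2)"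
    unfolding sums_def by (rule LIMSEQ_le_const2) (use row_contraction_sum[OF assms] in blast)
  moreover have "(\<Sum>i<n. \<Sum>i'<n. a i * a i' * of_bool (i = i')) = (\<Sum>i<n. (a i)\<^sup>2)"
    by (intro sum.cong refl) (simp add: power2_eq_square)
  ultimately show "0 \<le> (\<Sum>i<n. \<Sum>j<n. a i * a j * (of_bool (i = j) - row_gram V i j))"
    by (simp only: right_diff_distrib sum_subtractf)
qed

text \<open>Factor the defect \<open>of_bool (i = j) - row_gram V i j\<close> as the Gram matrix of
  rows \<open>X\<close>, and write column \<open>k\<close> of \<open>X\<close> into column
  \<open>\<zeta> k\<close>. As \<open>V\<close> vanishes there, the two Gram matrices add up to the
  identity.\<close>

lemma dilate_rows:
  fixes \<zeta> :: "nat \<Rightarrow> nat"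
  assumes V: "row_contraction V" and "inj \<zeta>" and z: "\<And>i k. V i (\<zeta> k) = 0"
  obtains U where "\<And>i i'. ((\<lambda>j. U i j * U i' j) has_sum of_bool (i = i')) UNIV"
    "\<And>i j. j \<notin> range \<zeta> \<Longrightarrow> U i j = V i j"
proof -
  obtain X :: "nat \<Rightarrow> nat \<Rightarrow> real" where X: "\<And>i j. ((\<lambda>k. X i k * X j k) has_sum of_bool (i = j) - row_gram V i j) UNIV"
    using psd_cholesky[OF row_contraction_defect_psd[OF V]] by auto
  define Y where "Y i j = (if j \<in> range \<zeta> then X i (inv \<zeta> j) else 0)" for i j
  have Y\<zeta>: "Y i (\<zeta> k) = X i k" for i k using \<open>inj \<zeta>\<close> by (simp add: Y_def)
  have Y: "((\<lambda>j. Y i j * Y i' j) has_sum of_bool (i = i') - row_gram V i i') UNIV" for i i'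
  proof -
    have "((\<lambda>j. Y i j * Y i' j) has_sum of_bool (i = i') - row_gram V i i') (range \<zeta>)"
      using X[of i i'] by (subst has_sum_reindex[OF \<open>inj \<zeta>\<close>]) (simp add: o_def Y\<zeta>)
    then show ?thesis
      by (subst has_sum_cong_neutral[where T = "range \<zeta>"]) (auto simp: Y_def)
  qed
  have VY: "V i j * Y i' j = 0" for i i' j using z by (auto simp: Y_def)
  have "((\<lambda>j. (V i j + Y i j) * (V i' j + Y i' j)) has_sum of_bool (i = i')) UNIV" for i i'
  proof -
    have "(V i j + Y i j) * (V i' j + Y i' j) = V i j * V i' j + Y i j * Y i' j" for j
      using VY[of i j i'] VY[of i' j i] by (auto simp: algebra_simps)
    then show ?thesis
      using has_sum_add[OF row_contraction_has_sum[OF V, of i i'] Y[of i i']] by simp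
  qed
  then show ?thesis by (rule that[of "\<lambda>i j. V i j + Y i j"]) (simp add: Y_def)
qed

subsection \<open>The tight case\<close>

lemma finite_row_le_gram:
  assumes "row_contraction V" "finite J"
  shows "(\<Sum>j\<in>J. (V i j)\<^sup>2) \<le> row_gram V i i"
proof -
  have "((\<lambda>j. V i j * V i j) has_sum (\<Sum>j\<in>J. V i j * V i j)) J"
    using assms(2) by (rule has_sum_finite)
  from has_sum_mono_neutral[OF this row_contraction_has_sum[OF assms(1), of i i]]
  show ?thesis by (simp add: power2_eq_square)
qed

lemma row_gram_le_1: "row_contraction V \<Longrightarrow> row_gram V i i \<le> 1"
  using psd_diag[OF row_contraction_defect_psd, of V i] by simp

text \<open>If the rows are not unit vectors, the diagonal falls short of the partial sums of \<open>s\<close> by a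
  fixed amount: \<open>\<Sum>j\<in>J. d j\<close> is a weighted sum of \<open>s\<close> with weights at most 1 and
  total weight at most \<open>card J\<close>.\<close>

lemma tight_row_gram:
  fixes s d :: "nat \<Rightarrow> real"
  assumes V: "row_contraction V" and dec: "decseq s" and s0: "\<And>i. 0 \<le> s i" and lim: "s \<longlonglongrightarrow> 0"
    and sums: "\<And>j. (\<lambda>i. s i * (V i j)\<^sup>2) sums d j"
    and tight: "\<And>\<epsilon> N. 0 < \<epsilon> \<Longrightarrow> \<exists>J. finite J \<and> N \<le> card J \<and> sum s {..<card J} - \<epsilon> < sum d J"
    and i0: "0 < s i0"
  shows "row_gram V i0 i0 = 1"
proof (rule ccontr)
  assume "row_gram V i0 i0 \<noteq> 1"
  define \<eta> where "\<eta> = 1 - row_gram V i0 i0"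
  have \<eta>: "\<eta> > 0" using row_gram_le_1[OF V, of i0] \<open>row_gram V i0 i0 \<noteq> 1\<close> by (simp add: \<eta>_def)
  \<comment> \<open>Once \<open>s k\<close> is below half of \<open>s i0\<close>, a defect
    \<open>\<eta>\<close> in row \<open>i0\<close> costs at least \<open>\<eta> * s i0 / 2\<close>,
    the tolerance then passed to \<open>tight\<close>.\<close>
  have "eventually (\<lambda>k. s k < s i0 / 2) sequentially"
    by (rule order_tendstoD(2)[OF lim]) (use i0 in simp)
  then obtain N where N: "\<And>k. k \<ge> N \<Longrightarrow> s k < s i0 / 2" by (auto simp: eventually_sequentially)
  have "0 < \<eta> * s i0 / 2" using \<eta> i0 by simp
  then obtain J where J: "finite J" "max N (Suc i0) \<le> card J"
    "sum s {..<card J} - \<eta> * s i0 / 2 < sum d J"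
    using tight by blast
  define k where "k = card J"
  have k: "i0 < k" "s k < s i0 / 2" using J(2) N[of k] by (auto simp: k_def)
  define c where "c i = (\<Sum>j\<in>J. (V i j)\<^sup>2)" for i
  have c0: "0 \<le> c i" for i by (simp add: c_def sum_nonneg)
  have c1: "c i \<le> 1 - (if i = i0 then \<eta> else 0)" for i
    using finite_row_le_gram[OF V J(1), of i] row_gram_le_1[OF V, of i] by (auto simp: c_def \<eta>_def)
  have csum: "(\<Sum>i<m. c i) \<le> k" for m
  proof -
    have "(\<Sum>i<m. c i) = (\<Sum>j\<in>J. \<Sum>i<m. (V i j)\<^sup>2)" unfolding c_def by (rule sum.swap)
    also have "\<dots> \<le> (\<Sum>j\<in>J. 1)" by (intro sum_mono row_contraction_column V)
    finally show ?thesis by (simp add: k_def)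
  qed
  have "(\<lambda>i. \<Sum>j\<in>J. s i * (V i j)\<^sup>2) sums sum d J" by (intro sums_sum sums)
  then have "(\<lambda>i. s i * c i) sums sum d J" by (simp add: c_def sum_distrib_left)
  moreover have "(\<Sum>i<m. s i * c i) \<le> sum s {..<k} - \<eta> * s i0 / 2" if "m \<ge> k" for m
  proof -
    \<comment> \<open>Measured from the level \<open>s k\<close>, the factors are nonnegative before
      \<open>k\<close> and nonpositive from \<open>k\<close> on, so the sum is largest for weights 1
      on the first \<open>k\<close> indices, except \<open>1 - \<eta>\<close> at \<open>i0\<close>.
      The level itself is multiplied by a total weight of at most \<open>k\<close>.\<close>
    have "(\<Sum>i<m. s i * c i) = (\<Sum>i<m. (s i - s k) * c i) + s k * (\<Sum>i<m. c i)"
      by (simp add: left_diff_distrib sum_subtractf sum_distrib_left)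
    also have "s k * (\<Sum>i<m. c i) \<le> s k * k" by (intro mult_left_mono csum s0)
    also have "(\<Sum>i<m. (s i - s k) * c i) \<le> (\<Sum>i<k. (s i - s k) * c i)"
    proof -
      have "(\<Sum>i<m. (s i - s k) * c i) = (\<Sum>i<k. (s i - s k) * c i) + (\<Sum>i\<in>{k..<m}. (s i - s k) * c i)"
        using that by (simp add: lessThan_atLeast0 sum.atLeastLessThan_concat)
      moreover have "(\<Sum>i\<in>{k..<m}. (s i - s k) * c i) \<le> 0"
        using decseqD[OF dec] c0 by (intro sum_nonpos mult_nonpos_nonneg) auto
      ultimately show ?thesis by simp
    qed
    also have "(\<Sum>i<k. (s i - s k) * c i) \<le> (\<Sum>i<k. (s i - s k) * (1 - (if i = i0 then \<eta> else 0)))"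
      using decseqD[OF dec] by (intro sum_mono mult_left_mono c1) auto
    also have "\<dots> = (\<Sum>i<k. s i - s k - (if i = i0 then (s i0 - s k) * \<eta> else 0))"
      by (rule sum.cong) (auto simp: algebra_simps)
    also have "\<dots> = (\<Sum>i<k. s i) - s k * k - (s i0 - s k) * \<eta>"
      using k by (simp add: sum_subtractf)
    finally have "(\<Sum>i<m. s i * c i) \<le> (\<Sum>i<k. s i) - (s i0 - s k) * \<eta>" by simp
    moreover have "s i0 / 2 * \<eta> \<le> (s i0 - s k) * \<eta>" using k \<eta> by (intro mult_right_mono) auto
    ultimately show ?thesis by (simp add: mult.commute)
  qed
  ultimately have "sum d J \<le> sum s {..<k} - \<eta> * s i0 / 2"
    unfolding sums_def by (intro LIMSEQ_le_const2) auto
  then show False using J(3) by (simp add: k_def)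
qed

subsection \<open>Rotating pairs of coordinates\<close>

text \<open>For an involution \<open>\<tau>\<close> with
  \<open>\<alpha> (\<tau> j) = - \<alpha> j\<close> this is right multiplication by a direct sum of
  plane rotations, one for each pair \<open>j\<close>, \<open>\<tau> j\<close>.\<close>

definition rotate_columns :: "(nat \<Rightarrow> nat) \<Rightarrow> (nat \<Rightarrow> real) \<Rightarrow> (nat \<Rightarrow> nat \<Rightarrow> real) \<Rightarrow> nat \<Rightarrow> nat \<Rightarrow> real" where
  "rotate_columns \<tau> \<alpha> U i j = cos (\<alpha> j) * U i j + sin (\<alpha> j) * U i (\<tau> j)"

text \<open>Within a pair a rotation preserves the sum of the two products. Adding the series over
  \<open>j\<close> and over \<open>\<tau> j\<close> counts everything twice, hence the equation for
  \<open>L + L\<close>, and avoids choosing representatives of the pairs.\<close>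

lemma rotate_columns_orthonormal:
  assumes U: "\<And>i i'. ((\<lambda>j. U i j * U i' j) has_sum of_bool (i = i')) UNIV"
    and \<tau>: "\<And>j. \<tau> (\<tau> j) = j" and \<alpha>: "\<And>j. \<alpha> (\<tau> j) = - \<alpha> j"
  shows "((\<lambda>j. rotate_columns \<tau> \<alpha> U i j * rotate_columns \<tau> \<alpha> U i' j) has_sum of_bool (i = i')) UNIV"
proof -
  have bij: "bij \<tau>" using \<tau> by (intro o_bij[of \<tau>]) auto
  have U2: "(\<lambda>j. (U i j)\<^sup>2) summable_on UNIV" for i
    using U[of i i] by (auto simp: power2_eq_square summable_on_def)
  have U2': "(\<lambda>j. (U i (\<tau> j))\<^sup>2) summable_on UNIV" for i
    using U2[of i] summable_on_reindex_bij_betw[OF bij, of "\<lambda>j. (U i j)\<^sup>2"] by simp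
  define R where "R = rotate_columns \<tau> \<alpha> U"
  have R2: "(\<lambda>j. (R i j)\<^sup>2) summable_on UNIV" for i
  proof (rule summable_on_comparison_test[OF summable_on_add[OF U2[of i] U2'[of i]]])
    fix j
    have cs: "(cos (\<alpha> j))\<^sup>2 + (sin (\<alpha> j))\<^sup>2 = 1" by simp
    have "(U i j)\<^sup>2 + (U i (\<tau> j))\<^sup>2 - (R i j)\<^sup>2 = (sin (\<alpha> j) * U i j - cos (\<alpha> j) * U i (\<tau> j))\<^sup>2
        + ((U i j)\<^sup>2 + (U i (\<tau> j))\<^sup>2) * (1 - ((cos (\<alpha> j))\<^sup>2 + (sin (\<alpha> j))\<^sup>2))"
      unfolding R_def rotate_columns_def by (simp only: power2_eq_square) (simp only: algebra_simps)
    also have "\<dots> = (sin (\<alpha> j) * U i j - cos (\<alpha> j) * U i (\<tau> j))\<^sup>2" unfolding cs by simp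
    finally have "(U i j)\<^sup>2 + (U i (\<tau> j))\<^sup>2 - (R i j)\<^sup>2 \<ge> 0" by simp
    then show "(R i j)\<^sup>2 \<le> (U i j)\<^sup>2 + (U i (\<tau> j))\<^sup>2" by simp
  qed auto
  define L where "L = (\<Sum>\<^sub>\<infinity>j. R i j * R i' j)"
  have L: "((\<lambda>j. R i j * R i' j) has_sum L) UNIV"
    unfolding L_def by (intro has_sum_infsum summable_on_mult_squares R2)
  have L': "((\<lambda>j. R i (\<tau> j) * R i' (\<tau> j)) has_sum L) UNIV"
    using L has_sum_reindex_bij_betw[OF bij, of "\<lambda>j. R i j * R i' j"] by simp
  have U': "((\<lambda>j. U i (\<tau> j) * U i' (\<tau> j)) has_sum of_bool (i = i')) UNIV"
    using U[of i i'] has_sum_reindex_bij_betw[OF bij, of "\<lambda>j. U i j * U i' j"] by simp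
  have "R i j * R i' j + R i (\<tau> j) * R i' (\<tau> j) = U i j * U i' j + U i (\<tau> j) * U i' (\<tau> j)" for j
  proof -
    have cs: "(cos (\<alpha> j))\<^sup>2 + (sin (\<alpha> j))\<^sup>2 = 1" by simp
    have "R i j * R i' j + R i (\<tau> j) * R i' (\<tau> j)
        = (U i j * U i' j + U i (\<tau> j) * U i' (\<tau> j)) * ((cos (\<alpha> j))\<^sup>2 + (sin (\<alpha> j))\<^sup>2)"
      unfolding R_def rotate_columns_def \<tau> \<alpha> cos_minus sin_minus power2_eq_square
      by (simp only: algebra_simps) simp
    then show ?thesis unfolding cs by simp
  qed
  then have "((\<lambda>j. U i j * U i' j + U i (\<tau> j) * U i' (\<tau> j)) has_sum L + L) UNIV"
    using has_sum_add[OF L L'] by simp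
  then have "L + L = of_bool (i = i') + of_bool (i = i')"
    using has_sum_unique[OF _ has_sum_add[OF U[of i i'] U']] by blast
  then have "L = of_bool (i = i')" by simp
  then show ?thesis using L by (simp add: R_def)
qed

lemma polar_coordinates: "\<exists>r \<phi>. 0 \<le> r \<and> x = r * cos \<phi> \<and> y = r * sin \<phi>" for x y :: real
proof -
  have "Complex x y = cmod (Complex x y) * cis (Arg (Complex x y))" by (simp add: rcis_cmod_Arg[unfolded rcis_def])
  then show ?thesis
    by (intro exI[of _ "cmod (Complex x y)"] exI[of _ "Arg (Complex x y)"]) (simp add: complex_eq_iff)
qed

text \<open>In a matrix with zero second column, the first column \<open>(p + q, y)\<close> is
  turned onto the axis by the angle \<open>\<phi>\<close>, leaving the single entry
  \<open>r\<close>. What remains is \<open>r * cos a * cos b = p\<close> and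
  \<open>r * sin a * sin b = q\<close>, that is, \<open>cos (a - b) = (p + q) / r\<close> and
  \<open>cos (a + b) = (p - q) / r\<close>; both are solvable because
  \<open>p + q \<le> r\<close>.\<close>

lemma two_rotations_triangular:
  fixes p q y :: real
  assumes "0 \<le> p" "0 \<le> q"
  shows "\<exists>a b. cos b * (cos a * (p + q) + sin a * y) = p \<and> sin b * (sin a * (p + q) - cos a * y) = q"
proof -
  obtain r \<phi> where r: "0 \<le> r" "p + q = r * cos \<phi>" "y = r * sin \<phi>"
    using polar_coordinates by blast
  have pq: "p + q \<le> r" unfolding r(2) using r(1) by (simp add: mult_left_le)
  show ?thesis
  proof (cases "r = 0")
    case True
    then show ?thesis using pq assms r by auto
  next
    case False
    with r(1) have r0: "r > 0" by simp
    define u where "u = arccos ((p + q) / r)"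
    define v where "v = arccos ((p - q) / r)"
    have u: "cos u = (p + q) / r"
      unfolding u_def using pq assms r0 by (intro cos_arccos) (auto simp: field_simps)
    have v: "cos v = (p - q) / r"
      unfolding v_def using pq assms r0 by (intro cos_arccos) (auto simp: field_simps)
    define a where "a = (u + v) / 2"
    define b where "b = (v - u) / 2"
    have ab: "u = a - b" "v = a + b" by (auto simp: a_def b_def field_simps)
    have c: "cos a * cos b = p / r" "sin a * sin b = q / r"
      using u v unfolding ab cos_diff cos_add add_divide_distrib diff_divide_distrib by linarith+
    have "cos (a + \<phi>) * (p + q) + sin (a + \<phi>) * y = r * cos (a + \<phi> - \<phi>)"
      unfolding r(2,3) cos_diff by (simp add: algebra_simps)
    moreover have "sin (a + \<phi>) * (p + q) - cos (a + \<phi>) * y = r * sin (a + \<phi> - \<phi>)"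
      unfolding r(2,3) sin_diff by (simp add: algebra_simps)
    ultimately show ?thesis
      using c r0 by (intro exI[of _ "a + \<phi>"] exI[of _ b]) (simp add: field_simps)
  qed
qed

text \<open>Independent rotations \<open>a\<close> and \<open>b\<close> of left and right
  coordinates act on the block with rows \<open>(p + q, x)\<close> and \<open>(y, 0)\<close>; the
  two formulas are its new diagonal entries. A vanishing off-diagonal entry leads to the triangular
  case, up to transposition.\<close>

lemma two_rotations:
  fixes p q x y :: real
  assumes "0 \<le> p" "0 \<le> q" "x = 0 \<or> y = 0"
  shows "\<exists>a b. cos a * cos b * (p + q) + cos a * sin b * x + sin a * cos b * y = p \<and>
    sin a * sin b * (p + q) - cos a * sin b * y - sin a * cos b * x = q"
proof (cases "x = 0")
  case True
  obtain a b where "cos b * (cos a * (p + q) + sin a * y) = p" "sin b * (sin a * (p + q) - cos a * y) = q"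
    using two_rotations_triangular[OF assms(1,2)] by blast
  then show ?thesis using True by (intro exI[of _ a] exI[of _ b]) (simp add: algebra_simps)
next
  case False
  then have "y = 0" using assms(3) by simp
  obtain a b where "cos b * (cos a * (p + q) + sin a * x) = p" "sin b * (sin a * (p + q) - cos a * x) = q"
    using two_rotations_triangular[OF assms(1,2)] by blast
  then show ?thesis using \<open>y = 0\<close> by (intro exI[of _ b] exI[of _ a]) (simp add: algebra_simps)
qed

subsection \<open>The case with slack\<close>

lemma null_sequence_subsequence_below:
  fixes d b :: "nat \<Rightarrow> real"
  assumes "d \<longlonglongrightarrow> 0" "\<And>n. 0 < b n"
  obtains g where "strict_mono (g :: nat \<Rightarrow> nat)" "\<And>n. d (g n) \<le> b n"
proof -
  have "\<exists>h. \<forall>m\<ge>h. d m < b n" for n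
    using order_tendstoD(2)[OF assms(1), of "b n"] assms(2) by (simp add: eventually_sequentially)
  then obtain h where h: "\<And>n m. m \<ge> h n \<Longrightarrow> d m < b n" by metis
  define g where "g n = n + (\<Sum>k\<le>n. h k)" for n
  have "strict_mono g" by (rule strict_monoI_Suc) (simp add: g_def)
  moreover have "h n \<le> g n" for n
    using member_le_sum[of n "{..n}" h] by (simp add: g_def)
  then have "d (g n) \<le> b n" for n using h less_imp_le by blast
  ultimately show ?thesis using that by blast
qed

text \<open>Sets with at least \<open>N\<close> elements absorb the total increase into the slack
  \<open>\<epsilon>\<close>. For smaller sets a merged entry is at most \<open>\<theta>\<close>,
  hence at most every positive \<open>s i\<close> with \<open>i < N\<close>, so it can be removed
  and charged to the last term of the sum, by induction on the cardinality.\<close>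

lemma merged_majorization:
  fixes s d d' e :: "nat \<Rightarrow> real"
  assumes s0: "\<And>i. 0 \<le> s i" and dec: "decseq s"
    and maj: "\<And>J. finite J \<Longrightarrow> sum d J \<le> sum s {..<card J}"
    and slack: "\<And>J. finite J \<Longrightarrow> N \<le> card J \<Longrightarrow> sum d J \<le> sum s {..<card J} - \<epsilon>"
    and \<theta>: "\<And>i. i < N \<Longrightarrow> 0 < s i \<Longrightarrow> \<theta> \<le> s i"
    and tot: "\<And>J. finite J \<Longrightarrow> J \<subseteq> M \<Longrightarrow> sum e J \<le> \<epsilon>"
    and d'1: "\<And>j. j \<notin> M \<Longrightarrow> d' j \<le> d j" and d'2: "\<And>j. j \<in> M \<Longrightarrow> d' j \<le> d j + e j"
    and d'3: "\<And>j. j \<in> M \<Longrightarrow> d' j \<le> \<theta>" and d'0: "\<And>j. 0 \<le> d' j"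
  shows "finite J \<Longrightarrow> sum d' J \<le> sum s {..<card J}"
proof (induction "card J" arbitrary: J)
  case 0
  then show ?case by simp
next
  case (Suc k)
  have big: "sum d' J \<le> sum s {..<card J}" if "finite J" "N \<le> card J" for J
  proof -
    have "sum d' J \<le> (\<Sum>j\<in>J. d j + (if j \<in> M then e j else 0))"
      using d'1 d'2 by (intro sum_mono) auto
    also have "\<dots> = sum d J + sum e (J \<inter> M)"
      using that(1) by (simp add: sum.distrib sum.inter_restrict)
    also have "\<dots> \<le> (sum s {..<card J} - \<epsilon>) + \<epsilon>"
      using that by (intro add_mono slack tot) auto
    finally show ?thesis by simp
  qed
  show ?case
  proof (cases "N \<le> card J")
    case True
    then show ?thesis using big Suc by blast
  next
    case False
    then have k: "Suc k < N" using Suc by simp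
    show ?thesis
    proof (cases "s k = 0")
      case True
      \<comment> \<open>Here \<open>s\<close> is zero from \<open>k\<close> on, so padding
        \<open>J\<close> to \<open>N\<close> elements leaves the right-hand side unchanged and
        reaches the large case.\<close>
      obtain B where B: "finite B" "card B = N - card J" "B \<subseteq> - J"
        using infinite_arbitrarily_large[of "- J" "N - card J"] Suc.prems by auto
      have c: "card (J \<union> B) = N"
        using B Suc.prems False by (subst card_Un_disjoint) auto
      have "sum d' J \<le> sum d' (J \<union> B)" using B Suc.prems d'0 by (intro sum_mono2) auto
      also have "\<dots> \<le> sum s {..<N}" using big[of "J \<union> B"] B Suc.prems c by simp
      also have "\<dots> = sum s {..<Suc k}"
      proof (rule sum_extend_zero)
        fix i assume "Suc k \<le> i"
        then show "s i = 0" using decseqD[OF dec, of k i] s0[of i] True by simp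
      qed (use k in simp)
      finally show ?thesis using Suc by simp
    next
      case False
      show ?thesis
      proof (cases "J \<inter> M = {}")
        case True
        then have "sum d' J \<le> sum d J" using d'1 by (intro sum_mono) auto
        then show ?thesis using maj[OF Suc.prems] by simp
      next
        case nonempty: False
        then obtain j where j: "j \<in> J" "j \<in> M" by auto
        have cj: "card (J - {j}) = k" using j Suc by simp
        have "sum d' J = d' j + sum d' (J - {j})" using j Suc.prems by (simp add: sum.remove)
        also have "\<dots> \<le> \<theta> + sum s {..<k}"
          using d'3[OF j(2)] Suc.hyps(1)[of "J - {j}"] cj Suc.prems by (intro add_mono) auto
        also have "\<dots> \<le> s k + sum s {..<k}" using \<theta>[of k] k False s0[of k] by simp
        finally show ?thesis using Suc.hyps(2) by (simp flip: Suc.hyps(2))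
      qed
    qed
  qed
qed

lemma summable_columns:
  fixes U W :: "nat \<Rightarrow> nat \<Rightarrow> real"
  assumes "row_contraction U" "row_contraction W" "decseq s" "\<And>i. 0 \<le> s i"
  shows "summable (\<lambda>i. s i * (U i p * W i q))"
proof -
  have a: "summable (\<lambda>i. (V i j)\<^sup>2)" if "row_contraction V" for V :: "nat \<Rightarrow> nat \<Rightarrow> real" and j
    using row_contraction_column[OF that] by (intro summableI_nonneg_bounded[of _ 1]) auto
  have "summable (\<lambda>i. s 0 * ((U i p)\<^sup>2 + (W i q)\<^sup>2))"
    by (intro summable_mult summable_add a assms)
  then show ?thesis
  proof (rule summable_comparison_test'[where N = 0])
    fix i
    have "0 \<le> (\<bar>U i p\<bar> - \<bar>W i q\<bar>)\<^sup>2" by simp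
    also have "\<dots> = (U i p)\<^sup>2 + (W i q)\<^sup>2 - 2 * \<bar>U i p * W i q\<bar>"
      by (simp add: power2_diff abs_mult)
    finally have "\<bar>U i p * W i q\<bar> \<le> (U i p)\<^sup>2 + (W i q)\<^sup>2"
      using abs_ge_zero[of "U i p * W i q"] by linarith
    then have "s i * \<bar>U i p * W i q\<bar> \<le> s 0 * ((U i p)\<^sup>2 + (W i q)\<^sup>2)"
      using decseqD[OF assms(3), of 0 i] assms(4) by (intro mult_mono) auto
    then show "norm (s i * (U i p * W i q)) \<le> s 0 * ((U i p)\<^sup>2 + (W i q)\<^sup>2)"
      using assms(4)[of i] by (simp add: abs_mult)
  qed
qed

text \<open>The slack is used up by merging: infinitely many disjoint pairs of entries are replaced by
  their sum and a zero. The zero columns leave room to dilate \<open>V\<close> to matrices with orthonormal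
  rows, one dilation for each side on disjoint columns, and rotations in the coordinate planes of the
  pairs undo the merging.\<close>

lemma orthonormal_rows_of_merged:
  fixes s d :: "nat \<Rightarrow> real" and \<tau> \<zeta>1 \<zeta>2 :: "nat \<Rightarrow> nat"
  assumes dec: "decseq s" and s0: "\<And>i. 0 \<le> s i" and lim: "s \<longlonglongrightarrow> 0" and d0: "\<And>j. 0 \<le> d j"
    and \<tau>: "\<And>j. \<tau> (\<tau> j) = j" and MZ: "M \<inter> \<tau> ` M = {}" and fix': "\<And>j. j \<notin> M \<union> \<tau> ` M \<Longrightarrow> \<tau> j = j"
    and \<zeta>: "inj \<zeta>1" "inj \<zeta>2" "range \<zeta>1 \<subseteq> \<tau> ` M" "range \<zeta>2 \<subseteq> \<tau> ` M" "range \<zeta>1 \<inter> range \<zeta>2 = {}"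
    and maj: "\<And>J. finite J \<Longrightarrow>
      (\<Sum>j\<in>J. if j \<in> \<tau> ` M then 0 else if j \<in> M then d j + d (\<tau> j) else d j) \<le> sum s {..<card J}"
  shows "\<exists>U W :: nat \<Rightarrow> nat \<Rightarrow> real. (\<forall>i i'. ((\<lambda>j. U i j * U i' j) has_sum of_bool (i = i')) UNIV) \<and>
    (\<forall>i i'. ((\<lambda>j. W i j * W i' j) has_sum of_bool (i = i')) UNIV) \<and>
    (\<forall>j. (\<lambda>i. s i * (U i j * W i j)) sums d j)"
proof -
  define Z where "Z = \<tau> ` M"
  define d' where "d' j = (if j \<in> Z then 0 else if j \<in> M then d j + d (\<tau> j) else d j)" for j
  have \<tau>Z: "\<tau> j \<in> M" if "j \<in> Z" for j using that \<tau> by (auto simp: Z_def)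
  have \<tau>M: "\<tau> j \<in> Z" if "j \<in> M" for j using that by (auto simp: Z_def)
  have dis: "j \<notin> Z" if "j \<in> M" for j using that MZ by (auto simp: Z_def)
  have "0 \<le> d' j" for j by (simp add: d'_def d0)
  then obtain V0 where V0: "row_contraction V0" "\<And>j. (\<lambda>i. s i * (V0 i j)\<^sup>2) sums d' j"
    using schur_horn_row_contraction[OF dec s0 lim, of d'] maj by (auto simp: d'_def Z_def)
  \<comment> \<open>\<open>d' j = 0\<close> forces only the entries of column \<open>j\<close> with
    \<open>s i > 0\<close> to vanish; the others are cleared by hand, which keeps contractivity and
    the series.\<close>
  define V where "V i j = (if j \<in> Z then 0 else V0 i j)" for i j
  have V: "row_contraction V"
    unfolding row_contraction_def
  proof (intro allI)
    fix a :: "nat \<Rightarrow> real" and m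
    have "(\<Sum>j<m. (\<Sum>i<m. a i * V i j)\<^sup>2) \<le> (\<Sum>j<m. (\<Sum>i<m. a i * V0 i j)\<^sup>2)"
    proof (rule sum_mono)
      fix j show "(\<Sum>i<m. a i * V i j)\<^sup>2 \<le> (\<Sum>i<m. a i * V0 i j)\<^sup>2"
        by (cases "j \<in> Z") (simp_all add: V_def)
    qed
    also have "\<dots> \<le> (\<Sum>i<m. (a i)\<^sup>2)" by (rule row_contractionD[OF V0(1)])
    finally show "(\<Sum>j<m. (\<Sum>i<m. a i * V i j)\<^sup>2) \<le> (\<Sum>i<m. (a i)\<^sup>2)" .
  qed
  have Vd: "(\<lambda>i. s i * (V i j)\<^sup>2) sums d' j" for j
    using V0(2)[of j] by (cases "j \<in> Z") (simp_all add: V_def d'_def)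
  have z1: "V i (\<zeta>1 k) = 0" "V i (\<zeta>2 k) = 0" for i k using \<zeta> by (auto simp: V_def Z_def)
  obtain U where U: "\<And>i i'. ((\<lambda>j. U i j * U i' j) has_sum of_bool (i = i')) UNIV"
    "\<And>i j. j \<notin> range \<zeta>1 \<Longrightarrow> U i j = V i j"
    using dilate_rows[OF V \<zeta>(1) z1(1)] by metis
  obtain W where W: "\<And>i i'. ((\<lambda>j. W i j * W i' j) has_sum of_bool (i = i')) UNIV"
    "\<And>i j. j \<notin> range \<zeta>2 \<Longrightarrow> W i j = V i j"
    using dilate_rows[OF V \<zeta>(2) z1(2)] by metis
  have rcU: "row_contraction U" and rcW: "row_contraction W"
    using U(1) W(1) orthonormal_rows_contraction by blast+
  \<comment> \<open>The rotations act on \<open>K\<close> in 2 by 2 blocks. Since the two dilations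
    use disjoint columns, the diagonal of \<open>K\<close> is still \<open>d'\<close>, and at least
    one off-diagonal entry of each pair vanishes.\<close>
  define K where "K p q = (\<Sum>i. s i * (U i p * W i q))" for p q
  have K: "(\<lambda>i. s i * (U i p * W i q)) sums K p q" for p q
    unfolding K_def by (intro summable_sums summable_columns rcU rcW dec s0)
  have Kd: "K j j = d' j" for j
  proof -
    have "U i j * W i j = (V i j)\<^sup>2" for i
      using U(2)[of j i] W(2)[of j i] \<zeta>(5) z1
      by (cases "j \<in> range \<zeta>1"; cases "j \<in> range \<zeta>2") (auto simp: power2_eq_square)
    then show ?thesis using K[of j j] Vd[of j] sums_unique2 by (metis (no_types, lifting) ext)
  qed
  have K0: "K j (\<tau> j) = 0 \<or> K (\<tau> j) j = 0" if "j \<in> M" for j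
  proof -
    have 0: "V i (\<tau> j) = 0" for i using \<tau>M[OF that] by (simp add: V_def)
    show ?thesis
    proof (cases "\<tau> j \<in> range \<zeta>2")
      case True
      then have "U i (\<tau> j) = 0" for i using U(2)[of "\<tau> j"] \<zeta>(5) 0 by auto
      then have "K (\<tau> j) j = 0" by (simp add: K_def)
      then show ?thesis ..
    next
      case False
      then have "W i (\<tau> j) = 0" for i using W(2)[of "\<tau> j"] 0 by auto
      then have "K j (\<tau> j) = 0" by (simp add: K_def)
      then show ?thesis ..
    qed
  qed
  have "\<exists>a b. j \<in> M \<longrightarrow> cos a * cos b * (d j + d (\<tau> j)) + cos a * sin b * K j (\<tau> j) + sin a * cos b * K (\<tau> j) j = d j \<and>
      sin a * sin b * (d j + d (\<tau> j)) - cos a * sin b * K (\<tau> j) j - sin a * cos b * K j (\<tau> j) = d (\<tau> j)" for j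
    using two_rotations[OF d0[of j] d0[of "\<tau> j"] K0] by blast
  then obtain A B where AB: "\<And>j. j \<in> M \<Longrightarrow> cos (A j) * cos (B j) * (d j + d (\<tau> j)) + cos (A j) * sin (B j) * K j (\<tau> j)
      + sin (A j) * cos (B j) * K (\<tau> j) j = d j"
    "\<And>j. j \<in> M \<Longrightarrow> sin (A j) * sin (B j) * (d j + d (\<tau> j)) - cos (A j) * sin (B j) * K (\<tau> j) j
      - sin (A j) * cos (B j) * K j (\<tau> j) = d (\<tau> j)"
    by metis
  \<comment> \<open>The sign change on the second member of each pair makes
    \<open>rotate_columns\<close> a rotation; columns outside the pairs stay fixed.\<close>
  define ang where "ang C j = (if j \<in> M then C j else if j \<in> Z then - C (\<tau> j) else (0::real))" for C j
  have ang: "ang C (\<tau> j) = - ang C j" for C j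
  proof -
    consider "j \<in> M" | "j \<in> Z" | "j \<notin> M \<union> Z" by blast
    then show ?thesis
      using \<tau>M[of j] \<tau>Z[of j] dis[of "\<tau> j"] dis[of j] fix'[of j]
      by cases (auto simp: ang_def \<tau> Z_def)
  qed
  define U' where "U' = rotate_columns \<tau> (ang A) U"
  define W' where "W' = rotate_columns \<tau> (ang B) W"
  have "(\<lambda>i. s i * (U' i j * W' i j)) sums d j" for j
  proof -
    define ca sa cb sb where "ca = cos (ang A j)" and "sa = sin (ang A j)" and "cb = cos (ang B j)" and "sb = sin (ang B j)"
    have "(\<lambda>i. ca * cb * (s i * (U i j * W i j)) + ca * sb * (s i * (U i j * W i (\<tau> j)))
        + sa * cb * (s i * (U i (\<tau> j) * W i j)) + sa * sb * (s i * (U i (\<tau> j) * W i (\<tau> j))))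
      sums (ca * cb * K j j + ca * sb * K j (\<tau> j) + sa * cb * K (\<tau> j) j + sa * sb * K (\<tau> j) (\<tau> j))"
      by (intro sums_add sums_mult K)
    moreover have "ca * cb * (s i * (U i j * W i j)) + ca * sb * (s i * (U i j * W i (\<tau> j)))
        + sa * cb * (s i * (U i (\<tau> j) * W i j)) + sa * sb * (s i * (U i (\<tau> j) * W i (\<tau> j)))
        = s i * (U' i j * W' i j)" for i
      by (simp add: U'_def W'_def rotate_columns_def ca_def sa_def cb_def sb_def algebra_simps)
    moreover have "ca * cb * K j j + ca * sb * K j (\<tau> j) + sa * cb * K (\<tau> j) j + sa * sb * K (\<tau> j) (\<tau> j) = d j"
    proof -
      consider "j \<in> M" | "j \<in> Z" | "j \<notin> M \<union> Z" by blast
      then show ?thesis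
      proof cases
        case 1
        then have "K j j = d j + d (\<tau> j)" "K (\<tau> j) (\<tau> j) = 0"
          using dis[of j] \<tau>M[of j] by (simp_all add: Kd d'_def)
        then show ?thesis using AB(1)[OF 1] 1 by (simp add: ca_def sa_def cb_def sb_def ang_def)
      next
        case 2
        have m: "\<tau> j \<in> M" "j \<notin> M" using 2 \<tau>Z dis by auto
        have k: "K (\<tau> j) (\<tau> j) = d (\<tau> j) + d j" "K j j = 0"
          using dis[of "\<tau> j"] m 2 by (simp_all add: Kd d'_def \<tau>)
        show ?thesis using AB(2)[OF m(1)] m 2 k
          by (simp add: ca_def sa_def cb_def sb_def ang_def \<tau>)
      next
        case 3
        then have "K j j = d j" by (simp add: Kd d'_def)
        then show ?thesis using 3 by (simp add: ca_def sa_def cb_def sb_def ang_def)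
      qed
    qed
    ultimately show ?thesis by simp
  qed
  then show ?thesis
    using rotate_columns_orthonormal[of U \<tau> "ang A", OF U(1) \<tau> ang]
      rotate_columns_orthonormal[of W \<tau> "ang B", OF W(1) \<tau> ang]
    unfolding U'_def W'_def by blast
qed

text \<open>A subsequence \<open>g\<close> of small entries is cut into pairs of consecutive
  positions; the even position receives the sum, the odd one becomes a zero column. Smallness is
  arranged so that \<open>merged_majorization\<close> applies.\<close>

lemma schur_horn_with_slack:
  fixes s d :: "nat \<Rightarrow> real"
  assumes dec: "decseq s" and s0: "\<And>i. 0 \<le> s i" and lim: "s \<longlonglongrightarrow> 0" and d0: "\<And>j. 0 \<le> d j"
    and limd: "d \<longlonglongrightarrow> 0"
    and maj: "\<And>J. finite J \<Longrightarrow> sum d J \<le> sum s {..<card J}"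
    and \<epsilon>: "0 < \<epsilon>" and slack: "\<And>J. finite J \<Longrightarrow> N \<le> card J \<Longrightarrow> sum d J \<le> sum s {..<card J} - \<epsilon>"
  shows "\<exists>U W :: nat \<Rightarrow> nat \<Rightarrow> real. (\<forall>i i'. ((\<lambda>j. U i j * U i' j) has_sum of_bool (i = i')) UNIV) \<and>
    (\<forall>i i'. ((\<lambda>j. W i j * W i' j) has_sum of_bool (i = i')) UNIV) \<and>
    (\<forall>j. (\<lambda>i. s i * (U i j * W i j)) sums d j)"
proof -
  \<comment> \<open>The least positive value among the first \<open>N\<close> terms of
    \<open>s\<close>, capped at 1; the inserted 1 keeps the set nonempty.\<close>
  define \<theta> where "\<theta> = Min (insert 1 {s i |i. i < N \<and> 0 < s i})"
  have fin: "finite (insert 1 {s i |i. i < N \<and> 0 < s i})" by simp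
  have \<theta>0: "0 < \<theta>" unfolding \<theta>_def using fin by (subst Min_gr_iff) auto
  have \<theta>: "\<theta> \<le> s i" if "i < N" "0 < s i" for i
    unfolding \<theta>_def using fin that by (intro Min_le) auto
  \<comment> \<open>Half of \<open>\<theta>\<close> because two entries are added; the factors
    \<open>(1/2) ^ Suc n\<close> have sum 1, so all entries that are moved stay within
    \<open>\<epsilon>\<close> together.\<close>
  obtain g where g: "strict_mono g" "\<And>n. d (g n) \<le> min (\<theta> / 2) (\<epsilon> * (1/2) ^ Suc n)"
    using null_sequence_subsequence_below[OF limd, of "\<lambda>n. min (\<theta> / 2) (\<epsilon> * (1/2) ^ Suc n)"] \<theta>0 \<epsilon>
    by auto
  have inj: "inj g" using g(1) by (simp add: strict_mono_imp_inj_on)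
  define h where "h n = (if even n then Suc n else n - 1)" for n :: nat
  have hh: "h (h n) = n" for n by (cases "even n") (auto simp: h_def elim: oddE)
  have hp: "even (h n) \<longleftrightarrow> odd n" for n by (cases "even n") (auto simp: h_def elim: oddE)
  define \<tau> where "\<tau> j = (if j \<in> range g then g (h (inv g j)) else j)" for j
  have \<tau>g: "\<tau> (g n) = g (h n)" for n using inj by (simp add: \<tau>_def)
  have \<tau>\<tau>: "\<tau> (\<tau> j) = j" for j
  proof (cases "j \<in> range g")
    case True
    then show ?thesis using \<tau>g hh by auto
  next
    case False
    then show ?thesis by (simp add: \<tau>_def)
  qed
  define M where "M = g ` {n. even n}"
  have ZM: "\<tau> ` M = g ` {n. odd n}"
  proof -
    have "h ` {n. even n} = {n. odd n}"
      using hh hp by (auto simp: image_iff) (metis hh hp)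
    moreover have "\<tau> ` M = g ` h ` {n. even n}" by (simp add: M_def image_image \<tau>g)
    ultimately show ?thesis by simp
  qed
  have gM: "g n \<in> M \<longleftrightarrow> even n" "g n \<in> \<tau> ` M \<longleftrightarrow> odd n" for n
    unfolding ZM unfolding M_def using inj by (auto simp: inj_eq)
  show ?thesis
  proof (rule orthonormal_rows_of_merged[OF dec s0 lim d0 \<tau>\<tau>])
    show "M \<inter> \<tau> ` M = {}" unfolding ZM unfolding M_def using inj by (auto simp: inj_eq)
    show "\<tau> j = j" if "j \<notin> M \<union> \<tau> ` M" for j
    proof -
      have "j \<notin> range g" using that gM by auto
      then show ?thesis by (simp add: \<tau>_def)
    qed
    \<comment> \<open>The odd positions split into the residues 1 and 3 modulo 4, giving infinitely
      many zero columns to each of the two dilations.\<close>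
    show "inj (\<lambda>k. g (4 * k + 1))" "inj (\<lambda>k. g (4 * k + 3))"
      by (auto intro!: injI dest!: injD[OF inj])
    show "range (\<lambda>k. g (4 * k + 1)) \<subseteq> \<tau> ` M" "range (\<lambda>k. g (4 * k + 3)) \<subseteq> \<tau> ` M"
      using gM by auto
    show "range (\<lambda>k. g (4 * k + 1)) \<inter> range (\<lambda>k. g (4 * k + 3)) = {}"
    proof -
      have "4 * k + 1 \<noteq> 4 * l + 3" for k l :: nat by presburger
      then show ?thesis using inj by (auto simp: inj_eq)
    qed
    show "(\<Sum>j\<in>J. if j \<in> \<tau> ` M then 0 else if j \<in> M then d j + d (\<tau> j) else d j) \<le> sum s {..<card J}"
      if "finite J" for J
    proof (rule merged_majorization[OF s0 dec maj slack \<theta>, where e = "\<lambda>j. d (\<tau> j)" and M = M])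
      show "(\<Sum>j\<in>J. d (\<tau> j)) \<le> \<epsilon>" if J: "finite J" "J \<subseteq> M" for J
      proof -
        obtain K where K: "K \<subseteq> {n. even n}" "J = g ` K" using J(2) unfolding M_def by (meson subset_imageE)
        have finK: "finite K" using J(1) K(2) inj by (metis finite_imageD inj_on_subset subset_UNIV)
        have "(\<Sum>j\<in>J. d (\<tau> j)) = (\<Sum>n\<in>K. d (g (h n)))"
          unfolding K(2) using inj by (subst sum.reindex) (auto simp: \<tau>g inj_on_def)
        also have "\<dots> \<le> (\<Sum>n\<in>K. \<epsilon> * (1/2) ^ Suc n)"
        proof (rule sum_mono)
          fix n assume "n \<in> K"
          then have "h n = Suc n" using K(1) by (auto simp: h_def)
          then have "d (g (h n)) \<le> \<epsilon> * (1/2) ^ Suc (Suc n)" using g(2)[of "Suc n"] by simp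
          also have "\<dots> \<le> \<epsilon> * (1/2) ^ Suc n" using \<epsilon> by simp
          finally show "d (g (h n)) \<le> \<epsilon> * (1/2) ^ Suc n" .
        qed
        also have "\<dots> = \<epsilon> * (\<Sum>n\<in>K. (1/2) ^ Suc n)" by (simp only: sum_distrib_left)
        also have "\<dots> \<le> \<epsilon> * 1"
        proof (intro mult_left_mono)
          have "(\<Sum>n\<in>K. (1/2::real) ^ Suc n) \<le> (\<Sum>n. (1/2) ^ Suc n)"
            by (rule sum_le_suminf[OF sums_summable[OF power_half_series] finK]) simp
          then show "(\<Sum>n\<in>K. (1/2::real) ^ Suc n) \<le> 1"
            using sums_unique[OF power_half_series] by simp
        qed (use \<epsilon> in simp)
        finally show ?thesis by simp
      qed
      show "(if j \<in> \<tau> ` M then 0 else if j \<in> M then d j + d (\<tau> j) else d j) \<le> \<theta>" if jM: "j \<in> M" for j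
      proof -
        obtain n where n: "j = g n" "even n" using jM by (auto simp: M_def)
        have "d (g n) \<le> \<theta> / 2" "d (g (h n)) \<le> \<theta> / 2" using g(2)[of n] g(2)[of "h n"] by auto
        then show ?thesis using n gM \<tau>g \<theta>0 by auto
      qed
    qed (use that d0 in \<open>auto intro: add_nonneg_nonneg\<close>)
  qed
qed

text \<open>Orthonormality is claimed only where \<open>s i > 0\<close>: the tight case gives no
  information on the other rows, and these do not contribute to the diagonal.\<close>

theorem diagonal_from_orthonormal_rows:
  fixes s d :: "nat \<Rightarrow> real"
  assumes dec: "decseq s" and s0: "\<And>i. 0 \<le> s i" and lim: "s \<longlonglongrightarrow> 0" and d0: "\<And>j. 0 \<le> d j"
    and limd: "d \<longlonglongrightarrow> 0"
    and maj: "\<And>J. finite J \<Longrightarrow> sum d J \<le> sum s {..<card J}"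
  shows "\<exists>U W :: nat \<Rightarrow> nat \<Rightarrow> real.
    (\<forall>i i'. 0 < s i \<longrightarrow> 0 < s i' \<longrightarrow> ((\<lambda>j. U i j * U i' j) has_sum of_bool (i = i')) UNIV) \<and>
    (\<forall>i i'. 0 < s i \<longrightarrow> 0 < s i' \<longrightarrow> ((\<lambda>j. W i j * W i' j) has_sum of_bool (i = i')) UNIV) \<and>
    (\<forall>j. (\<lambda>i. s i * (U i j * W i j)) sums d j)"
proof (cases "\<forall>\<epsilon> N. 0 < \<epsilon> \<longrightarrow> (\<exists>J. finite J \<and> N \<le> card J \<and> sum s {..<card J} - \<epsilon> < sum d J)")
  case True
  obtain V where V: "row_contraction V" "\<And>j. (\<lambda>i. s i * (V i j)\<^sup>2) sums d j"
    using schur_horn_row_contraction[OF dec s0 lim d0 maj] by metis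
  have "((\<lambda>j. V i j * V i' j) has_sum of_bool (i = i')) UNIV" if "0 < s i" for i i'
  proof -
    have 1: "row_gram V i i = 1" using tight_row_gram[OF V(1) dec s0 lim V(2) _ that] True by blast
    \<comment> \<open>A unit row gives a zero diagonal entry of the positive semidefinite defect, so
      the whole row of the defect vanishes; this is orthogonality to all other rows.\<close>
    have "row_gram V i i' = of_bool (i = i')"
      using psd_zero(2)[OF row_contraction_defect_psd[OF V(1)], of i i'] 1 by (cases "i = i'") auto
    then show ?thesis using row_contraction_has_sum[OF V(1), of i i'] by simp
  qed
  then show ?thesis using V(2) by (intro exI[of _ V]) (simp add: power2_eq_square)
next
  case False
  then obtain \<epsilon> N where \<epsilon>: "0 < \<epsilon>" and slack: "\<And>J. finite J \<Longrightarrow> N \<le> card J \<Longrightarrow> sum d J \<le> sum s {..<card J} - \<epsilon>"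
    by (meson not_le)
  have "\<exists>U W :: nat \<Rightarrow> nat \<Rightarrow> real. (\<forall>i i'. ((\<lambda>j. U i j * U i' j) has_sum of_bool (i = i')) UNIV) \<and>
    (\<forall>i i'. ((\<lambda>j. W i j * W i' j) has_sum of_bool (i = i')) UNIV) \<and>
    (\<forall>j. (\<lambda>i. s i * (U i j * W i j)) sums d j)"
    by (rule schur_horn_with_slack[OF dec s0 lim d0 limd _ \<epsilon>]) (use maj slack in auto)
  then show ?thesis by blast
qed

subsection \<open>Decreasing enumerations\<close>

text \<open>The first \<open>Suc n\<close> enumerated members attain the value. Conversely, any
  \<open>Suc n\<close> members include one that is not among the first \<open>n\<close> enumerated,
  and it is bounded by \<open>f (p n)\<close>.\<close>

lemma nth_largest_enumeration:
  fixes f :: "'i \<Rightarrow> real" and p :: "nat \<Rightarrow> 'i"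
  assumes inj: "inj p" and sub: "range p \<subseteq> I" and dec: "decseq (\<lambda>n. f (p n))"
    and rest: "\<And>n x. x \<in> I \<Longrightarrow> x \<notin> p ` {..<n} \<Longrightarrow> f x \<le> f (p n)"
  shows "nth_largest f I n = f (p n)"
  unfolding nth_largest_def
proof (rule Greatest_equality)
  show "\<exists>J\<subseteq>I. card J = Suc n \<and> (\<forall>j\<in>J. f (p n) \<le> f j)"
  proof (intro exI[of _ "p ` {..n}"] conjI ballI)
    show "card (p ` {..n}) = Suc n" using inj by (simp add: card_image inj_on_subset)
  qed (use sub decseqD[OF dec] in auto)
next
  fix t assume "\<exists>J\<subseteq>I. card J = Suc n \<and> (\<forall>j\<in>J. t \<le> f j)"
  then obtain J where J: "J \<subseteq> I" "card J = Suc n" "\<And>j. j \<in> J \<Longrightarrow> t \<le> f j" by blast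
  have "\<not> J \<subseteq> p ` {..<n}"
  proof
    assume "J \<subseteq> p ` {..<n}"
    then have "card J \<le> card (p ` {..<n})" by (intro card_mono) auto
    also have "\<dots> \<le> n" using card_image_le[of "{..<n}" p] by simp
    finally show False using J(2) by simp
  qed
  then obtain x where "x \<in> J" "x \<notin> p ` {..<n}" by blast
  then show "t \<le> f (p n)" using J rest[of x n] by force
qed

lemma null_sequence_enumeration:
  fixes f :: "nat \<Rightarrow> real"
  assumes f0: "\<And>j. 0 \<le> f j" and lim: "f \<longlonglongrightarrow> 0"
  shows "\<exists>p :: nat \<Rightarrow> nat. inj p \<and> (\<forall>n y. y \<notin> p ` {..<n} \<longrightarrow> f y \<le> f (p n))"
proof -
  have ex: "\<exists>x. x \<notin> F \<and> (\<forall>y. y \<notin> F \<longrightarrow> f y \<le> f x)" if finF: "finite F" for F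
  proof (cases "\<exists>y0. y0 \<notin> F \<and> f y0 > 0")
    case True
    then obtain y0 where y0: "y0 \<notin> F" "f y0 > 0" by blast
    define Y where "Y = {y. y \<notin> F \<and> f y0 \<le> f y}"
    obtain N where N: "\<And>y. y \<ge> N \<Longrightarrow> f y < f y0"
      using order_tendstoD(2)[OF lim y0(2)] by (auto simp: eventually_sequentially)
    have "Y \<subseteq> {..<N}"
    proof
      fix y assume "y \<in> Y"
      then have "\<not> f y < f y0" by (simp add: Y_def)
      then show "y \<in> {..<N}" using N[of y] by (cases "y < N") auto
    qed
    then have fin: "finite Y" using finite_subset by blast
    have "Y \<noteq> {}" using y0 by (auto simp: Y_def)
    then have "Max (f ` Y) \<in> f ` Y" using fin by (intro Max_in) auto
    then obtain x where x: "x \<in> Y" "f x = Max (f ` Y)" by (metis imageE)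
    have "f y \<le> f x" if "y \<notin> F" for y
    proof (cases "f y0 \<le> f y")
      case True
      then show ?thesis using that x(2) fin by (simp add: Y_def)
    next
      case False
      then show ?thesis using x(1) by (simp add: Y_def)
    qed
    then show ?thesis using x(1) by (auto simp: Y_def)
  next
    case False
    obtain x where "x \<notin> F" using ex_new_if_finite[OF infinite_UNIV_nat finF] by blast
    moreover have "f y \<le> f x" if "y \<notin> F" for y
    proof -
      have "f y \<le> 0" using False that by (auto simp: not_less)
      then show ?thesis using f0[of x] by simp
    qed
    ultimately show ?thesis by blast
  qed
  define P where "P p n r \<longleftrightarrow> r \<notin> p ` {..<n} \<and> (\<forall>y. y \<notin> p ` {..<n} \<longrightarrow> f y \<le> f r)"
    for p :: "nat \<Rightarrow> nat" and n r
  have "\<exists>p. \<forall>n. P p n (p n)"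
  proof (rule dependent_wellorder_choice[where P = P])
    fix r :: nat and p q :: "nat \<Rightarrow> nat" and n
    assume "\<And>y. y < n \<Longrightarrow> p y = q y"
    then have "p ` {..<n} = q ` {..<n}" by (intro image_cong) auto
    then show "P p n r = P q n r" by (simp add: P_def)
  next
    fix n and p :: "nat \<Rightarrow> nat"
    show "\<exists>r. P p n r" unfolding P_def by (rule ex) simp
  qed
  then obtain p where "\<forall>n. P p n (p n)" ..
  then have p: "p n \<notin> p ` {..<n}" "y \<notin> p ` {..<n} \<longrightarrow> f y \<le> f (p n)" for n y
    unfolding P_def by simp_all
  have "inj p"
  proof (rule linorder_injI)
    fix x y :: nat assume "x < y"
    then show "p x \<noteq> p y" using p(1)[of y] by (metis image_eqI lessThan_iff)
  qed
  then show ?thesis using p(2) by auto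
qed

text \<open>Among all sets of \<open>k\<close> indices, the first \<open>k\<close> of the
  enumeration have the largest sum: exchanging some of them for other indices replaces terms that
  are at least \<open>t\<close> by terms that are at most \<open>t\<close>.\<close>

lemma rearrangement_sum_le_iff:
  fixes f :: "nat \<Rightarrow> real"
  assumes f0: "\<And>j. 0 \<le> f j" and lim: "f \<longlonglongrightarrow> 0"
  shows "(\<forall>k. (\<Sum>i<k. rearrangement f i) \<le> S k) \<longleftrightarrow> (\<forall>J. finite J \<longrightarrow> sum f J \<le> S (card J))"
proof -
  obtain p :: "nat \<Rightarrow> nat" where "inj p \<and> (\<forall>n y. y \<notin> p ` {..<n} \<longrightarrow> f y \<le> f (p n))"
    using null_sequence_enumeration[OF f0 lim] ..
  then have inj: "inj p" and p: "y \<notin> p ` {..<n} \<longrightarrow> f y \<le> f (p n)" for n y by simp_all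
  have dec: "decseq (\<lambda>n. f (p n))"
  proof (rule decseq_SucI)
    fix n
    have "p (Suc n) \<notin> p ` {..<n}" using inj by (simp add: inj_image_mem_iff)
    then show "f (p (Suc n)) \<le> f (p n)" using p by simp
  qed
  have r: "rearrangement f n = f (p n)" for n
    unfolding rearrangement_def using p by (intro nth_largest_enumeration[OF inj _ dec]) simp_all
  have sump: "(\<Sum>i<k. rearrangement f i) = sum f (p ` {..<k})" for k
    using inj by (simp add: r sum.reindex inj_on_subset)
  have cp: "card (p ` {..<k}) = k" for k using inj by (simp add: card_image inj_on_subset)
  have le: "sum f J \<le> sum f (p ` {..<card J})" if J: "finite J" for J
  proof -
    define P where "P = p ` {..<card J}"
    have fP: "finite P" "card P = card J" by (simp_all add: P_def cp)
    have "card (J - P) = card (P - J)"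
      using J fP by (simp add: card_Diff_subset_Int Int_commute)
    define t where "t = f (p (card J - 1))"
    have 1: "f j \<le> t" if "j \<in> J - P" for j
    proof -
      have "card J > 0" using that J by (auto simp: card_gt_0_iff)
      then have "p ` {..<card J - 1} \<subseteq> P" by (auto simp: P_def)
      then have "j \<notin> p ` {..<card J - 1}" using that by blast
      then show ?thesis using p unfolding t_def by simp
    qed
    have 2: "t \<le> f j" if "j \<in> P - J" for j
      using that decseqD[OF dec] by (auto simp: P_def t_def)
    have "sum f (J - P) \<le> of_nat (card (J - P)) * t" by (rule sum_bounded_above) (rule 1)
    also have "\<dots> \<le> sum f (P - J)" unfolding \<open>card (J - P) = card (P - J)\<close> by (rule sum_bounded_below) (rule 2)
    finally have "sum f (J - P) + sum f (J \<inter> P) \<le> sum f (P - J) + sum f (J \<inter> P)" by simp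
    then show ?thesis
      using sum.Int_Diff[of J f P] sum.Int_Diff[of P f J] J fP by (simp add: P_def Int_commute add.commute)
  qed
  show ?thesis
  proof (intro iffI allI impI)
    fix J :: "nat set" assume "\<forall>k. (\<Sum>i<k. rearrangement f i) \<le> S k" and J: "finite J"
    then show "sum f J \<le> S (card J)" using le[OF J] by (metis order_trans sump)
  next
    fix k assume a: "\<forall>J. finite J \<longrightarrow> sum f J \<le> S (card J)"
    show "(\<Sum>i<k. rearrangement f i) \<le> S k" using a[rule_format, of "p ` {..<k}"] by (simp add: sump cp)
  qed
qed

subsection \<open>Inner product spaces over the real or complex numbers\<close>

text \<open>Covers real and complex scalars at once: \<open>cj\<close> is conjugation and
  \<open>re\<close> the real part. Norm, topology and boundedness remain those of the underlying
  real space, linked to \<open>ip\<close> by \<open>re_ip\<close>. The sort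
  \<open>heine_borel\<close> makes balls of scalars compact, which
  \<open>compact_combinations\<close> uses.\<close>

locale scalar_inner = vs: vector_space sc
  for sc :: "'f::{real_normed_field, heine_borel} \<Rightarrow> 'a::{real_inner, complete_space} \<Rightarrow> 'a" +
  fixes ip :: "'a \<Rightarrow> 'a \<Rightarrow> 'f" and cj :: "'f \<Rightarrow> 'f" and re :: "'f \<Rightarrow> real"
  assumes ip_add_left: "ip (x + y) z = ip x z + ip y z"
    and ip_sc_left: "ip (sc c x) y = c * ip x y"
    and ip_commute: "ip x y = cj (ip y x)"
    and re_ip: "re (ip x y) = inner x y"
    and sc_of_real: "sc (of_real r) x = r *\<^sub>R x"
    and cj_add: "cj (a + b) = cj a + cj b"
    and cj_mult: "cj (a * b) = cj a * cj b"
    and cj_cj: "cj (cj a) = a"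
    and cj_of_real: "cj (of_real r) = of_real r"
    and cj_self: "cj a = a \<Longrightarrow> a = of_real (re a)"
    and mult_cj: "a * cj a = of_real ((norm a)\<^sup>2)"
    and re_of_real: "re (of_real r) = r"
begin

lemma cj_0 [simp]: "cj 0 = 0"
  using cj_of_real[of 0] by simp

lemma norm_cj [simp]: "norm (cj a) = norm a"
proof (cases "a = 0")
  case False
  have "norm a * norm (cj a) = norm a * norm a"
    using arg_cong[OF mult_cj[of a], of norm] by (simp add: norm_mult power2_eq_square)
  then show ?thesis using False by simp
qed simp

lemma ip_self: "ip x x = of_real ((norm x)\<^sup>2)"
  using cj_self[of "ip x x"] ip_commute[of x x] by (simp add: re_ip power2_norm_eq_inner)

lemma ip_add_right: "ip x (y + z) = ip x y + ip x z"
  using ip_commute[of x "y + z"] ip_commute[of x y] ip_commute[of x z]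
  by (simp add: ip_add_left cj_add)

lemma ip_sc_right: "ip x (sc c y) = cj c * ip x y"
  using ip_commute[of x "sc c y"] ip_commute[of x y] by (simp add: ip_sc_left cj_mult)

lemma ip_scaleR_left: "ip (r *\<^sub>R x) y = of_real r * ip x y"
  using ip_sc_left[of "of_real r" x y] by (simp add: sc_of_real)

lemma ip_scaleR_right: "ip x (r *\<^sub>R y) = of_real r * ip x y"
  using ip_sc_right[of x "of_real r" y] by (simp add: sc_of_real cj_of_real)

lemma norm_sc: "norm (sc c x) = norm c * norm x"
proof -
  have "of_real ((norm (sc c x))\<^sup>2) = (c * cj c) * ip x x"
    by (simp only: ip_self[symmetric] ip_sc_left ip_sc_right mult_ac)
  also have "\<dots> = (of_real ((norm c * norm x)\<^sup>2) :: 'f)" by (simp add: mult_cj ip_self power_mult_distrib)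
  finally have "(norm (sc c x))\<^sup>2 = (norm c * norm x)\<^sup>2" by (simp only: of_real_eq_iff)
  then show ?thesis by simp
qed

lemma norm_ip_le: "norm (ip x y) \<le> norm x * norm y"
proof (cases "ip x y = 0")
  case False
  have "of_real ((norm (ip x y))\<^sup>2) = ip (sc (cj (ip x y)) x) y"
    by (simp only: ip_sc_left mult_cj[symmetric] mult.commute)
  then have "(norm (ip x y))\<^sup>2 = inner (sc (cj (ip x y)) x) y"
    by (metis re_ip re_of_real)
  also have "\<dots> \<le> norm (ip x y) * norm x * norm y"
    using norm_cauchy_schwarz[of "sc (cj (ip x y)) x" y] by (simp add: norm_sc)
  finally have "norm (ip x y) * norm (ip x y) \<le> norm (ip x y) * (norm x * norm y)"
    by (simp add: power2_eq_square mult.assoc)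
  then show ?thesis using False by simp
qed simp

lemma bounded_bilinear_ip: "bounded_bilinear ip"
proof
  show "\<exists>K. \<forall>a b. norm (ip a b) \<le> norm a * norm b * K"
    using norm_ip_le by (intro exI[of _ 1]) simp
qed (simp_all add: ip_add_left ip_add_right ip_scaleR_left ip_scaleR_right scaleR_conv_of_real)

lemma sc_scaleR: "sc c (r *\<^sub>R x) = r *\<^sub>R sc c x" "sc (r *\<^sub>R c) x = r *\<^sub>R sc c x"
  by (simp_all add: sc_of_real[symmetric] vs.scale_scale mult.commute scaleR_conv_of_real)

lemma bounded_bilinear_sc: "bounded_bilinear sc"
proof
  show "\<exists>K. \<forall>a b. norm (sc a b) \<le> norm a * norm b * K"
    by (intro exI[of _ 1]) (simp add: norm_sc)
qed (simp_all add: vs.scale_left_distrib vs.scale_right_distrib sc_scaleR)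

sublocale ip: bounded_bilinear ip by (rule bounded_bilinear_ip)
sublocale sc: bounded_bilinear sc by (rule bounded_bilinear_sc)

lemma ip_eq_0_commute: "ip x y = 0 \<longleftrightarrow> ip y x = 0"
  by (metis cj_0 ip_commute)

lemma ip_self_eq_0: "ip x x = 0 \<longleftrightarrow> x = 0"
  by (simp add: ip_self)

lemma ip_eqI: "(\<And>z. ip x z = ip y z) \<Longrightarrow> x = y"
  using ip_self_eq_0[of "x - y"] by (simp add: ip.diff_left)

subsection \<open>Finite orthonormal families\<close>

text \<open>Zero vectors are allowed, as in the family of normalised images of singular vectors.\<close>

definition orthogonal_units :: "'i set \<Rightarrow> ('i \<Rightarrow> 'a) \<Rightarrow> bool" where
  "orthogonal_units I v \<longleftrightarrow> (\<forall>i\<in>I. \<forall>j\<in>I. i \<noteq> j \<longrightarrow> ip (v i) (v j) = 0) \<and>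
    (\<forall>i\<in>I. v i = 0 \<or> norm (v i) = 1)"

definition orthonormal :: "'i set \<Rightarrow> ('i \<Rightarrow> 'a) \<Rightarrow> bool" where
  "orthonormal I v \<longleftrightarrow> (\<forall>i\<in>I. \<forall>j\<in>I. ip (v i) (v j) = of_bool (i = j))"

lemma orthonormal_norm: "orthonormal I v \<Longrightarrow> i \<in> I \<Longrightarrow> norm (v i) = 1"
proof -
  assume "orthonormal I v" "i \<in> I"
  then have "of_real ((norm (v i))\<^sup>2) = (of_real 1 :: 'f)"
    by (simp only: ip_self[symmetric]) (simp add: orthonormal_def)
  then have "(norm (v i))\<^sup>2 = 1" by (simp only: of_real_eq_iff)
  then show ?thesis using norm_ge_zero[of "v i"] by (auto simp: power2_eq_1_iff)
qed

lemma orthonormal_iff: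
  "orthonormal I v \<longleftrightarrow> (\<forall>i\<in>I. norm (v i) = 1) \<and> (\<forall>i\<in>I. \<forall>j\<in>I. i \<noteq> j \<longrightarrow> ip (v i) (v j) = 0)"
proof
  show "orthonormal I v \<Longrightarrow> (\<forall>i\<in>I. norm (v i) = 1) \<and> (\<forall>i\<in>I. \<forall>j\<in>I. i \<noteq> j \<longrightarrow> ip (v i) (v j) = 0)"
    using orthonormal_norm[of I v] by (auto simp: orthonormal_def)
next
  assume "(\<forall>i\<in>I. norm (v i) = 1) \<and> (\<forall>i\<in>I. \<forall>j\<in>I. i \<noteq> j \<longrightarrow> ip (v i) (v j) = 0)"
  then show "orthonormal I v" unfolding orthonormal_def by (auto simp: ip_self)
qed

lemma orthonormal_imp_orthogonal_units: "orthonormal I v \<Longrightarrow> orthogonal_units I v"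
  by (auto simp: orthonormal_iff orthogonal_units_def)

lemma orthonormal_subset: "orthonormal I v \<Longrightarrow> J \<subseteq> I \<Longrightarrow> orthonormal J v"
  unfolding orthonormal_def by blast

lemma orthogonal_units_subset: "orthogonal_units I v \<Longrightarrow> J \<subseteq> I \<Longrightarrow> orthogonal_units J v"
  unfolding orthogonal_units_def by blast

definition proj :: "'i set \<Rightarrow> ('i \<Rightarrow> 'a) \<Rightarrow> 'a \<Rightarrow> 'a" where
  "proj I v x = (\<Sum>i\<in>I. sc (ip x (v i)) (v i))"

lemma ip_sum_orthogonal_units:
  assumes "orthogonal_units I v" "finite I" "j \<in> I"
  shows "ip (\<Sum>i\<in>I. sc (c i) (v i)) (v j) = (if v j = 0 then 0 else c j)"
proof -
  have "ip (\<Sum>i\<in>I. sc (c i) (v i)) (v j) = (\<Sum>i\<in>I. c i * ip (v i) (v j))"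
    by (simp add: ip.sum_left ip_sc_left)
  also have "\<dots> = (\<Sum>i\<in>I. if i = j then (if v j = 0 then 0 else c j) else 0)"
    using assms by (intro sum.cong refl) (auto simp: orthogonal_units_def ip_self ip.zero_left)
  finally show ?thesis using assms by simp
qed

lemma ip_diff_proj:
  assumes "orthogonal_units I v" "finite I" "j \<in> I"
  shows "ip (x - proj I v x) (v j) = 0"
  using ip_sum_orthogonal_units[OF assms, of "\<lambda>i. ip x (v i)"]
  by (auto simp: ip.diff_left proj_def ip.zero_right)

lemma norm_diff_proj:
  assumes "orthogonal_units I v" "finite I"
  shows "(norm (x - proj I v x))\<^sup>2 = (norm x)\<^sup>2 - (\<Sum>i\<in>I. (norm (ip x (v i)))\<^sup>2)"
proof -
  have "ip (x - proj I v x) (proj I v x) = (\<Sum>i\<in>I. cj (ip x (v i)) * ip (x - proj I v x) (v i))"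
    by (simp add: proj_def[of I v x] ip.sum_right ip_sc_right)
  also have "\<dots> = 0" using ip_diff_proj[OF assms] by simp
  finally have "ip (x - proj I v x) (x - proj I v x) = ip (x - proj I v x) x"
    by (simp add: ip.diff_right)
  also have "\<dots> = ip x x - (\<Sum>i\<in>I. ip x (v i) * cj (ip x (v i)))"
    using ip_commute[of "v _" x] by (simp add: ip.diff_left proj_def ip.sum_left ip_sc_left)
  finally have "of_real ((norm (x - proj I v x))\<^sup>2) =
      (of_real ((norm x)\<^sup>2 - (\<Sum>i\<in>I. (norm (ip x (v i)))\<^sup>2)) :: 'f)"
    by (simp add: ip_self mult_cj)
  then show ?thesis by (simp only: of_real_eq_iff)
qed

lemma bessel:
  assumes "orthogonal_units I v" "finite I"
  shows "(\<Sum>i\<in>I. (norm (ip x (v i)))\<^sup>2) \<le> (norm x)\<^sup>2"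
  using norm_diff_proj[OF assms, of x] zero_le_power2[of "norm (x - proj I v x)"] by linarith

lemma norm_sum_orthogonal_units:
  assumes "orthogonal_units I v" "finite I"
  shows "(norm (\<Sum>i\<in>I. sc (c i) (v i)))\<^sup>2 \<le> (\<Sum>i\<in>I. (norm (c i))\<^sup>2)"
proof -
  define y where "y = (\<Sum>i\<in>I. sc (c i) (v i))"
  have "ip y y = (\<Sum>i\<in>I. cj (c i) * ip y (v i))"
    by (subst (2) y_def) (simp add: ip.sum_right ip_sc_right)
  also have "\<dots> = (\<Sum>i\<in>I. of_real (if v i = 0 then 0 else (norm (c i))\<^sup>2))"
    using ip_sum_orthogonal_units[OF assms, of _ c]
    by (intro sum.cong refl) (auto simp: y_def mult.commute[of "cj _"] mult_cj)
  finally have "of_real ((norm y)\<^sup>2) = (of_real (\<Sum>i\<in>I. if v i = 0 then 0 else (norm (c i))\<^sup>2) :: 'f)"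
    by (simp add: ip_self)
  then have "(norm y)\<^sup>2 = (\<Sum>i\<in>I. if v i = 0 then 0 else (norm (c i))\<^sup>2)"
    by (simp only: of_real_eq_iff)
  also have "\<dots> \<le> (\<Sum>i\<in>I. (norm (c i))\<^sup>2)" by (intro sum_mono) auto
  finally show ?thesis by (simp add: y_def)
qed

lemma proj_in_span: "finite I \<Longrightarrow> proj I v x \<in> vs.span (v ` I)"
  unfolding proj_def by (intro vs.span_sum vs.span_scale vs.span_base) auto

lemma orthonormal_independent:
  assumes "orthonormal I v"
  shows "vs.independent (v ` I)" "inj_on v I"
proof -
  show inj: "inj_on v I"
  proof (rule inj_onI)
    fix i j assume "i \<in> I" "j \<in> I" "v i = v j"
    then have "of_bool (i = j) = (of_bool True :: 'f)"
      using assms unfolding orthonormal_def by (metis (full_types))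
    then show "i = j" by (cases "i = j") auto
  qed
  show "vs.independent (v ` I)"
    unfolding vs.independent_explicit_finite_subsets
  proof (intro allI impI ballI)
    fix S u w assume S: "S \<subseteq> v ` I" "finite S" and sum: "(\<Sum>x\<in>S. sc (u x) x) = 0" and w: "w \<in> S"
    have "orthogonal_units S (\<lambda>x. x)"
      unfolding orthogonal_units_def
    proof (intro conjI ballI impI disjI2)
      fix x y assume "x \<in> S" "y \<in> S" "x \<noteq> y"
      then obtain i j where "i \<in> I" "j \<in> I" "x = v i" "y = v j" "i \<noteq> j" using S by blast
      then show "ip x y = 0" using assms by (simp add: orthonormal_def)
    next
      fix x assume "x \<in> S"
      then show "norm x = 1" using S orthonormal_norm[OF assms] by blast
    qed
    from ip_sum_orthogonal_units[OF this S(2) w, of u]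
    have "w = 0 \<or> u w = 0" by (simp add: sum ip.zero_left split: if_splits)
    moreover have "norm w = 1" using S w orthonormal_norm[OF assms] by blast
    ultimately show "u w = 0" by auto
  qed
qed

text \<open>No finite set spans, so some vector has a nonzero residual after projection. The second
  form is a Gram-Schmidt step that also captures a prescribed \<open>z\<close>.\<close>

lemma exists_unit_orthogonal:
  assumes "orthonormal I v" "finite I" and inf: "\<nexists>B. finite B \<and> vs.span B = UNIV"
  shows "\<exists>x. norm x = 1 \<and> (\<forall>i\<in>I. ip x (v i) = 0)"
    and "\<exists>x. norm x = 1 \<and> (\<forall>i\<in>I. ip x (v i) = 0) \<and> z \<in> vs.span (insert x (v ` I))"
proof -
  note on = orthonormal_imp_orthogonal_units[OF assms(1)]
  have *: "\<exists>x. norm x = 1 \<and> (\<forall>i\<in>I. ip x (v i) = 0) \<and> y \<in> vs.span (insert x (v ` I))"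
    if "y \<notin> vs.span (v ` I)" for y
  proof -
    define r where "r = y - proj I v y"
    have "r \<noteq> 0" using that proj_in_span[OF assms(2), of v y] by (auto simp: r_def)
    define x where "x = (1 / norm r) *\<^sub>R r"
    have "norm x = 1" using \<open>r \<noteq> 0\<close> by (simp add: x_def)
    moreover have "ip x (v i) = 0" if "i \<in> I" for i
      using ip_diff_proj[OF on assms(2) that, of y] by (simp add: x_def r_def ip_scaleR_left)
    moreover have "y = sc (of_real (norm r)) x + proj I v y"
      using \<open>r \<noteq> 0\<close> by (simp add: x_def sc_of_real) (simp add: r_def)
    then have "y \<in> vs.span (insert x (v ` I))"
      using proj_in_span[OF assms(2), of v y] vs.span_mono[of "v ` I" "insert x (v ` I)"]
      by (metis (no_types, lifting) insertI1 subset_insertI subsetD vs.span_add vs.span_base vs.span_scale)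
    ultimately show ?thesis by blast
  qed
  have "vs.span (v ` I) \<noteq> UNIV" using inf assms(2) by blast
  then obtain y where "y \<notin> vs.span (v ` I)" by blast
  from *[OF this] show ex: "\<exists>x. norm x = 1 \<and> (\<forall>i\<in>I. ip x (v i) = 0)" by blast
  show "\<exists>x. norm x = 1 \<and> (\<forall>i\<in>I. ip x (v i) = 0) \<and> z \<in> vs.span (insert x (v ` I))"
  proof (cases "z \<in> vs.span (v ` I)")
    case True
    then show ?thesis using ex vs.span_mono[of "v ` I" "insert _ (v ` I)"] by blast
  qed (rule *)
qed

text \<open>A recursion scheme shared by singular vectors, bases and extensions. The congruence
  condition says that \<open>Q v n\<close> looks only at the first \<open>n\<close> vectors, which
  makes the dependent choice legitimate.\<close>

lemma greedy_orthonormal: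
  fixes Q :: "(nat \<Rightarrow> 'a) \<Rightarrow> nat \<Rightarrow> 'a \<Rightarrow> bool"
  assumes cong: "\<And>v w n x. (\<And>i. i < n \<Longrightarrow> v i = w i) \<Longrightarrow> Q v n x = Q w n x"
    and step: "\<And>v n. orthonormal {..<n} v \<Longrightarrow> (\<And>i. i < n \<Longrightarrow> Q v i (v i)) \<Longrightarrow>
      \<exists>x. norm x = 1 \<and> (\<forall>i<n. ip x (v i) = 0) \<and> Q v n x"
  shows "\<exists>v. orthonormal UNIV v \<and> (\<forall>n. Q v n (v n))"
proof -
  define P where "P v n x \<longleftrightarrow> norm x = 1 \<and> (\<forall>i<n. ip x (v i) = 0) \<and> Q v n x" for v n x
  have on: "orthonormal {i. i < n} v" if "\<And>i. i < n \<Longrightarrow> P v i (v i)" for n v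
    unfolding orthonormal_iff
  proof (intro conjI ballI impI)
    fix i j assume "i \<in> {i. i < n}" "j \<in> {i. i < n}" "i \<noteq> j"
    then show "ip (v i) (v j) = 0"
      using that[of i] that[of j] ip_eq_0_commute[of "v i" "v j"] by (cases "i < j") (auto simp: P_def)
  next
    fix i assume "i \<in> {i. i < n}"
    then show "norm (v i) = 1" using that[of i] by (simp add: P_def)
  qed
  have "\<exists>v. \<forall>n. P v n (v n)"
  proof (rule dependent_wellorder_choice[where P = P])
    fix x :: 'a and v w :: "nat \<Rightarrow> 'a" and n
    assume "\<And>i. i < n \<Longrightarrow> v i = w i"
    then show "P v n x = P w n x" using cong[of n v w x] by (auto simp: P_def)
  next
    fix n and v :: "nat \<Rightarrow> 'a" assume v: "\<And>i. i < n \<Longrightarrow> P v i (v i)"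
    show "\<exists>x. P v n x" unfolding P_def
    proof (rule step)
      show "orthonormal {..<n} v" using on[OF v] by (simp add: lessThan_def)
    qed (use v in \<open>simp add: P_def\<close>)
  qed
  then obtain v where v: "\<forall>n. P v n (v n)" ..
  have "orthonormal UNIV v"
    unfolding orthonormal_def
  proof (intro ballI)
    fix i j :: nat
    have "orthonormal {k. k < Suc (max i j)} v" using v by (intro on) auto
    then show "ip (v i) (v j) = of_bool (i = j)"
      by (simp add: orthonormal_def less_Suc_eq_le)
  qed
  then show ?thesis using v by (auto simp: P_def)
qed

subsection \<open>Orthogonal series\<close>

lemma summable_orthogonal:
  fixes u :: "nat \<Rightarrow> 'a"
  assumes u: "orthogonal_units UNIV u" and C: "\<And>n. (\<Sum>i<n. (norm (c i))\<^sup>2) \<le> C"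
  shows "summable (\<lambda>i. sc (c i) (u i))"
proof -
  have sq: "summable (\<lambda>i. (norm (c i))\<^sup>2)"
    using C by (intro summableI_nonneg_bounded[of _ C]) auto
  have "Cauchy (\<lambda>n. \<Sum>i<n. sc (c i) (u i))"
  proof (rule metric_CauchyI)
    fix e :: real assume e: "0 < e"
    then obtain N where N: "\<And>m n. m \<ge> N \<Longrightarrow> norm (\<Sum>i\<in>{m..<n}. (norm (c i))\<^sup>2) < e\<^sup>2"
      using sq[unfolded summable_Cauchy, rule_format, of "e\<^sup>2"] by auto
    have *: "dist (\<Sum>i<m. sc (c i) (u i)) (\<Sum>i<n. sc (c i) (u i)) < e" if "N \<le> m" "m \<le> n" for m n
    proof -
      have "(\<Sum>i<n. sc (c i) (u i)) = (\<Sum>i<m. sc (c i) (u i)) + (\<Sum>i\<in>{m..<n}. sc (c i) (u i))"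
        using that by (simp add: lessThan_atLeast0 sum.atLeastLessThan_concat)
      then have "(dist (\<Sum>i<m. sc (c i) (u i)) (\<Sum>i<n. sc (c i) (u i)))\<^sup>2 = (norm (\<Sum>i\<in>{m..<n}. sc (c i) (u i)))\<^sup>2"
        by (simp add: dist_norm norm_minus_commute)
      also have "\<dots> \<le> (\<Sum>i\<in>{m..<n}. (norm (c i))\<^sup>2)"
        by (rule norm_sum_orthogonal_units) (use u orthogonal_units_subset in auto)
      also have "\<dots> < e\<^sup>2" using N[OF that(1), of n] by simp
      finally show ?thesis using e by (simp add: power2_less_imp_less)
    qed
    show "\<exists>M. \<forall>m\<ge>M. \<forall>n\<ge>M. dist (\<Sum>i<m. sc (c i) (u i)) (\<Sum>i<n. sc (c i) (u i)) < e"
    proof (intro exI[of _ N] allI impI)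
      fix m n assume "N \<le> m" "N \<le> n"
      then show "dist (\<Sum>i<m. sc (c i) (u i)) (\<Sum>i<n. sc (c i) (u i)) < e"
        using *[of m n] *[of n m] by (cases "m \<le> n") (auto simp: dist_commute)
    qed
  qed
  then have "convergent (\<lambda>n. \<Sum>i<n. sc (c i) (u i))" by (rule Cauchy_convergent)
  then show ?thesis by (simp add: summable_iff_convergent)
qed

lemma norm_suminf_orthogonal:
  fixes u :: "nat \<Rightarrow> 'a"
  assumes u: "orthogonal_units UNIV u" and C: "\<And>n. (\<Sum>i<n. (norm (c i))\<^sup>2) \<le> C"
  shows "(norm (\<Sum>i. sc (c i) (u i)))\<^sup>2 \<le> C"
proof (rule LIMSEQ_le_const2)
  show "(\<lambda>n. (norm (\<Sum>i<n. sc (c i) (u i)))\<^sup>2) \<longlonglongrightarrow> (norm (\<Sum>i. sc (c i) (u i)))\<^sup>2"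
    by (intro tendsto_intros summable_LIMSEQ summable_orthogonal[OF u C])
  have "(norm (\<Sum>i<n. sc (c i) (u i)))\<^sup>2 \<le> C" for n
    using norm_sum_orthogonal_units[OF orthogonal_units_subset[OF u], of "{..<n}" c] C[of n] by simp
  then show "\<exists>N. \<forall>n\<ge>N. (norm (\<Sum>i<n. sc (c i) (u i)))\<^sup>2 \<le> C" by blast
qed

lemma ip_suminf_left: "summable f \<Longrightarrow> (\<lambda>i. ip (f i) y) sums ip (\<Sum>i. f i) y"
  by (rule bounded_linear.sums[OF ip.bounded_linear_left summable_sums])

lemma ip_suminf_right: "summable f \<Longrightarrow> (\<lambda>i. ip y (f i)) sums ip y (\<Sum>i. f i)"
  by (rule bounded_linear.sums[OF ip.bounded_linear_right summable_sums])

end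

subsection \<open>Singular values\<close>

text \<open>The number of predecessors increases strictly along \<open>F\<close>, so it runs through
  \<open>{..<card F}\<close>. This finds the index of a singular vector that belongs to a label
  \<open>(\<mu>, k)\<close>.\<close>

lemma exists_rank_in_finite_set:
  fixes F :: "nat set"
  assumes "finite F" "k < card F"
  shows "\<exists>i\<in>F. card {j \<in> F. j < i} = k"
proof -
  define r where "r i = card {j \<in> F. j < i}" for i
  have less: "r i < r i'" if "i \<in> F" "i < i'" for i i'
    unfolding r_def using assms(1) that by (intro psubset_card_mono) auto
  have "inj_on r F"
    using less by (intro linorder_inj_onI) (auto dest: less_imp_neq)
  moreover have "r ` F \<subseteq> {..<card F}"
  proof
    fix m assume "m \<in> r ` F"
    then obtain i where "i \<in> F" "m = r i" by blast
    then show "m \<in> {..<card F}" unfolding r_def using assms(1) by (auto intro!: psubset_card_mono)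
  qed
  ultimately have "r ` F = {..<card F}"
    by (intro card_subset_eq) (auto simp: card_image)
  then have "k \<in> r ` F" using assms(2) by simp
  then show ?thesis unfolding r_def by blast
qed

context scalar_inner
begin

definition adjoint_pair :: "('a \<Rightarrow> 'a) \<Rightarrow> ('a \<Rightarrow> 'a) \<Rightarrow> bool" where
  "adjoint_pair A T \<longleftrightarrow> (\<forall>x y. ip (A x) y = ip x (T y))"

text \<open>The same choice term as in \<open>cadjoint\<close> and \<open>adjoint\<close>, so that
  both are instances; by \<open>adj_eq\<close> it is determined as soon as some
  \<open>adjoint_pair\<close> exists.\<close>

definition adj :: "('a \<Rightarrow> 'a) \<Rightarrow> 'a \<Rightarrow> 'a" where
  "adj A = (SOME T. \<forall>x y. ip (A x) y = ip x (T y))"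

definition sing :: "('a \<Rightarrow> 'a) \<Rightarrow> nat \<Rightarrow> real" where
  "sing A = nth_largest (\<lambda>(\<mu>, k). sqrt \<mu>)
     {(\<mu>, k::nat). \<exists>B \<subseteq> {x. adj A (A x) = sc (of_real \<mu>) x}. vs.independent B \<and> card B = Suc k}"

lemma ip_eqI_right: "(\<And>z. ip z x = ip z y) \<Longrightarrow> x = y"
  using ip_self_eq_0[of "x - y"] by (simp add: ip.diff_right)

lemma adjoint_pairD: "adjoint_pair A T \<Longrightarrow> ip x (T y) = ip (A x) y"
  by (simp add: adjoint_pair_def)

lemma adjoint_pair_commute: "adjoint_pair A T \<Longrightarrow> ip (T x) y = ip x (A y)"
  using ip_commute[of "T x" y] ip_commute[of x "A y"] by (simp add: adjoint_pairD)

lemma adj_eq: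
  assumes "adjoint_pair A T"
  shows "adj A = T"
proof
  fix y
  have "\<forall>x y. ip (A x) y = ip x (adj A y)"
    unfolding adj_def
    by (rule someI[where P = "\<lambda>T. \<forall>x y. ip (A x) y = ip x (T y)"]) (use assms adjoint_pair_def in auto)
  then show "adj A y = T y" by (intro ip_eqI_right) (simp add: adjoint_pairD[OF assms])
qed

lemma adjoint_pair_linear:
  assumes "adjoint_pair A T"
  shows "T (x + y) = T x + T y" "T (sc c x) = sc c (T x)"
  by (rule ip_eqI_right; simp add: adjoint_pairD[OF assms] ip_add_right ip_sc_right)+

lemma adjoint_pair_bounded_linear:
  assumes T: "adjoint_pair A T" and A: "bounded_linear A"
  shows "bounded_linear T"
proof -
  obtain K where K: "0 \<le> K" "\<And>x. norm (A x) \<le> norm x * K"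
    using bounded_linear.nonneg_bounded[OF A] by blast
  show ?thesis
  proof (rule bounded_linear_intro)
    show "T (x + y) = T x + T y" for x y by (rule adjoint_pair_linear[OF T])
    show "T (r *\<^sub>R x) = r *\<^sub>R T x" for r x
      using adjoint_pair_linear(2)[OF T, of "of_real r" x] by (simp add: sc_of_real)
    show "norm (T y) \<le> norm y * K" for y
    proof (cases "T y = 0")
      case False
      have "(norm (T y))\<^sup>2 = norm (ip (T y) (T y))" by (simp add: ip_self norm_power)
      also have "\<dots> = norm (ip (A (T y)) y)" by (simp add: adjoint_pairD[OF T])
      also have "\<dots> \<le> norm (A (T y)) * norm y" by (rule norm_ip_le)
      also have "\<dots> \<le> norm (T y) * K * norm y" by (intro mult_right_mono K) auto
      finally have "norm (T y) * norm (T y) \<le> norm (T y) * (norm y * K)"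
        by (simp add: power2_eq_square mult_ac)
      then show ?thesis using False by simp
    qed (use K in simp)
  qed
qed

text \<open>The hypothesis on orthogonal complements replaces completeness of the family \<open>v\<close>: it forces
  every eigenvector of \<open>A\<^sup>*A\<close> for an eigenvalue above \<open>(s n)\<^sup>2\<close> into the span of the first
  \<open>n\<close> vectors.\<close>

lemma sing_eq:
  assumes T: "adjoint_pair A T" and A: "bounded_linear A"
    and v: "orthonormal UNIV v" and eig: "\<And>i. T (A (v i)) = sc (of_real ((s i)\<^sup>2)) (v i)"
    and s0: "\<And>i. 0 \<le> s i" and dec: "decseq s"
    and le: "\<And>k x. (\<And>i. i < k \<Longrightarrow> ip x (v i) = 0) \<Longrightarrow> norm (A x) \<le> s k * norm x"
  shows "sing A = s"
proof
  fix n
  define E where "E \<mu> = {x. T (A x) = sc (of_real \<mu>) x}" for \<mu>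
  define I where "I = {(\<mu>, k::nat). \<exists>B \<subseteq> E \<mu>. vs.independent B \<and> card B = Suc k}"
  \<comment> \<open>The \<open>i\<close>-th singular vector is labelled by its eigenvalue and the
    number of earlier vectors with the same eigenvalue, in accordance with the listing by
    multiplicity.\<close>
  define p where "p i = ((s i)\<^sup>2, card {j. j < i \<and> s j = s i})" for i
  interpret TA: bounded_linear "\<lambda>x. T (A x)"
    using bounded_linear_compose[OF adjoint_pair_bounded_linear[OF T A] A] .
  have TAip: "ip (T (A x)) y = ip x (T (A y))" for x y
    by (simp add: adjoint_pairD[OF T] adjoint_pair_commute[OF T])
  have "sing A = nth_largest (\<lambda>(\<mu>, k). sqrt \<mu>) I"
    by (simp add: sing_def I_def E_def adj_eq[OF T])
  moreover have "nth_largest (\<lambda>(\<mu>, k). sqrt \<mu>) I n = (\<lambda>(\<mu>, k). sqrt \<mu>) (p n)"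
  proof (rule nth_largest_enumeration)
    show "inj p"
    proof (rule linorder_injI)
      fix x y :: nat assume xy: "x < y"
      show "p x \<noteq> p y"
      proof
        assume eq: "p x = p y"
        then have "s x = s y" using s0 by (simp add: p_def)
        then have "{j. j < x \<and> s j = s x} \<subset> {j. j < y \<and> s j = s y}" using xy by auto
        then have "card {j. j < x \<and> s j = s x} < card {j. j < y \<and> s j = s y}"
          by (intro psubset_card_mono) auto
        then show False using eq by (simp add: p_def)
      qed
    qed
    show "range p \<subseteq> I"
    proof
      fix q assume "q \<in> range p"
      then obtain i where q: "q = p i" by blast
      define F where "F = insert i {j. j < i \<and> s j = s i}"
      have F: "finite F" "card F = Suc (card {j. j < i \<and> s j = s i})" by (simp_all add: F_def)
      have on: "orthonormal F v" using v orthonormal_subset by blast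
      have "v ` F \<subseteq> E ((s i)\<^sup>2)" using eig by (auto simp: E_def F_def)
      moreover have "card (v ` F) = card F"
        by (rule card_image[OF orthonormal_independent(2)[OF on]])
      ultimately show "q \<in> I"
        using orthonormal_independent(1)[OF on] F by (auto simp: q p_def I_def)
    qed
    show "decseq (\<lambda>n. (\<lambda>(\<mu>, k). sqrt \<mu>) (p n))" using dec s0 by (simp add: p_def)
    fix n q assume q: "q \<in> I" "q \<notin> p ` {..<n}"
    obtain \<mu> k where \<mu>k: "q = (\<mu>, k)" by fastforce
    show "(\<lambda>(\<mu>, k). sqrt \<mu>) q \<le> (\<lambda>(\<mu>, k). sqrt \<mu>) (p n)"
    proof (rule ccontr)
      assume "\<not> ?thesis"
      then have lt: "s n < sqrt \<mu>" using s0 by (simp add: \<mu>k p_def)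
      then have "(s n)\<^sup>2 < (sqrt \<mu>)\<^sup>2" using s0[of n] by (intro power_strict_mono) auto
      moreover have "\<mu> > 0" using lt s0[of n] by (metis less_le_trans not_le order_less_imp_le real_sqrt_le_0_iff)
      ultimately have \<mu>: "(s n)\<^sup>2 < \<mu>" "\<mu> > 0" by simp_all
      define F where "F = {i. i < n \<and> (s i)\<^sup>2 = \<mu>}"
      have F: "finite F" by (simp add: F_def)
      have on: "orthonormal F v" using v orthonormal_subset by blast
      note ou = orthonormal_imp_orthogonal_units[OF on]
      \<comment> \<open>The residual \<open>y\<close> of an eigenvector is orthogonal to all
        \<open>v i\<close> with \<open>i < n\<close>, by projection or by distinctness of
        eigenvalues. So \<open>norm (A y) \<le> s n * norm y\<close>, while the eigenvalue equation
        gives \<open>(norm (A y))\<^sup>2 = \<mu> * (norm y)\<^sup>2\<close> with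
        \<open>\<mu> > (s n)\<^sup>2\<close>; hence \<open>y = 0\<close>.\<close>
      have "E \<mu> \<subseteq> vs.span (v ` F)"
      proof
        fix x assume "x \<in> E \<mu>"
        then have x: "T (A x) = sc (of_real \<mu>) x" by (simp add: E_def)
        define y where "y = x - proj F v x"
        have "T (A (proj F v x)) = (\<Sum>i\<in>F. T (A (sc (ip x (v i)) (v i))))"
          by (simp add: proj_def TA.sum)
        also have "\<dots> = (\<Sum>i\<in>F. sc (of_real \<mu>) (sc (ip x (v i)) (v i)))"
        proof (rule sum.cong)
          fix i assume i: "i \<in> F"
          have "T (A (sc c (v i))) = sc c (T (A (v i)))" for c
            by (rule ip_eqI) (simp add: TAip ip_sc_left)
          then show "T (A (sc (ip x (v i)) (v i))) = sc (of_real \<mu>) (sc (ip x (v i)) (v i))"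
            using i eig[of i] by (simp add: F_def vs.scale_scale mult.commute del: of_real_power)
        qed simp
        finally have TAp: "T (A (proj F v x)) = sc (of_real \<mu>) (proj F v x)"
          by (simp only: proj_def sc.sum_right)
        have TAy: "T (A y) = sc (of_real \<mu>) y"
          unfolding y_def by (simp add: TA.diff x TAp sc.diff_right)
        have "ip y (v i) = 0" if "i < n" for i
        proof (cases "i \<in> F")
          case True
          then show ?thesis unfolding y_def by (intro ip_diff_proj ou F)
        next
          case False
          have "of_real \<mu> * ip y (v i) = ip (T (A y)) (v i)" by (simp add: TAy ip_sc_left)
          also have "\<dots> = of_real ((s i)\<^sup>2) * ip y (v i)"
            by (simp only: TAip eig ip_sc_right cj_of_real)
          finally have "of_real (\<mu> - (s i)\<^sup>2) * ip y (v i) = 0" by (simp add: algebra_simps)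
          moreover have "\<mu> - (s i)\<^sup>2 \<noteq> 0" using False that by (auto simp: F_def)
          ultimately show ?thesis by (metis mult_eq_0_iff of_real_eq_0_iff)
        qed
        then have "norm (A y) \<le> s n * norm y" by (rule le)
        then have "(norm (A y))\<^sup>2 \<le> (s n * norm y)\<^sup>2" by (intro power_mono) auto
        moreover have "(norm (A y))\<^sup>2 = \<mu> * (norm y)\<^sup>2"
        proof -
          have "of_real ((norm (A y))\<^sup>2) = ip y (T (A y))" by (simp add: adjoint_pairD[OF T] ip_self)
          also have "\<dots> = of_real (\<mu> * (norm y)\<^sup>2)" by (simp add: TAy ip_sc_right cj_of_real ip_self)
          finally show ?thesis by (simp only: of_real_eq_iff)
        qed
        ultimately have "(\<mu> - (s n)\<^sup>2) * (norm y)\<^sup>2 \<le> 0" by (simp add: power_mult_distrib algebra_simps)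
        then have "(norm y)\<^sup>2 \<le> 0" using \<mu> by (simp add: mult_le_0_iff)
        then have "x = proj F v x" by (simp add: y_def)
        then show "x \<in> vs.span (v ` F)" using proj_in_span[OF F, of v x] by simp
      qed
      moreover obtain B where "B \<subseteq> E \<mu>" "vs.independent B" "card B = Suc k"
        using q(1) by (auto simp: \<mu>k I_def)
      ultimately have "Suc k \<le> card (v ` F)"
        using vs.independent_span_bound[of "v ` F" B] F by auto
      then have "k < card F" using card_image_le[OF F, of v] by simp
      \<comment> \<open>The dimension bound puts the label \<open>(\<mu>, k)\<close> on some index
        \<open>i < n\<close>, against the choice of \<open>q\<close>.\<close>
      then obtain i where i: "i \<in> F" "card {j \<in> F. j < i} = k"
        using exists_rank_in_finite_set[OF F] by blast
      have "{j \<in> F. j < i} = {j. j < i \<and> s j = s i}"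
        using i(1) s0 by (auto simp: F_def)
      then have "p i = q" using i by (simp add: \<mu>k p_def F_def)
      then show False using q(2) i(1) by (auto simp: F_def)
    qed
  qed
  ultimately show "sing A n = s n" using s0 by (simp add: p_def)
qed

text \<open>The maximum of \<open>norm (A x)\<close> on the unit sphere of the orthogonal complement is attained,
  because a maximising sequence satisfies \<open>A\<^sup>*A x - \<sigma>\<^sup>2 x \<longlonglongrightarrow> 0\<close>.\<close>

lemma next_singular_vector:
  fixes v :: "nat \<Rightarrow> 'a"
  assumes T: "adjoint_pair A T" and A: "bounded_linear A" and cpt: "compact (closure (A ` cball 0 1))"
    and inf: "\<nexists>B. finite B \<and> vs.span B = UNIV"
    and v: "orthonormal {..<n} v"
    and eig: "\<And>i. i < n \<Longrightarrow> T (A (v i)) = sc (of_real ((norm (A (v i)))\<^sup>2)) (v i)"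
  shows "\<exists>x. norm x = 1 \<and> (\<forall>i<n. ip x (v i) = 0) \<and> T (A x) = sc (of_real ((norm (A x))\<^sup>2)) x \<and>
    (\<forall>y. (\<forall>i<n. ip y (v i) = 0) \<longrightarrow> norm (A y) \<le> norm (A x) * norm y)"
proof -
  define X where "X = {x. norm x = 1 \<and> (\<forall>i<n. ip x (v i) = 0)}"
  obtain x0 where x0: "x0 \<in> X" using exists_unit_orthogonal(1)[OF v _ inf] by (auto simp: X_def)
  obtain K where K: "\<And>x. norm (A x) \<le> norm x * K"
    using bounded_linear.nonneg_bounded[OF A] by blast
  have bdd: "bdd_above ((\<lambda>x. norm (A x)) ` X)"
    using K by (intro bdd_aboveI[of _ K]) (auto simp: X_def, metis mult_1)
  define \<sigma> where "\<sigma> = (SUP x\<in>X. norm (A x))"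
  have up: "norm (A x) \<le> \<sigma>" if "x \<in> X" for x
    unfolding \<sigma>_def using bdd that by (rule cSUP_upper2) simp
  interpret A: bounded_linear A by (rule A)
  interpret TA: bounded_linear "\<lambda>x. T (A x)"
    using bounded_linear_compose[OF adjoint_pair_bounded_linear[OF T A] A] .
  have up': "norm (A y) \<le> \<sigma> * norm y" if y: "\<forall>i<n. ip y (v i) = 0" for y
  proof (cases "y = 0")
    case False
    define z where "z = (1 / norm y) *\<^sub>R y"
    have "z \<in> X" using False y by (simp add: X_def z_def ip_scaleR_left)
    then have "norm (A z) \<le> \<sigma>" by (rule up)
    then show ?thesis using False by (simp add: z_def A.scaleR field_simps)
  qed (simp add: A.zero)
  have \<sigma>0: "0 \<le> \<sigma>" using up[OF x0] norm_ge_zero[of "A x0"] by linarith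
  have TAip: "ip (T (A x)) y = ip x (T (A y))" for x y
    by (simp add: adjoint_pairD[OF T] adjoint_pair_commute[OF T])
  \<comment> \<open>The complement of eigenvectors is invariant under \<open>T\<close> after
    \<open>A\<close>, so the bound by \<open>\<sigma>\<close> applies to \<open>T (A x)\<close> as
    well.\<close>
  have TAperp: "\<forall>i<n. ip (T (A x)) (v i) = 0" if "x \<in> X" for x
    using that by (simp add: TAip eig ip_sc_right X_def)
  have "\<exists>x\<in>X. norm (A x) = \<sigma> \<and> T (A x) = \<sigma>\<^sup>2 *\<^sub>R x"
  proof (cases "\<sigma> = 0")
    case True
    then have "A x0 = 0" using up[OF x0] by simp
    then show ?thesis using x0 True TA.zero A.zero by (intro bexI[of _ x0]) auto
  next
    case False
    then have \<sigma>: "\<sigma> > 0" using \<sigma>0 by simp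
    have "\<exists>x\<in>X. \<sigma> - 1 / Suc m < norm (A x)" for m :: nat
    proof -
      have "\<sigma> - 1 / Suc m < \<sigma>" by simp
      then show ?thesis unfolding \<sigma>_def using less_cSUP_iff[OF _ bdd] x0 by blast
    qed
    then obtain x where x: "\<And>m. x m \<in> X" "\<And>m. \<sigma> - 1 / Suc m < norm (A (x m))" by metis
    have "(\<lambda>m. \<sigma> - 1 / Suc m) \<longlonglongrightarrow> \<sigma> - 0"
      by (intro tendsto_intros LIMSEQ_Suc lim_1_over_n)
    then have low: "(\<lambda>m. \<sigma> - 1 / Suc m) \<longlonglongrightarrow> \<sigma>" by simp
    have lim\<sigma>: "(\<lambda>m. norm (A (x m))) \<longlonglongrightarrow> \<sigma>"
    proof (rule tendsto_sandwich[OF _ _ low tendsto_const])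
      show "\<forall>\<^sub>F m in sequentially. norm (A (x m)) \<le> \<sigma>" by (intro always_eventually allI up x(1))
      show "\<forall>\<^sub>F m in sequentially. \<sigma> - 1 / Suc m \<le> norm (A (x m))"
        by (intro always_eventually allI less_imp_le x(2))
    qed
    have norm_diff: "(norm (a - c *\<^sub>R z))\<^sup>2 = (norm a)\<^sup>2 - 2 * c * inner a z + c\<^sup>2 * (norm z)\<^sup>2"
      for a z :: 'a and c
      unfolding power2_norm_eq_inner
      by (simp add: inner_diff_left inner_diff_right inner_commute[of z a] power2_eq_square algebra_simps)
    \<comment> \<open>Expanding the square and using
      \<open>norm (T (A z)) \<le> \<sigma>\<^sup>2\<close> gives a bound that tends to 0 as
      \<open>norm (A z)\<close> approaches \<open>\<sigma>\<close>.\<close>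
    have defect: "(norm (T (A z) - \<sigma>\<^sup>2 *\<^sub>R z))\<^sup>2 \<le> 2 * \<sigma>^4 - 2 * \<sigma>\<^sup>2 * (norm (A z))\<^sup>2" if z: "z \<in> X" for z
    proof -
      have i: "inner (T (A z)) z = (norm (A z))\<^sup>2"
      proof -
        have "inner (T (A z)) z = re (ip (A z) (A z))" by (simp add: re_ip[symmetric] adjoint_pair_commute[OF T])
        then show ?thesis by (simp add: ip_self del: of_real_power add: re_of_real)
      qed
      have "norm (T (A z)) \<le> \<sigma>\<^sup>2"
      proof (cases "T (A z) = 0")
        case False
        have "(norm (T (A z)))\<^sup>2 = norm (ip (T (A z)) (T (A z)))" by (simp add: ip_self norm_power)
        also have "\<dots> = norm (ip (A (T (A z))) (A z))" by (simp add: adjoint_pairD[OF T])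
        also have "\<dots> \<le> norm (A (T (A z))) * norm (A z)" by (rule norm_ip_le)
        also have "\<dots> \<le> (\<sigma> * norm (T (A z))) * \<sigma>"
          using up'[OF TAperp[OF z]] up[OF z] \<sigma>0 by (intro mult_mono) auto
        finally have "norm (T (A z)) * norm (T (A z)) \<le> norm (T (A z)) * \<sigma>\<^sup>2"
          by (simp add: power2_eq_square mult_ac)
        then show ?thesis using False by simp
      qed simp
      then have "(norm (T (A z)))\<^sup>2 \<le> (\<sigma>\<^sup>2)\<^sup>2" by (intro power_mono) auto
      moreover have "norm z = 1" using z by (simp add: X_def)
      then have "(norm (T (A z) - \<sigma>\<^sup>2 *\<^sub>R z))\<^sup>2 = (norm (T (A z)))\<^sup>2 - 2 * \<sigma>\<^sup>2 * (norm (A z))\<^sup>2 + \<sigma>^4"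
        unfolding norm_diff by (simp add: i power4_eq_xxxx power2_eq_square)
      ultimately show ?thesis by simp
    qed
    have "(\<lambda>m. 2 * \<sigma>^4 - 2 * \<sigma>\<^sup>2 * (norm (A (x m)))\<^sup>2) \<longlonglongrightarrow> 2 * \<sigma>^4 - 2 * \<sigma>\<^sup>2 * \<sigma>\<^sup>2"
      by (intro tendsto_intros lim\<sigma>)
    then have lim0: "(\<lambda>m. 2 * \<sigma>^4 - 2 * \<sigma>\<^sup>2 * (norm (A (x m)))\<^sup>2) \<longlonglongrightarrow> 0"
      by (simp add: power2_eq_square power4_eq_xxxx)
    have "(\<lambda>m. (norm (T (A (x m)) - \<sigma>\<^sup>2 *\<^sub>R x m))\<^sup>2) \<longlonglongrightarrow> 0"
      by (rule Lim_null_comparison[OF always_eventually lim0]) (use defect x(1) in auto)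
    then have "(\<lambda>m. (norm (T (A (x m)) - \<sigma>\<^sup>2 *\<^sub>R x m))) \<longlonglongrightarrow> 0"
      using tendsto_real_sqrt[of "\<lambda>m. (norm (T (A (x m)) - \<sigma>\<^sup>2 *\<^sub>R x m))\<^sup>2" 0] by simp
    then have diff0: "(\<lambda>m. T (A (x m)) - \<sigma>\<^sup>2 *\<^sub>R x m) \<longlonglongrightarrow> 0" by (simp add: tendsto_norm_zero_iff)
    have "A (x m) \<in> closure (A ` cball 0 1)" for m
      using x(1)[of m] by (intro closure_subset[THEN subsetD] imageI) (simp add: X_def)
    then obtain y r where r: "strict_mono (r :: nat \<Rightarrow> nat)" "((\<lambda>m. A (x m)) \<circ> r) \<longlonglongrightarrow> y"
      using cpt[unfolded compact_def, rule_format, of "\<lambda>m. A (x m)"] by blast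
    have "(\<lambda>m. T (((\<lambda>m. A (x m)) \<circ> r) m)) \<longlonglongrightarrow> T y"
      by (rule bounded_linear.tendsto[OF adjoint_pair_bounded_linear[OF T A] r(2)])
    then have 1: "(\<lambda>m. T (A (x (r m)))) \<longlonglongrightarrow> T y" by simp
    have 2: "(\<lambda>m. T (A (x (r m))) - \<sigma>\<^sup>2 *\<^sub>R x (r m)) \<longlonglongrightarrow> 0"
      using LIMSEQ_subseq_LIMSEQ[OF diff0 r(1)] by (simp add: o_def)
    \<comment> \<open>Compactness yields convergence of the images \<open>A (x (r m))\<close>; since
      \<open>\<sigma> > 0\<close>, the vectors themselves are recovered from
      \<open>T (A (x (r m)))\<close> and the vanishing defect.\<close>
    have "(\<lambda>m. (1 / \<sigma>\<^sup>2) *\<^sub>R (T (A (x (r m))) - (T (A (x (r m))) - \<sigma>\<^sup>2 *\<^sub>R x (r m)))) \<longlonglongrightarrow> (1 / \<sigma>\<^sup>2) *\<^sub>R (T y - 0)"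
      by (intro tendsto_intros 1 2)
    moreover define z where "z = (1 / \<sigma>\<^sup>2) *\<^sub>R T y"
    ultimately have limx: "(\<lambda>m. x (r m)) \<longlonglongrightarrow> z" using \<sigma> by simp
    have "z \<in> X"
    proof -
      have "(\<lambda>m. norm (x (r m))) \<longlonglongrightarrow> norm z" by (intro tendsto_intros limx)
      then have "norm z = 1" using x(1) by (simp add: X_def LIMSEQ_const_iff)
      moreover have "ip z (v i) = 0" if "i < n" for i
      proof -
        have "(\<lambda>m. ip (x (r m)) (v i)) \<longlonglongrightarrow> ip z (v i)" by (intro ip.tendsto limx tendsto_const)
        then show ?thesis using x(1) that by (simp add: X_def LIMSEQ_const_iff)
      qed
      ultimately show ?thesis by (simp add: X_def)
    qed
    moreover have "norm (A z) = \<sigma>"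
    proof -
      have "(\<lambda>m. norm (A (x (r m)))) \<longlonglongrightarrow> norm (A z)" by (intro tendsto_norm A.tendsto limx)
      moreover have "(\<lambda>m. norm (A (x (r m)))) \<longlonglongrightarrow> \<sigma>"
        using LIMSEQ_subseq_LIMSEQ[OF lim\<sigma> r(1)] by (simp add: o_def)
      ultimately show ?thesis by (rule LIMSEQ_unique)
    qed
    moreover have "T (A z) = \<sigma>\<^sup>2 *\<^sub>R z"
    proof -
      have "(\<lambda>m. T (A (x (r m))) - \<sigma>\<^sup>2 *\<^sub>R x (r m)) \<longlonglongrightarrow> T (A z) - \<sigma>\<^sup>2 *\<^sub>R z"
        by (intro tendsto_diff TA.tendsto tendsto_scaleR tendsto_const limx)
      then have "T (A z) - \<sigma>\<^sup>2 *\<^sub>R z = 0" using 2 by (rule LIMSEQ_unique)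
      then show ?thesis by simp
    qed
    ultimately show ?thesis by blast
  qed
  then obtain x where x: "x \<in> X" "norm (A x) = \<sigma>" "T (A x) = \<sigma>\<^sup>2 *\<^sub>R x" by blast
  then show ?thesis
    using up' by (intro exI[of _ x]) (auto simp: X_def sc_of_real simp flip: of_real_power)
qed

text \<open>Successive maximisers satisfy the hypotheses of \<open>sing_eq\<close>, which identifies
  their values with \<open>sing A\<close>. In infinite dimension the choice never stops: for finite
  rank the values end in zeros, for infinite rank they all stay positive.\<close>

lemma singular_vectors:
  assumes T: "adjoint_pair A T" and A: "bounded_linear A" and cpt: "compact (closure (A ` cball 0 1))"
    and inf: "\<nexists>B. finite B \<and> vs.span B = UNIV"
  shows "\<exists>v. orthonormal UNIV v \<and> (\<forall>i. T (A (v i)) = sc (of_real ((sing A i)\<^sup>2)) (v i)) \<and>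
    (\<forall>k x. (\<forall>i<k. ip x (v i) = 0) \<longrightarrow> norm (A x) \<le> sing A k * norm x) \<and>
    (\<forall>i. 0 \<le> sing A i) \<and> decseq (sing A)"
proof -
  define Q where "Q v n x \<longleftrightarrow> T (A x) = sc (of_real ((norm (A x))\<^sup>2)) x \<and>
    (\<forall>y. (\<forall>i<n. ip y (v i) = 0) \<longrightarrow> norm (A y) \<le> norm (A x) * norm y)" for v :: "nat \<Rightarrow> 'a" and n x
  have "\<exists>v. orthonormal UNIV v \<and> (\<forall>n. Q v n (v n))"
  proof (rule greedy_orthonormal)
    fix v n assume v: "orthonormal {..<n} v" and Q: "\<And>i. i < n \<Longrightarrow> Q v i (v i)"
    have "T (A (v i)) = sc (of_real ((norm (A (v i)))\<^sup>2)) (v i)" if "i < n" for i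
      using Q[OF that] by (simp add: Q_def)
    from next_singular_vector[OF T A cpt inf v this]
    show "\<exists>x. norm x = 1 \<and> (\<forall>i<n. ip x (v i) = 0) \<and> Q v n x" unfolding Q_def by blast
  qed (auto simp: Q_def)
  then obtain v where v: "orthonormal UNIV v" and Q: "\<And>n. Q v n (v n)" by blast
  define s where "s i = norm (A (v i))" for i
  have le: "norm (A x) \<le> s k * norm x" if "\<And>i. i < k \<Longrightarrow> ip x (v i) = 0" for k x
    using Q[of k] that by (simp add: Q_def s_def)
  have eig: "T (A (v i)) = sc (of_real ((s i)\<^sup>2)) (v i)" for i
    using Q[of i] by (simp add: Q_def s_def)
  have s0: "0 \<le> s i" for i by (simp add: s_def)
  have dec: "decseq s"
  proof (rule decseq_SucI)
    fix k
    have "norm (A (v (Suc k))) \<le> s k * norm (v (Suc k))"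
      using v by (intro le) (simp add: orthonormal_def)
    then show "s (Suc k) \<le> s k" using orthonormal_norm[OF v] by (simp add: s_def)
  qed
  have "sing A = s" by (rule sing_eq[OF T A v eig s0 dec le])
  then show ?thesis using v eig le s0 dec by blast
qed

end

section \<open>Bases, adjoints and the majorisation of diagonals\<close>

context scalar_inner
begin

definition basis :: "(nat \<Rightarrow> 'a) \<Rightarrow> bool" where
  "basis e \<longleftrightarrow> orthonormal UNIV e \<and> closure (vs.span (range e)) = UNIV"

lemma basis_exists:
  assumes sep: "separable_space (euclidean :: 'a topology)"
    and inf: "\<nexists>B. finite B \<and> vs.span B = UNIV"
  shows "\<exists>e. basis e"
proof -
  obtain C :: "'a set" where C: "countable C" "closure C = UNIV"
    using sep by (auto simp: separable_space_def)
  then have "C \<noteq> {}" by auto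
  define q where "q = from_nat_into C"
  have q: "range q = C" unfolding q_def using C \<open>C \<noteq> {}\<close> by simp
  have "\<exists>v. orthonormal UNIV v \<and> (\<forall>n. q n \<in> vs.span (insert (v n) (v ` {..<n})))"
  proof (rule greedy_orthonormal)
    fix v w :: "nat \<Rightarrow> 'a" and n x assume "\<And>i. i < n \<Longrightarrow> v i = w i"
    then have "v ` {..<n} = w ` {..<n}" by (intro image_cong) auto
    then show "(q n \<in> vs.span (insert x (v ` {..<n}))) = (q n \<in> vs.span (insert x (w ` {..<n})))" by simp
  next
    fix v :: "nat \<Rightarrow> 'a" and n assume v: "orthonormal {..<n} v"
    show "\<exists>x. norm x = 1 \<and> (\<forall>i<n. ip x (v i) = 0) \<and> q n \<in> vs.span (insert x (v ` {..<n}))"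
      using exists_unit_orthogonal(2)[OF v _ inf, of "q n"] by auto
  qed
  then obtain v where v: "orthonormal UNIV v" "\<And>n. q n \<in> vs.span (insert (v n) (v ` {..<n}))" by blast
  have "q n \<in> vs.span (range v)" for n
    using v(2)[of n] vs.span_mono[of "insert (v n) (v ` {..<n})" "range v"] by auto
  then have "C \<subseteq> vs.span (range v)" using q by auto
  then have "closure (vs.span (range v)) = UNIV" using closure_mono C(2) by blast
  then show ?thesis using v(1) by (auto simp: basis_def)
qed

text \<open>\<open>I\<close> is an initial segment, so the greedy choice can follow \<open>u\<close>
  on \<open>I\<close> and continue freely afterwards.\<close>

lemma extend_orthonormal:
  assumes inf: "\<nexists>B. finite B \<and> vs.span B = UNIV"
    and u: "orthonormal I u" and I: "\<forall>i\<in>I. {..i} \<subseteq> I"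
  shows "\<exists>v. orthonormal UNIV v \<and> (\<forall>i::nat. i \<in> I \<longrightarrow> v i = u i)"
proof (rule greedy_orthonormal)
  fix v n assume v: "orthonormal {..<n} v" and Q: "\<And>i. i < n \<Longrightarrow> i \<in> I \<longrightarrow> v i = u i"
  show "\<exists>x. norm x = 1 \<and> (\<forall>i<n. ip x (v i) = 0) \<and> (n \<in> I \<longrightarrow> x = u n)"
  proof (cases "n \<in> I")
    case True
    have "ip (u n) (v i) = 0" if "i < n" for i
    proof -
      have "{..n} \<subseteq> I" using I True by blast
      then have "i \<in> I" using that by (simp add: subset_iff)
      then show ?thesis using Q[OF that] u True that by (simp add: orthonormal_def)
    qed
    then show ?thesis using orthonormal_norm[OF u True] by blast
  next
    case False
    then show ?thesis using exists_unit_orthogonal(1)[OF v _ inf] by auto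
  qed
qed auto

text \<open>Riesz representation in coordinates: the value of the adjoint at \<open>y\<close> must
  have the coordinates \<open>ip y (A (e j))\<close>. The identity then holds on the basis, hence on
  a closed subspace containing it.\<close>

lemma adjoint_exists:
  assumes A: "bounded_linear A" and hom: "\<And>c x. A (sc c x) = sc c (A x)" and e: "basis e"
  shows "\<exists>T. adjoint_pair A T"
proof -
  interpret A: bounded_linear A by (rule A)
  have on: "orthonormal UNIV e" using e by (simp add: basis_def)
  note ou = orthonormal_imp_orthogonal_units[OF on]
  obtain K where K: "0 \<le> K" "\<And>x. norm (A x) \<le> norm x * K"
    using A.nonneg_bounded by blast
  have "\<exists>z. \<forall>x. ip (A x) y = ip x z" for y
  proof -
    define c where "c j = ip y (A (e j))" for j
    have bnd: "(\<Sum>j<n. (norm (c j))\<^sup>2) \<le> (norm y * K)\<^sup>2" for n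
    proof -
      \<comment> \<open>Testing \<open>A\<close> on the truncated candidate \<open>z\<close>, whose
        squared norm is at most \<open>t\<close>, gives in effect
        \<open>t \<le> norm y * K * sqrt t\<close>.\<close>
      define t where "t = (\<Sum>j<n. (norm (c j))\<^sup>2)"
      define z where "z = (\<Sum>j<n. sc (c j) (e j))"
      have "ip y (A z) = (\<Sum>j<n. cj (c j) * c j)"
        by (simp add: z_def A.sum hom ip.sum_right ip_sc_right c_def)
      also have "\<dots> = of_real t" by (simp add: t_def mult.commute[of "cj _"] mult_cj)
      finally have "norm (ip y (A z)) = \<bar>t\<bar>" by simp
      then have "t \<le> norm (ip y (A z))" by simp
      also have "\<dots> \<le> norm y * norm (A z)" by (rule norm_ip_le)
      also have "\<dots> \<le> norm y * (norm z * K)" by (intro mult_left_mono K) auto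
      finally have 1: "t \<le> (norm y * K) * norm z" by (simp add: mult_ac)
      have 2: "(norm z)\<^sup>2 \<le> t"
        unfolding z_def t_def by (intro norm_sum_orthogonal_units orthogonal_units_subset[OF ou]) auto
      have t0: "0 \<le> t" by (simp add: t_def sum_nonneg)
      have "t * t \<le> ((norm y * K) * norm z) * ((norm y * K) * norm z)" using 1 t0 by (intro mult_mono) auto
      also have "\<dots> = (norm y * K)\<^sup>2 * (norm z)\<^sup>2" by (simp add: power2_eq_square mult_ac)
      also have "\<dots> \<le> (norm y * K)\<^sup>2 * t" using 2 by (intro mult_left_mono) auto
      finally have "t * t \<le> (norm y * K)\<^sup>2 * t" .
      then have "t \<le> (norm y * K)\<^sup>2" using t0 by (cases "t = 0") auto
      then show ?thesis by (simp add: t_def)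
    qed
    define z where "z = (\<Sum>j. sc (c j) (e j))"
    have ze: "ip z (e j) = c j" for j
    proof -
      have "(\<lambda>i. ip (sc (c i) (e i)) (e j)) sums ip z (e j)"
        unfolding z_def by (intro ip_suminf_left summable_orthogonal[OF ou bnd])
      moreover have "(\<lambda>i. ip (sc (c i) (e i)) (e j)) = (\<lambda>i. if i = j then c i else 0)"
        using on by (auto simp: ip_sc_left orthonormal_def)
      ultimately show ?thesis using sums_unique2 sums_single[of j c] by metis
    qed
    define S where "S = {x. ip (A x) y = ip x z}"
    have "closed S"
      unfolding S_def
      by (intro closed_Collect_eq continuous_intros ip.continuous_on A.continuous_on)
    moreover have "vs.span (range e) \<subseteq> S"
    proof (rule vs.span_minimal)
      show "range e \<subseteq> S"
      proof
        fix x assume "x \<in> range e"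
        then obtain j where j: "x = e j" by blast
        show "x \<in> S"
          using ip_commute[of "A (e j)" y] ip_commute[of "e j" z] ze[of j] by (simp add: S_def j c_def)
      qed
      show "vs.subspace S"
        by (rule vs.subspaceI)
          (auto simp: S_def ip_add_left ip_sc_left hom A.add A.zero ip.zero_left)
    qed
    ultimately have "closure (vs.span (range e)) \<subseteq> S" by (rule closure_minimal[rotated])
    then have "S = UNIV" using e by (auto simp: basis_def)
    then show ?thesis by (intro exI[of _ z]) (auto simp: S_def)
  qed
  then show ?thesis unfolding adjoint_pair_def by metis
qed

text \<open>Splitting off the first \<open>card J\<close> singular vectors on both sides keeps the argument finite;
  the two families of coefficients are then decoupled by the inequality of arithmetic and geometric means.\<close>

lemma diagonal_sum_le:
  assumes T: "adjoint_pair A T" and A: "bounded_linear A" and hom: "\<And>c x. A (sc c x) = sc c (A x)"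
    and v: "orthonormal UNIV v" and eig: "\<And>i. T (A (v i)) = sc (of_real ((s i)\<^sup>2)) (v i)"
    and s0: "\<And>i. 0 \<le> s i" and dec: "decseq s"
    and le: "\<And>k x. (\<And>i. i < k \<Longrightarrow> ip x (v i) = 0) \<Longrightarrow> norm (A x) \<le> s k * norm x"
    and J: "finite J" and e: "orthonormal J e"
  shows "(\<Sum>j\<in>J. norm (ip (A (e j)) (e j))) \<le> (\<Sum>i<card J. s i)"
proof -
  interpret A: bounded_linear A by (rule A)
  define k where "k = card J"
  \<comment> \<open>For \<open>s i = 0\<close> the division yields \<open>u i = 0\<close>, which
    \<open>orthogonal_units\<close> permits; \<open>A (v i) = s i *\<^sub>R u i\<close> still holds
    because \<open>A (v i)\<close> vanishes.\<close>
  define u where "u i = (1 / s i) *\<^sub>R A (v i)" for i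
  have AA: "ip (A x) (A (v i)) = of_real ((s i)\<^sup>2) * ip x (v i)" for x i
    using adjoint_pairD[OF T, of x "A (v i)"] by (simp only: eig ip_sc_right cj_of_real)
  have nAv: "norm (A (v i)) = s i" for i
  proof -
    have "of_real ((norm (A (v i)))\<^sup>2) = (of_real ((s i)\<^sup>2) :: 'f)"
      using AA[of "v i" i] v by (simp only: ip_self) (simp add: orthonormal_norm)
    then have "(norm (A (v i)))\<^sup>2 = (s i)\<^sup>2" by (simp only: of_real_eq_iff)
    then show ?thesis using s0[of i] by simp
  qed
  have Av: "A (v i) = s i *\<^sub>R u i" for i
    using nAv[of i] by (cases "s i = 0") (auto simp: u_def)
  have ouv: "orthogonal_units {..<k} v"
    using orthonormal_imp_orthogonal_units[OF v] orthogonal_units_subset by blast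
  have ouu: "orthogonal_units {..<k} u"
    unfolding orthogonal_units_def
  proof (intro conjI ballI impI)
    fix i j :: nat assume "i \<noteq> j"
    then show "ip (u i) (u j) = 0"
      using AA[of "v i" j] v by (simp add: u_def ip_scaleR_left ip_scaleR_right orthonormal_def)
  next
    fix i :: nat show "u i = 0 \<or> norm (u i) = 1"
      using nAv[of i] s0[of i] by (cases "s i = 0") (auto simp: u_def)
  qed
  have Je: "\<And>j. j \<in> J \<Longrightarrow> norm (e j) = 1" using orthonormal_norm[OF e] by blast
  define a where "a i j = (norm (ip (e j) (v i)))\<^sup>2" for i j
  define b where "b i j = (norm (ip (e j) (u i)))\<^sup>2" for i j
  have ab: "(\<Sum>j\<in>J. (norm (ip (e j) x))\<^sup>2) \<le> 1" if "norm x \<le> 1" for x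
  proof -
    have "norm (ip (e j) x) = norm (ip x (e j))" for j using ip_commute[of "e j" x] by simp
    then have "(\<Sum>j\<in>J. (norm (ip (e j) x))\<^sup>2) \<le> (norm x)\<^sup>2"
      using bessel[OF orthonormal_imp_orthogonal_units[OF e] J, of x] by simp
    also have "\<dots> \<le> 1" using that by (simp add: power_le_one)
    finally show ?thesis .
  qed
  have a1: "(\<Sum>j\<in>J. a i j) \<le> 1" for i
    unfolding a_def using orthonormal_norm[OF v, of i] by (intro ab) simp
  have b1: "(\<Sum>j\<in>J. b i j) \<le> 1" for i
    unfolding b_def using nAv[of i] s0[of i] by (intro ab) (cases "s i = 0", auto simp: u_def)
  have main: "norm (ip (A (e j)) (e j)) \<le> s k + (\<Sum>i<k. (s i - s k) * ((a i j + b i j) / 2))" if j: "j \<in> J" for j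
  proof -
    define y where "y = e j - proj {..<k} v (e j)"
    define z where "z = e j - proj {..<k} u (e j)"
    have yv: "ip y (v i) = 0" if "i < k" for i
      unfolding y_def using that by (intro ip_diff_proj[OF ouv]) auto
    have Ay: "norm (A y) \<le> s k * norm y" using yv by (intro le)
    \<comment> \<open>\<open>A y\<close> is orthogonal to the first \<open>k\<close> left vectors,
      so on the right \<open>e j\<close> may be replaced by its residual \<open>z\<close>; this
      brings in the norms of both residuals.\<close>
    have "ip (A y) (u i) = 0" if "i < k" for i
      using AA[of y i] yv[OF that] by (simp add: u_def ip_scaleR_right)
    then have "ip (A y) (proj {..<k} u (e j)) = 0" by (simp add: proj_def ip.sum_right ip_sc_right)
    then have Aye: "ip (A y) (e j) = ip (A y) z" by (simp add: z_def ip.diff_right)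
    have "A (e j) = A (proj {..<k} v (e j)) + A y" by (simp add: y_def A.diff)
    then have "ip (A (e j)) (e j) = ip (A (proj {..<k} v (e j))) (e j) + ip (A y) z"
      by (simp add: ip_add_left Aye)
    also have "ip (A (proj {..<k} v (e j))) (e j) = (\<Sum>i<k. ip (e j) (v i) * (of_real (s i) * ip (u i) (e j)))"
      by (simp add: proj_def A.sum hom Av ip.sum_left ip_sc_left ip_scaleR_left)
    finally have "norm (ip (A (e j)) (e j)) \<le>
        norm (\<Sum>i<k. ip (e j) (v i) * (of_real (s i) * ip (u i) (e j))) + norm (ip (A y) z)"
      by (simp add: norm_triangle_ineq)
    also have "norm (\<Sum>i<k. ip (e j) (v i) * (of_real (s i) * ip (u i) (e j)))
        \<le> (\<Sum>i<k. s i * ((a i j + b i j) / 2))"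
    proof (rule sum_norm_le)
      fix i assume "i \<in> {..<k}"
      have n: "norm (ip (u i) (e j)) = norm (ip (e j) (u i))" using ip_commute[of "u i" "e j"] by simp
      have "norm (ip (e j) (v i)) * norm (ip (e j) (u i)) \<le> (a i j + b i j) / 2"
        using sum_squares_bound[of "norm (ip (e j) (v i))" "norm (ip (e j) (u i))"]
        by (simp add: a_def b_def)
      then have "s i * (norm (ip (e j) (v i)) * norm (ip (e j) (u i))) \<le> s i * ((a i j + b i j) / 2)"
        using s0 by (rule mult_left_mono)
      then show "norm (ip (e j) (v i) * (of_real (s i) * ip (u i) (e j))) \<le> s i * ((a i j + b i j) / 2)"
        using s0[of i] by (simp add: norm_mult n mult_ac)
    qed
    also have "norm (ip (A y) z) \<le> s k * (1 - (\<Sum>i<k. (a i j + b i j) / 2))"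
    proof -
      have ny: "(norm y)\<^sup>2 = 1 - (\<Sum>i<k. a i j)"
        unfolding y_def a_def using norm_diff_proj[OF ouv, of "e j"] Je[OF j] by simp
      have nz: "(norm z)\<^sup>2 = 1 - (\<Sum>i<k. b i j)"
        unfolding z_def b_def using norm_diff_proj[OF ouu, of "e j"] Je[OF j] by simp
      have "norm (ip (A y) z) \<le> norm (A y) * norm z" by (rule norm_ip_le)
      also have "\<dots> \<le> (s k * norm y) * norm z" by (intro mult_right_mono Ay) auto
      also have "\<dots> = s k * (norm y * norm z)" by simp
      also have "\<dots> \<le> s k * (((norm y)\<^sup>2 + (norm z)\<^sup>2) / 2)"
        using sum_squares_bound[of "norm y" "norm z"] s0[of k] by (intro mult_left_mono) auto
      also have "\<dots> = s k * (1 - (\<Sum>i<k. (a i j + b i j) / 2))"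
        unfolding ny nz by (simp add: sum.distrib sum_divide_distrib[symmetric] field_simps)
      finally show ?thesis .
    qed
    finally show ?thesis
      by (simp add: right_diff_distrib left_diff_distrib diff_divide_distrib sum_subtractf sum_distrib_left)
  qed
  \<comment> \<open>Over all of \<open>J\<close> the level terms give \<open>k * s k\<close>. By
    Bessel's inequality each \<open>i < k\<close> has total weight at most 1, so the rest is at most
    the sum of \<open>s i - s k\<close>.\<close>
  have "(\<Sum>j\<in>J. norm (ip (A (e j)) (e j))) \<le> (\<Sum>j\<in>J. s k + (\<Sum>i<k. (s i - s k) * ((a i j + b i j) / 2)))"
    by (rule sum_mono) (rule main)
  also have "\<dots> = k * s k + (\<Sum>j\<in>J. \<Sum>i<k. (s i - s k) * ((a i j + b i j) / 2))"
    by (simp add: sum.distrib k_def)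
  also have "(\<Sum>j\<in>J. \<Sum>i<k. (s i - s k) * ((a i j + b i j) / 2))
      = (\<Sum>i<k. \<Sum>j\<in>J. (s i - s k) * ((a i j + b i j) / 2))"
    by (rule sum.swap)
  also have "\<dots> = (\<Sum>i<k. (s i - s k) * (((\<Sum>j\<in>J. a i j) + (\<Sum>j\<in>J. b i j)) / 2))"
    by (simp only: sum_distrib_left[symmetric] sum_divide_distrib[symmetric] sum.distrib)
  also have "(\<Sum>i<k. (s i - s k) * (((\<Sum>j\<in>J. a i j) + (\<Sum>j\<in>J. b i j)) / 2)) \<le> (\<Sum>i<k. (s i - s k) * 1)"
  proof (intro sum_mono mult_left_mono)
    fix i assume "i \<in> {..<k}"
    then show "0 \<le> s i - s k" using decseqD[OF dec, of i k] by simp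
    show "((\<Sum>j\<in>J. a i j) + (\<Sum>j\<in>J. b i j)) / 2 \<le> 1" using a1[of i] b1[of i] by simp
  qed
  finally show ?thesis by (simp add: sum_subtractf k_def)
qed

end

subsection \<open>Operators with prescribed singular values\<close>

lemma compact_closure_if_compact_approximations:
  fixes S :: "'a::{real_normed_vector, complete_space} set"
  assumes "\<And>\<epsilon>. 0 < \<epsilon> \<Longrightarrow> \<exists>K. compact K \<and> (\<forall>x\<in>S. \<exists>y\<in>K. norm (x - y) \<le> \<epsilon>)"
  shows "compact (closure S)"
  unfolding compact_eq_totally_bounded
proof (intro conjI allI impI)
  show "complete (closure S)" by (simp add: complete_eq_closed)
  fix e :: real assume "0 < e"
  then obtain K where K: "compact K" "\<And>x. x \<in> S \<Longrightarrow> \<exists>y\<in>K. norm (x - y) \<le> e / 4"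
    using assms[of "e / 4"] by auto
  obtain F where F: "finite F" "K \<subseteq> (\<Union>x\<in>F. ball x (e / 4))"
    using K(1) \<open>0 < e\<close> unfolding compact_eq_totally_bounded by (meson zero_less_divide_iff zero_less_numeral)
  have "S \<subseteq> (\<Union>x\<in>F. cball x (e / 2))"
  proof
    fix x assume "x \<in> S"
    then obtain y where y: "y \<in> K" "norm (x - y) \<le> e / 4" using K(2) by blast
    then obtain z where z: "z \<in> F" "dist z y < e / 4" using F(2) by auto
    have "dist z x \<le> dist z y + dist y x" by (rule dist_triangle)
    also have "\<dots> \<le> e / 2" using y z by (simp add: dist_norm norm_minus_commute)
    finally show "x \<in> (\<Union>x\<in>F. cball x (e / 2))" using z(1) by auto
  qed
  then have "closure S \<subseteq> (\<Union>x\<in>F. cball x (e / 2))"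
    using F(1) by (intro closure_minimal) auto
  also have "\<dots> \<subseteq> (\<Union>x\<in>F. ball x e)" using \<open>0 < e\<close> by (intro UN_mono) auto
  finally show "\<exists>k. finite k \<and> closure S \<subseteq> (\<Union>x\<in>k. ball x e)" using F(1) by blast
qed

context scalar_inner
begin

definition svd_operator :: "(nat \<Rightarrow> real) \<Rightarrow> (nat \<Rightarrow> 'a) \<Rightarrow> (nat \<Rightarrow> 'a) \<Rightarrow> 'a \<Rightarrow> 'a" where
  "svd_operator s u w x = (\<Sum>i. sc (of_real (s i) * ip x (w i)) (u i))"

context
  fixes s :: "nat \<Rightarrow> real" and u w :: "nat \<Rightarrow> 'a"
  assumes s0: "\<And>i. 0 \<le> s i" and dec: "decseq s"
    and u: "orthonormal UNIV u" and w: "orthonormal UNIV w"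
begin

text \<open>With \<open>k = 0\<close> this gives convergence of the series; for general
  \<open>k\<close> it leads to the bound on the complement of the first right vectors that
  \<open>sing_eq\<close> requires.\<close>

lemma svd_coeff_bound:
  assumes "\<And>i. i < k \<Longrightarrow> ip x (w i) = 0"
  shows "(\<Sum>i<n. (norm (of_real (s i) * ip x (w i)))\<^sup>2) \<le> (s k * norm x)\<^sup>2"
proof -
  have "(\<Sum>i<n. (norm (of_real (s i) * ip x (w i)))\<^sup>2) \<le> (\<Sum>i<n. (s k)\<^sup>2 * (norm (ip x (w i)))\<^sup>2)"
  proof (rule sum_mono)
    fix i
    show "(norm (of_real (s i) * ip x (w i)))\<^sup>2 \<le> (s k)\<^sup>2 * (norm (ip x (w i)))\<^sup>2"
    proof (cases "i < k")
      case False
      then have "(s i)\<^sup>2 \<le> (s k)\<^sup>2" using decseqD[OF dec, of k i] s0 by (intro power_mono) auto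
      then show ?thesis by (simp add: norm_mult power_mult_distrib mult_right_mono)
    qed (simp add: assms)
  qed
  also have "\<dots> = (s k)\<^sup>2 * (\<Sum>i<n. (norm (ip x (w i)))\<^sup>2)" by (simp add: sum_distrib_left)
  also have "\<dots> \<le> (s k)\<^sup>2 * (norm x)\<^sup>2"
    by (intro mult_left_mono bessel orthonormal_imp_orthogonal_units orthonormal_subset[OF w]) auto
  finally show ?thesis by (simp add: power_mult_distrib)
qed

lemma svd_summable: "summable (\<lambda>i. sc (of_real (s i) * ip x (w i)) (u i))"
  by (rule summable_orthogonal[OF orthonormal_imp_orthogonal_units[OF u] svd_coeff_bound[where k = 0]]) simp

lemma norm_svd_operator_le:
  assumes "\<And>i. i < k \<Longrightarrow> ip x (w i) = 0"
  shows "norm (svd_operator s u w x) \<le> s k * norm x"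
proof -
  have "(norm (svd_operator s u w x))\<^sup>2 \<le> (s k * norm x)\<^sup>2"
    unfolding svd_operator_def
    by (rule norm_suminf_orthogonal[OF orthonormal_imp_orthogonal_units[OF u] svd_coeff_bound[OF assms]])
  then show ?thesis using s0[of k] by (simp add: power2_le_iff_abs_le)
qed

lemma svd_operator_sc: "svd_operator s u w (sc c x) = sc c (svd_operator s u w x)"
proof -
  have "(\<lambda>i. sc c (sc (of_real (s i) * ip x (w i)) (u i))) sums sc c (svd_operator s u w x)"
    unfolding svd_operator_def by (intro bounded_linear.sums[OF sc.bounded_linear_right] summable_sums svd_summable)
  then have "(\<lambda>i. sc (of_real (s i) * ip (sc c x) (w i)) (u i)) sums sc c (svd_operator s u w x)"
    by (simp add: ip_sc_left vs.scale_scale mult_ac)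
  then show ?thesis unfolding svd_operator_def[of s u w "sc c x"] by (simp add: sums_iff)
qed

lemma bounded_linear_svd_operator: "bounded_linear (svd_operator s u w)"
proof (rule bounded_linear_intro)
  fix x y
  have "(\<lambda>i. sc (of_real (s i) * ip x (w i)) (u i) + sc (of_real (s i) * ip y (w i)) (u i))
      sums (svd_operator s u w x + svd_operator s u w y)"
    unfolding svd_operator_def by (intro sums_add summable_sums svd_summable)
  then have "(\<lambda>i. sc (of_real (s i) * ip (x + y) (w i)) (u i)) sums (svd_operator s u w x + svd_operator s u w y)"
    by (simp add: ip_add_left distrib_left vs.scale_left_distrib)
  then show "svd_operator s u w (x + y) = svd_operator s u w x + svd_operator s u w y"
    unfolding svd_operator_def[of s u w "x + y"] by (simp add: sums_iff)
next
  fix r x show "svd_operator s u w (r *\<^sub>R x) = r *\<^sub>R svd_operator s u w x"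
    using svd_operator_sc[of "of_real r" x] by (simp add: sc_of_real)
next
  fix x show "norm (svd_operator s u w x) \<le> norm x * s 0"
    using norm_svd_operator_le[of 0 x] by (simp add: mult.commute)
qed

lemma svd_operator_right_vector: "svd_operator s u w (w i) = s i *\<^sub>R u i"
proof -
  have "(\<lambda>j. sc (of_real (s j) * ip (w i) (w j)) (u j)) = (\<lambda>j. if j = i then s j *\<^sub>R u j else 0)"
    using w by (auto simp: orthonormal_def sc_of_real)
  then have "(\<lambda>j. sc (of_real (s j) * ip (w i) (w j)) (u j)) sums (s i *\<^sub>R u i)"
    using sums_single[of i "\<lambda>j. s j *\<^sub>R u j"] by simp
  then show ?thesis unfolding svd_operator_def by (simp add: sums_iff)
qed

lemma ip_svd_operator:
  "(\<lambda>i. of_real (s i) * (ip x (w i) * ip (u i) y)) sums ip (svd_operator s u w x) y"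
  using ip_suminf_left[OF svd_summable, of x y] by (simp add: svd_operator_def ip_sc_left mult_ac)

lemma compact_combinations:
  "compact {\<Sum>i<n. sc (c i) (u i) |c. \<forall>i<n. norm (c i) \<le> M}"
proof (induction n)
  case (Suc n)
  let ?K = "{\<Sum>i<n. sc (c i) (u i) |c. \<forall>i<n. norm (c i) \<le> M}"
  let ?L = "(\<lambda>a. sc a (u n)) ` cball 0 M"
  have "compact ?L"
    by (intro compact_continuous_image compact_cball sc.continuous_on continuous_on_id continuous_on_const)
  then have "compact {x + y |x y. x \<in> ?K \<and> y \<in> ?L}" by (intro compact_sums Suc)
  also have "{x + y |x y. x \<in> ?K \<and> y \<in> ?L} = {\<Sum>i<Suc n. sc (c i) (u i) |c. \<forall>i<Suc n. norm (c i) \<le> M}"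
  proof (intro set_eqI iffI)
    fix z assume "z \<in> {x + y |x y. x \<in> ?K \<and> y \<in> ?L}"
    then obtain c a where c: "\<forall>i<n. norm (c i) \<le> M" "norm a \<le> M"
      "z = (\<Sum>i<n. sc (c i) (u i)) + sc a (u n)" by auto
    then have "z = (\<Sum>i<Suc n. sc ((c(n := a)) i) (u i)) \<and> (\<forall>i<Suc n. norm ((c(n := a)) i) \<le> M)"
      by (auto simp: less_Suc_eq)
    then show "z \<in> {\<Sum>i<Suc n. sc (c i) (u i) |c. \<forall>i<Suc n. norm (c i) \<le> M}" by blast
  next
    fix z assume "z \<in> {\<Sum>i<Suc n. sc (c i) (u i) |c. \<forall>i<Suc n. norm (c i) \<le> M}"
    then obtain c where c: "\<forall>i<Suc n. norm (c i) \<le> M" "z = (\<Sum>i<n. sc (c i) (u i)) + sc (c n) (u n)" by auto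
    have "(\<Sum>i<n. sc (c i) (u i)) \<in> ?K" using c(1) by (auto simp: less_Suc_eq)
    moreover have "sc (c n) (u n) \<in> ?L" using c(1) by auto
    ultimately show "z \<in> {x + y |x y. x \<in> ?K \<and> y \<in> ?L}" using c(2) by blast
  qed
  finally show ?case .
qed simp

text \<open>Replacing \<open>x\<close> by its projection onto the first \<open>n\<close> right
  vectors changes the value by at most \<open>s n\<close>, and the projected values lie in a compact
  set of combinations of finitely many \<open>u i\<close>.\<close>

lemma compact_svd_operator:
  assumes lim: "s \<longlonglongrightarrow> 0"
  shows "compact (closure (svd_operator s u w ` cball 0 1))"
proof (rule compact_closure_if_compact_approximations)
  fix \<epsilon> :: real assume "0 < \<epsilon>"
  then obtain n where n: "s n < \<epsilon>"
    using order_tendstoD(2)[OF lim] by (metis eventually_sequentially order_refl)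
  define K where "K = {\<Sum>i<n. sc (c i) (u i) |c. \<forall>i<n. norm (c i) \<le> s 0}"
  interpret S: bounded_linear "svd_operator s u w" by (rule bounded_linear_svd_operator)
  have "\<exists>y\<in>K. norm (svd_operator s u w x - y) \<le> \<epsilon>" if x: "norm x \<le> 1" for x
  proof -
    define p where "p = proj {..<n} w x"
    have ou: "orthogonal_units {..<n} w"
      using orthonormal_imp_orthogonal_units[OF orthonormal_subset[OF w]] by blast
    have "svd_operator s u w p = (\<Sum>i<n. sc (ip x (w i) * of_real (s i)) (u i))"
      by (simp add: p_def proj_def S.sum svd_operator_sc svd_operator_right_vector sc_of_real[symmetric]
          vs.scale_scale)
    moreover have "norm (ip x (w i) * of_real (s i)) \<le> s 0" for i
    proof -
      have "norm (ip x (w i)) \<le> norm x * norm (w i)" by (rule norm_ip_le)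
      also have "\<dots> \<le> 1" using x orthonormal_norm[OF w, of i] by simp
      finally have "norm (ip x (w i)) * s i \<le> 1 * s 0"
        using decseqD[OF dec, of 0 i] s0 by (intro mult_mono) auto
      then show ?thesis using s0[of i] by (simp add: norm_mult)
    qed
    ultimately have "svd_operator s u w p \<in> K" unfolding K_def by auto
    moreover have "norm (svd_operator s u w x - svd_operator s u w p) \<le> \<epsilon>"
    proof -
      have "norm (svd_operator s u w (x - p)) \<le> s n * norm (x - p)"
        unfolding p_def by (intro norm_svd_operator_le ip_diff_proj[OF ou]) auto
      also have "\<dots> \<le> s n * 1"
      proof (intro mult_left_mono s0)
        have "(norm (x - p))\<^sup>2 \<le> (norm x)\<^sup>2"
          unfolding p_def by (subst norm_diff_proj[OF ou]) (auto intro: sum_nonneg)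
        then have "norm (x - p) \<le> norm x" by (simp add: power2_le_iff_abs_le)
        then show "norm (x - p) \<le> 1" using x by simp
      qed
      finally show ?thesis using n by (simp add: S.diff)
    qed
    ultimately show ?thesis by blast
  qed
  then have "\<forall>x\<in>svd_operator s u w ` cball 0 1. \<exists>y\<in>K. norm (x - y) \<le> \<epsilon>" by auto
  moreover have "compact K" unfolding K_def by (rule compact_combinations)
  ultimately show "\<exists>K. compact K \<and> (\<forall>x\<in>svd_operator s u w ` cball 0 1. \<exists>y\<in>K. norm (x - y) \<le> \<epsilon>)"
    by blast
qed

end

lemma adjoint_pair_svd_operator:
  assumes "\<And>i. 0 \<le> s i" "decseq s" "orthonormal UNIV u" "orthonormal UNIV w"
  shows "adjoint_pair (svd_operator s u w) (svd_operator s w u)"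
  unfolding adjoint_pair_def
proof (intro allI)
  fix x y
  have "(\<lambda>i. of_real (s i) * (ip x (w i) * ip (u i) y)) sums ip (svd_operator s u w x) y"
    by (intro ip_svd_operator assms)
  moreover have "(\<lambda>i. of_real (s i) * (ip x (w i) * ip (u i) y)) sums ip x (svd_operator s w u y)"
  proof -
    have "(\<lambda>i. ip x (sc (of_real (s i) * ip y (u i)) (w i))) sums ip x (svd_operator s w u y)"
      unfolding svd_operator_def by (intro ip_suminf_right svd_summable assms)
    moreover have "ip x (sc (of_real (s i) * ip y (u i)) (w i)) = of_real (s i) * (ip x (w i) * ip (u i) y)" for i
      using ip_commute[of "u i" y] by (simp add: ip_sc_right cj_mult cj_of_real mult_ac)
    ultimately show ?thesis by simp
  qed
  ultimately show "ip (svd_operator s u w x) y = ip x (svd_operator s w u y)" by (rule sums_unique2)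
qed

lemma sing_svd_operator:
  assumes "\<And>i. 0 \<le> s i" "decseq s" "orthonormal UNIV u" "orthonormal UNIV w"
  shows "sing (svd_operator s u w) = s"
proof (rule sing_eq[where T = "svd_operator s w u"])
  fix i
  have "bounded_linear (svd_operator s w u)" by (intro bounded_linear_svd_operator assms)
  then show "svd_operator s w u (svd_operator s u w (w i)) = sc (of_real ((s i)\<^sup>2)) (w i)"
    using svd_operator_right_vector[OF assms, of i]
      svd_operator_right_vector[OF assms(1,2,4,3), of i]
    by (simp only: sc_of_real bounded_linear.linear linear_scale) (simp add: power2_eq_square)
qed (intro adjoint_pair_svd_operator bounded_linear_svd_operator norm_svd_operator_le assms; assumption)+

lemma basis_series:
  fixes e :: "nat \<Rightarrow> 'a" and R :: "nat \<Rightarrow> nat \<Rightarrow> real"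
  assumes e: "orthonormal UNIV e"
    and R: "\<And>i i'. i \<in> I \<Longrightarrow> i' \<in> I \<Longrightarrow> ((\<lambda>j. R i j * R i' j) has_sum of_bool (i = i')) UNIV"
  shows "\<exists>u. orthonormal I u \<and> (\<forall>i\<in>I. \<forall>j. ip (u i) (e j) = of_real (R i j))"
proof -
  define u where "u i = (\<Sum>j. sc (of_real (R i j)) (e j))" for i
  have sums: "(\<lambda>j. R i j * R i' j) sums of_bool (i = i')" if "i \<in> I" "i' \<in> I" for i i'
    using has_sum_imp_sums[OF R[OF that]] .
  have bnd: "(\<Sum>j<n. (norm (of_real (R i j) :: 'f))\<^sup>2) \<le> 1" if "i \<in> I" for i n
  proof -
    have "(\<Sum>j<n. R i j * R i j) \<le> (\<Sum>j. R i j * R i j)"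
      using sums[OF that that] by (intro sum_le_suminf) (auto simp: sums_iff)
    also have "\<dots> = 1" using sums[OF that that] by (simp add: sums_iff)
    finally show ?thesis by (simp add: power2_eq_square)
  qed
  have S: "(\<lambda>j. ip (sc (of_real (R i j)) (e j)) y) sums ip (u i) y" if "i \<in> I" for i y
    unfolding u_def
    by (intro ip_suminf_left summable_orthogonal[OF orthonormal_imp_orthogonal_units[OF e] bnd[OF that]])
  have ue: "ip (u i) (e j) = of_real (R i j)" if "i \<in> I" for i j
  proof -
    have "(\<lambda>k. ip (sc (of_real (R i k)) (e k)) (e j)) = (\<lambda>k. if k = j then of_real (R i k) else 0)"
      using e by (auto simp: ip_sc_left orthonormal_def)
    then show ?thesis using S[OF that, of "e j"] sums_single[of j "\<lambda>k. of_real (R i k) :: 'f"] sums_unique2 by metis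
  qed
  have "ip (u i) (u i') = of_bool (i = i')" if "i \<in> I" "i' \<in> I" for i i'
  proof -
    have "ip (e j) (u i') = of_real (R i' j)" for j
      using ip_commute[of "e j" "u i'"] ue[OF that(2)] by (simp add: cj_of_real)
    then have "(\<lambda>j. of_real (R i j * R i' j)) sums ip (u i) (u i')"
      using S[OF that(1), of "u i'"] by (simp add: ip_sc_left)
    moreover have "(\<lambda>j. of_real (R i j * R i' j)) sums (of_real (of_bool (i = i')) :: 'f)"
      by (rule sums_of_real[OF sums[OF that]])
    ultimately show ?thesis using sums_unique2 by fastforce
  qed
  then show ?thesis using ue by (intro exI[of _ u]) (simp add: orthonormal_def)
qed

theorem diagonal_iff_majorized:
  fixes s :: "nat \<Rightarrow> real" and d :: "nat \<Rightarrow> 'f"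
  assumes s0: "\<And>i. 0 \<le> s i" and dec: "decseq s" and lim: "s \<longlonglongrightarrow> 0" and d: "d \<longlonglongrightarrow> 0"
    and sep: "separable_space (euclidean :: 'a topology)"
    and inf: "\<nexists>B. finite B \<and> vs.span B = UNIV"
  shows "(\<exists>A. bounded_linear A \<and> compact (closure (A ` cball 0 1)) \<and> (\<forall>c x. A (sc c x) = sc c (A x)) \<and>
      sing A = s \<and> (\<exists>e. basis e \<and> (\<forall>j. ip (A (e j)) (e j) = d j)))
    \<longleftrightarrow> (\<forall>k. (\<Sum>i<k. rearrangement (\<lambda>j. norm (d j)) i) \<le> (\<Sum>i<k. s i))" (is "?L \<longleftrightarrow> ?R")
proof -
  have lim0: "(\<lambda>j. norm (d j)) \<longlonglongrightarrow> 0" using d by (rule tendsto_norm_zero)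
  have R: "?R \<longleftrightarrow> (\<forall>J. finite J \<longrightarrow> (\<Sum>j\<in>J. norm (d j)) \<le> (\<Sum>i<card J. s i))"
    using rearrangement_sum_le_iff[of "\<lambda>j. norm (d j)" "\<lambda>k. \<Sum>i<k. s i", OF _ lim0] by simp
  show ?thesis
  proof
    assume ?L
    then obtain A e where A: "bounded_linear A" "compact (closure (A ` cball 0 1))" "\<And>c x. A (sc c x) = sc c (A x)"
      "sing A = s" and e: "basis e" "\<And>j. ip (A (e j)) (e j) = d j" by blast
    obtain T where T: "adjoint_pair A T" using adjoint_exists[OF A(1,3) e(1)] by blast
    obtain v where v: "orthonormal UNIV v" "\<And>i. T (A (v i)) = sc (of_real ((s i)\<^sup>2)) (v i)"
      "\<And>k x. (\<forall>i<k. ip x (v i) = 0) \<longrightarrow> norm (A x) \<le> s k * norm x"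
      using singular_vectors[OF T A(1,2) inf] unfolding A(4) by metis
    have "(\<Sum>j\<in>J. norm (d j)) \<le> (\<Sum>i<card J. s i)" if J: "finite J" for J
    proof -
      have on: "orthonormal J e" using e(1) orthonormal_subset by (auto simp: basis_def)
      have "(\<Sum>j\<in>J. norm (ip (A (e j)) (e j))) \<le> (\<Sum>i<card J. s i)"
        by (rule diagonal_sum_le[OF T A(1,3) v(1,2) s0 dec _ J on]) (use v(3) in blast)
      then show ?thesis by (simp add: e(2))
    qed
    then show ?R using R by blast
  next
    assume ?R
    then have maj: "\<And>J. finite J \<Longrightarrow> (\<Sum>j\<in>J. norm (d j)) \<le> (\<Sum>i<card J. s i)" using R by blast
    \<comment> \<open>Orthonormality is known for these rows. They form an initial segment because
      \<open>s\<close> decreases, so their vectors can be extended to all indices.\<close>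
    define I where "I = {i. 0 < s i}"
    have I: "\<forall>i\<in>I. {..i} \<subseteq> I"
      using decseqD[OF dec] by (auto simp: I_def intro: less_le_trans)
    have "\<exists>U W :: nat \<Rightarrow> nat \<Rightarrow> real.
      (\<forall>i i'. 0 < s i \<longrightarrow> 0 < s i' \<longrightarrow> ((\<lambda>j. U i j * U i' j) has_sum of_bool (i = i')) UNIV) \<and>
      (\<forall>i i'. 0 < s i \<longrightarrow> 0 < s i' \<longrightarrow> ((\<lambda>j. W i j * W i' j) has_sum of_bool (i = i')) UNIV) \<and>
      (\<forall>j. (\<lambda>i. s i * (U i j * W i j)) sums norm (d j))"
      by (rule diagonal_from_orthonormal_rows[OF dec s0 lim _ lim0]) (use maj in auto)
    then obtain U W :: "nat \<Rightarrow> nat \<Rightarrow> real" where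
      "\<forall>i i'. 0 < s i \<longrightarrow> 0 < s i' \<longrightarrow> ((\<lambda>j. U i j * U i' j) has_sum of_bool (i = i')) UNIV"
      "\<forall>i i'. 0 < s i \<longrightarrow> 0 < s i' \<longrightarrow> ((\<lambda>j. W i j * W i' j) has_sum of_bool (i = i')) UNIV"
      and UW: "\<forall>j. (\<lambda>i. s i * (U i j * W i j)) sums norm (d j)"
      by (elim exE conjE)
    then have
      U: "\<And>i i'. i \<in> I \<Longrightarrow> i' \<in> I \<Longrightarrow> ((\<lambda>j. U i j * U i' j) has_sum of_bool (i = i')) UNIV" and
      W: "\<And>i i'. i \<in> I \<Longrightarrow> i' \<in> I \<Longrightarrow> ((\<lambda>j. W i j * W i' j) has_sum of_bool (i = i')) UNIV"
      by (simp_all add: I_def)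
    obtain e where e: "basis e" using basis_exists[OF sep inf] by blast
    then have one: "orthonormal UNIV e" by (simp add: basis_def)
    \<comment> \<open>Unimodular phases, set to 1 at zero entries. Expanding \<open>u\<close> in the
      basis \<open>e'\<close> instead of \<open>e\<close> multiplies the \<open>j\<close>-th
      diagonal entry by \<open>cj (\<omega> j)\<close>, turning \<open>norm (d j)\<close> into
      \<open>d j\<close>.\<close>
    define \<omega> where "\<omega> j = (if d j = 0 then 1 else cj (d j) / of_real (norm (d j)))" for j
    have cj_inverse_real: "cj (a / of_real r) = cj a / of_real r" for a r
      using cj_mult[of a "of_real (1 / r)"] cj_of_real[of "1 / r"] by (simp add: divide_inverse)
    have \<omega>: "norm (\<omega> j) = 1" "cj (\<omega> j) * of_real (norm (d j)) = d j" for j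
      by (auto simp: \<omega>_def norm_divide cj_inverse_real cj_cj)
    define e' where "e' j = sc (cj (\<omega> j)) (e j)" for j
    have one': "orthonormal UNIV e'"
      unfolding orthonormal_iff
      using orthonormal_norm[OF one] one
      by (auto simp: e'_def norm_sc \<omega> ip_sc_left ip_sc_right orthonormal_def)
    have "\<exists>u0. orthonormal I u0 \<and> (\<forall>i\<in>I. \<forall>j. ip (u0 i) (e' j) = of_real (U i j))"
      by (rule basis_series[OF one' U])
    then obtain u0 where u0: "orthonormal I u0" "\<forall>i\<in>I. \<forall>j. ip (u0 i) (e' j) = of_real (U i j)"
      by (elim exE conjE)
    have "\<exists>w0. orthonormal I w0 \<and> (\<forall>i\<in>I. \<forall>j. ip (w0 i) (e j) = of_real (W i j))"
      by (rule basis_series[OF one W])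
    then obtain w0 where w0: "orthonormal I w0" "\<forall>i\<in>I. \<forall>j. ip (w0 i) (e j) = of_real (W i j)"
      by (elim exE conjE)
    obtain u where u: "orthonormal UNIV u" "\<forall>i. i \<in> I \<longrightarrow> u i = u0 i"
      using extend_orthonormal[OF inf u0(1) I] by (elim exE conjE)
    obtain w where w: "orthonormal UNIV w" "\<forall>i. i \<in> I \<longrightarrow> w i = w0 i"
      using extend_orthonormal[OF inf w0(1) I] by (elim exE conjE)
    have diag: "ip (svd_operator s u w (e j)) (e j) = d j" for j
    proof -
      have "of_real (s i) * (ip (e j) (w i) * ip (u i) (e j)) = cj (\<omega> j) * of_real (s i * (U i j * W i j))" for i
      proof (cases "i \<in> I")
        case True
        have 1: "ip (e j) (w i) = of_real (W i j)"
          using ip_commute[of "e j" "w i"] w(2) w0(2) True by (simp add: cj_of_real)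
        have "\<omega> j * ip (u i) (e j) = of_real (U i j)"
          using u(2) u0(2) True by (simp add: e'_def ip_sc_right cj_cj)
        moreover have "cj (\<omega> j) * \<omega> j = 1" using mult_cj[of "\<omega> j"] \<omega>(1)[of j] by (simp add: mult.commute)
        ultimately have "ip (u i) (e j) = cj (\<omega> j) * of_real (U i j)"
          by (metis mult.assoc mult_1)
        then show ?thesis by (simp add: 1 mult_ac)
      next
        case False
        then have "s i = 0" using s0[of i] by (simp add: I_def)
        then show ?thesis by simp
      qed
      then have "(\<lambda>i. cj (\<omega> j) * of_real (s i * (U i j * W i j))) sums ip (svd_operator s u w (e j)) (e j)"
        using ip_svd_operator[OF s0 dec u(1) w(1), of "e j" "e j"] by (simp only:)
      moreover have "(\<lambda>i. cj (\<omega> j) * of_real (s i * (U i j * W i j))) sums (cj (\<omega> j) * of_real (norm (d j)))"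
        by (intro sums_mult sums_of_real UW[rule_format])
      ultimately show ?thesis using \<omega>(2) sums_unique2 by metis
    qed
    show ?L
    proof (intro exI conjI allI)
      show "bounded_linear (svd_operator s u w)" by (intro bounded_linear_svd_operator s0 dec u w)
      show "compact (closure (svd_operator s u w ` cball 0 1))" by (intro compact_svd_operator s0 dec u w lim)
      show "svd_operator s u w (sc c x) = sc c (svd_operator s u w x)" for c x
        by (intro svd_operator_sc s0 dec u w)
      show "sing (svd_operator s u w) = s" by (intro sing_svd_operator s0 dec u w)
      show "basis e" by (rule e)
      show "ip (svd_operator s u w (e j)) (e j) = d j" for j by (rule diag)
    qed
  qed
qed

end

subsection \<open>The complex and the real case\<close>

interpretation complex_scalar: scalar_inner
  "scaleC :: complex \<Rightarrow> 'a::{complex_inner, complete_space} \<Rightarrow> 'a" cinner cnj Re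
proof (intro_locales)
  show "vector_space (scaleC :: complex \<Rightarrow> 'a \<Rightarrow> 'a)" by (rule vector_space_scaleC)
  show "scalar_inner_axioms (scaleC :: complex \<Rightarrow> 'a \<Rightarrow> 'a) cinner cnj Re"
  proof
    fix a :: complex
    show "cnj a = a \<Longrightarrow> a = of_real (Re a)" by (simp add: complex_eq_iff)
    show "a * cnj a = of_real ((norm a)\<^sup>2)" by (simp add: complex_mult_cnj cmod_power2)
  qed (simp_all add: cinner_add_left cinner_scaleC_left scaleC_of_real Re_cinner flip: cinner_commute)
qed

interpretation real_scalar: scalar_inner
  "scaleR :: real \<Rightarrow> 'a::{real_inner, complete_space} \<Rightarrow> 'a" inner id id
proof
  fix x y :: 'a
  show "inner x y = id (inner y x)" by (simp add: inner_commute)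
qed (simp_all add: inner_add_left power2_eq_square)

theorem theorem3p9:
  fixes s :: "nat \<Rightarrow> real" and d :: "nat \<Rightarrow> complex"
  assumes "\<forall>i. 0 \<le> s i" and "decseq s" and "s \<longlonglongrightarrow> 0" and "d \<longlonglongrightarrow> 0"
  shows "(separable_space (euclidean :: 'h::{complex_inner, complete_space} topology) \<and>
          \<not> (\<exists>B :: 'h set. finite B \<and> cspan B = UNIV) \<longrightarrow>
          ((\<exists>A :: 'h \<Rightarrow> 'h.
              ccompact_operator A \<and> csingular_values A = s \<and> cdiagonal A d) \<longleftrightarrow>
           (\<forall>k. (\<Sum>i<k. rearrangement (\<lambda>j. cmod (d j)) i) \<le> (\<Sum>i<k. s i)))) \<and>
         (separable_space (euclidean :: 'r::{real_inner, complete_space} topology) \<and>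
          \<not> (\<exists>B :: 'r set. finite B \<and> span B = UNIV) \<and>
          (\<forall>j. d j \<in> \<real>) \<longrightarrow>
          ((\<exists>A :: 'r \<Rightarrow> 'r.
              compact_operator A \<and> singular_values A = s \<and> diagonal A (\<lambda>j. Re (d j))) \<longleftrightarrow>
           (\<forall>k. (\<Sum>i<k. rearrangement (\<lambda>j. cmod (d j)) i) \<le> (\<Sum>i<k. s i))))"
proof (intro conjI impI)
  note s = assms(1)[rule_format] assms(2,3)
  {
    assume "separable_space (euclidean :: 'h topology) \<and> \<not> (\<exists>B :: 'h set. finite B \<and> cspan B = UNIV)"
    then have sep: "separable_space (euclidean :: 'h topology)"
      and inf: "\<nexists>B :: 'h set. finite B \<and> module.span scaleC B = UNIV"
      by (simp_all add: cspan_def)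
    have sing: "csingular_values A = complex_scalar.sing A" for A :: "'h \<Rightarrow> 'h"
      by (simp add: csingular_values_def complex_scalar.sing_def complex_scalar.adj_def
          cadjoint_def cindependent_def)
    have diag: "cdiagonal A d \<longleftrightarrow> (\<exists>e. complex_scalar.basis e \<and> (\<forall>j. cinner (A (e j)) (e j) = d j))"
      for A :: "'h \<Rightarrow> 'h"
      by (simp add: cdiagonal_def conb_def complex_scalar.basis_def complex_scalar.orthonormal_def cspan_def)
    have cpt: "ccompact_operator A \<longleftrightarrow> bounded_linear A \<and> compact (closure (A ` cball 0 1)) \<and>
        (\<forall>c x. A (c *\<^sub>C x) = c *\<^sub>C A x)" for A :: "'h \<Rightarrow> 'h"
      by (simp add: ccompact_operator_def compact_operator_def)
    show "(\<exists>A :: 'h \<Rightarrow> 'h. ccompact_operator A \<and> csingular_values A = s \<and> cdiagonal A d) \<longleftrightarrow>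
        (\<forall>k. (\<Sum>i<k. rearrangement (\<lambda>j. cmod (d j)) i) \<le> (\<Sum>i<k. s i))"
      unfolding sing diag cpt conj_assoc
      by (rule complex_scalar.diagonal_iff_majorized[OF s assms(4) sep inf])
  }
  {
    assume "separable_space (euclidean :: 'r topology) \<and> \<not> (\<exists>B :: 'r set. finite B \<and> span B = UNIV) \<and>
      (\<forall>j. d j \<in> \<real>)"
    then have sep: "separable_space (euclidean :: 'r topology)"
      and inf: "\<nexists>B :: 'r set. finite B \<and> module.span scaleR B = UNIV"
      and real: "\<And>j. d j \<in> \<real>"
      by (simp_all add: span_raw_def)
    have norm: "cmod (d j) = norm (Re (d j))" for j
      using real[of j] by (auto elim: Reals_cases)
    have "(\<lambda>j. Re (d j)) \<longlonglongrightarrow> 0" using tendsto_Re[OF assms(4)] by simp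
    have sing: "singular_values A = real_scalar.sing A" for A :: "'r \<Rightarrow> 'r"
      by (simp add: singular_values_def real_scalar.sing_def real_scalar.adj_def
          adjoint_def dependent_raw_def)
    have diag: "diagonal A (\<lambda>j. Re (d j)) \<longleftrightarrow>
        (\<exists>e. real_scalar.basis e \<and> (\<forall>j. inner (A (e j)) (e j) = Re (d j)))" for A :: "'r \<Rightarrow> 'r"
      by (simp add: diagonal_def onb_def real_scalar.basis_def real_scalar.orthonormal_def span_raw_def)
    \<comment> \<open>Over the reals homogeneity is part of \<open>bounded_linear\<close>, so the
      homogeneity conjunct of the common theorem comes for free.\<close>
    have cpt: "compact_operator A \<longleftrightarrow> bounded_linear A \<and> compact (closure (A ` cball 0 1)) \<and>
        (\<forall>c x. A (c *\<^sub>R x) = c *\<^sub>R A x)" for A :: "'r \<Rightarrow> 'r"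
      by (auto simp: compact_operator_def bounded_linear.linear linear_scale)
    show "(\<exists>A :: 'r \<Rightarrow> 'r. compact_operator A \<and> singular_values A = s \<and> diagonal A (\<lambda>j. Re (d j))) \<longleftrightarrow>
        (\<forall>k. (\<Sum>i<k. rearrangement (\<lambda>j. cmod (d j)) i) \<le> (\<Sum>i<k. s i))"
      unfolding sing diag cpt conj_assoc norm
      by (rule real_scalar.diagonal_iff_majorized[OF s \<open>(\<lambda>j. Re (d j)) \<longlonglongrightarrow> 0\<close> sep inf])
  }
qed

end
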